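(* Let $K$ be a differentially closed field of characteristic zero. If $\varphi\colon X\to Y$ is a dominant morphism of irreducible differential algebraic varieties over $K$, then there is a nonempty open set $U\subseteq X$ such that the restriction $\varphi|_U\colon U\to Y$ is an open map.
   Context: $K$ is a field with a finite set $\Delta$ of pairwise commuting derivations which is differentially closed: every finite system of differential polynomial equations and inequations over $K$ that has a solution in some differential extension field of $K$ has a solution in $K$. $K\{y_1,\dots,y_n\}$ is the ring of differential polynomials over $K$. A differential algebraic variety is a set $V(\mathfrak a)\subseteq K^n$ of common zeros of a differential ideal $\mathfrak a\subseteq K\{y_1,\dots,y_n\}$; it carries the topology (Kolchin topology) whose closed subsets are the zero sets of differential polynomials, and openness, irreducibility and density refer to this topology. A regular function on $X\subseteq K^n$ is a function $X\to K$ which, in a neighborhood of each point of $X$, equals a quotient $P/Q$ of differential polynomials with $Q$ nowhere zero on that neighborhood. A morphism $X\to Y\subseteq K^m$ is a map whose $m$ coordinate functions are regular functions on $X$. A morphism is dominant if its image is dense in $Y$. A map is open if it takes open sets to open sets. *)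

theory Defs
  imports "HOL-Analysis.Abstract_Topology" "HOL-Algebra.Ring" "HOL-Library.Poly_Mapping"
    "HOL-Library.Multiset"
begin

section \<open>Derivative operators and differential fields\<close>

text \<open>
  The set \<open>\<Delta>\<close> is a finite set of derivation symbols; the base field \<open>K\<close> is the whole type \<open>'a\<close>,
  on which \<open>j \<in> \<Delta>\<close> acts as \<open>\<delta> j\<close>. Commutative words in \<open>\<Delta>\<close> (the derivative operators) are
  multisets over \<open>\<Delta>\<close>.
\<close>

definition ders :: "('d \<Rightarrow> 'b \<Rightarrow> 'b) \<Rightarrow> 'd multiset \<Rightarrow> 'b \<Rightarrow> 'b" where
  "ders D \<theta> a = fold_mset D a \<theta>"

definition differential_field :: "'d set \<Rightarrow> ('d \<Rightarrow> 'a::field \<Rightarrow> 'a) \<Rightarrow> bool" where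
  "differential_field \<Delta> \<delta> \<longleftrightarrow>
     finite \<Delta> \<and>
     (\<forall>j\<in>\<Delta>. \<forall>a b. \<delta> j (a + b) = \<delta> j a + \<delta> j b \<and> \<delta> j (a * b) = \<delta> j a * b + a * \<delta> j b) \<and>
     (\<forall>i\<in>\<Delta>. \<forall>j\<in>\<Delta>. \<forall>a. \<delta> i (\<delta> j a) = \<delta> j (\<delta> i a))"

text \<open>A differential field \<open>L\<close>, with derivations \<open>e\<close>, extending \<open>K\<close> along an embedding \<open>h\<close>.\<close>

definition differential_extension ::
  "'d set \<Rightarrow> ('d \<Rightarrow> 'a::field \<Rightarrow> 'a) \<Rightarrow> 'b ring \<Rightarrow> ('d \<Rightarrow> 'b \<Rightarrow> 'b) \<Rightarrow> ('a \<Rightarrow> 'b) \<Rightarrow> bool" where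
  "differential_extension \<Delta> \<delta> L e h \<longleftrightarrow>
     field L \<and>
     (\<forall>j\<in>\<Delta>. e j \<in> carrier L \<rightarrow> carrier L) \<and>
     (\<forall>j\<in>\<Delta>. \<forall>a\<in>carrier L. \<forall>b\<in>carrier L.
        e j (a \<oplus>\<^bsub>L\<^esub> b) = e j a \<oplus>\<^bsub>L\<^esub> e j b \<and>
        e j (a \<otimes>\<^bsub>L\<^esub> b) = (e j a \<otimes>\<^bsub>L\<^esub> b) \<oplus>\<^bsub>L\<^esub> (a \<otimes>\<^bsub>L\<^esub> e j b)) \<and>
     (\<forall>i\<in>\<Delta>. \<forall>j\<in>\<Delta>. \<forall>a\<in>carrier L. e i (e j a) = e j (e i a)) \<and>
     range h \<subseteq> carrier L \<and> h 1 = \<one>\<^bsub>L\<^esub> \<and>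
     (\<forall>a b. h (a + b) = h a \<oplus>\<^bsub>L\<^esub> h b \<and> h (a * b) = h a \<otimes>\<^bsub>L\<^esub> h b) \<and>
     (\<forall>j\<in>\<Delta>. \<forall>a. h (\<delta> j a) = e j (h a))"

section \<open>Differential polynomials\<close>

text \<open>The variable \<open>(i, \<theta>)\<close> stands for the derivative \<open>\<theta> y\<^sub>i\<close>; indices \<open>i\<close> start at \<open>0\<close>.\<close>

type_synonym 'd dvar = "nat \<times> 'd multiset"
type_synonym ('d, 'a) dpoly = "('d dvar \<Rightarrow>\<^sub>0 nat) \<Rightarrow>\<^sub>0 'a"

definition dpolys :: "'d set \<Rightarrow> nat \<Rightarrow> ('d, 'a::zero) dpoly set" where
  "dpolys \<Delta> n = {P. \<forall>M \<in> Poly_Mapping.keys P. \<forall>(i, \<theta>) \<in> Poly_Mapping.keys M.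
     i < n \<and> set_mset \<theta> \<subseteq> \<Delta>}"

text \<open>
  The derivation on \<open>K{y\<^sub>1, ..., y\<^sub>n}\<close> extending \<open>\<delta> j\<close> and mapping \<open>\<theta> y\<^sub>i\<close> to \<open>(j \<theta>) y\<^sub>i\<close>, by the
  Leibniz rule on each monomial.
\<close>

definition dpoly_deriv :: "('d \<Rightarrow> 'a \<Rightarrow> 'a) \<Rightarrow> 'd \<Rightarrow> ('d, 'a::comm_ring_1) dpoly \<Rightarrow> ('d, 'a) dpoly"
  where
  "dpoly_deriv \<delta> j P = (\<Sum>M \<in> Poly_Mapping.keys P.
     Poly_Mapping.single M (\<delta> j (Poly_Mapping.lookup P M)) +
     (\<Sum>(i, \<theta>) \<in> Poly_Mapping.keys M.
        Poly_Mapping.single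
          (M - Poly_Mapping.single (i, \<theta>) 1 + Poly_Mapping.single (i, add_mset j \<theta>) 1)
          (of_nat (Poly_Mapping.lookup M (i, \<theta>)) * Poly_Mapping.lookup P M)))"

definition monom_eval ::
  "('d \<Rightarrow> 'a \<Rightarrow> 'a) \<Rightarrow> (nat \<Rightarrow> 'a) \<Rightarrow> ('d dvar \<Rightarrow>\<^sub>0 nat) \<Rightarrow> 'a::comm_ring_1" where
  "monom_eval \<delta> x M =
     (\<Prod>(i, \<theta>) \<in> Poly_Mapping.keys M. ders \<delta> \<theta> (x i) ^ Poly_Mapping.lookup M (i, \<theta>))"

definition dpoly_eval ::
  "('d \<Rightarrow> 'a \<Rightarrow> 'a) \<Rightarrow> (nat \<Rightarrow> 'a) \<Rightarrow> ('d, 'a) dpoly \<Rightarrow> 'a::comm_ring_1" where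
  "dpoly_eval \<delta> x P =
     (\<Sum>M \<in> Poly_Mapping.keys P. Poly_Mapping.lookup P M * monom_eval \<delta> x M)"

text \<open>Value at a point with coordinates in an extension \<open>L\<close>, coefficients being embedded by \<open>h\<close>.\<close>

definition dpoly_eval_ext ::
  "'b ring \<Rightarrow> ('d \<Rightarrow> 'b \<Rightarrow> 'b) \<Rightarrow> ('a \<Rightarrow> 'b) \<Rightarrow> (nat \<Rightarrow> 'b) \<Rightarrow> ('d, 'a::zero) dpoly \<Rightarrow> 'b" where
  "dpoly_eval_ext L e h x P =
     (\<Oplus>\<^bsub>L\<^esub>M \<in> Poly_Mapping.keys P. h (Poly_Mapping.lookup P M) \<otimes>\<^bsub>L\<^esub>
        (\<Otimes>\<^bsub>L\<^esub>v \<in> Poly_Mapping.keys M.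
           ders e (snd v) (x (fst v)) [^]\<^bsub>L\<^esub> Poly_Mapping.lookup M v))"

section \<open>Differentially closed fields\<close>

text \<open>The set \<open>R\<^sup>n\<close> for a subset \<open>R\<close> of a type; points are \<open>undefined\<close> at indices \<open>i \<ge> n\<close>.\<close>

definition points :: "nat \<Rightarrow> 'b set \<Rightarrow> (nat \<Rightarrow> 'b) set" where
  "points n R = ({..<n} \<rightarrow>\<^sub>E R)"

text \<open>
  The extension fields \<open>L\<close> range over all differential extension fields carried by subsets of the
  type \<open>'a\<close>, i.e., up to isomorphism, all those of cardinality at most that of \<open>K\<close>. For infinite
  \<open>K\<close> (in particular in characteristic zero) this is no restriction: a solution in an arbitrary
  \<open>L\<close> lies in the differential subfield generated over \<open>K\<close> by its finitely many coordinates, which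
  has the cardinality of \<open>K\<close>.
\<close>

definition differentially_closed :: "'d set \<Rightarrow> ('d \<Rightarrow> 'a::field \<Rightarrow> 'a) \<Rightarrow> bool" where
  "differentially_closed \<Delta> \<delta> \<longleftrightarrow>
     differential_field \<Delta> \<delta> \<and>
     (\<forall>n. \<forall>F G :: ('d, 'a) dpoly set.
        finite F \<and> finite G \<and> F \<subseteq> dpolys \<Delta> n \<and> G \<subseteq> dpolys \<Delta> n \<and>
        (\<exists>(L :: 'a ring) e h. differential_extension \<Delta> \<delta> L e h \<and>
           (\<exists>x \<in> points n (carrier L).
              (\<forall>P\<in>F. dpoly_eval_ext L e h x P = \<zero>\<^bsub>L\<^esub>) \<and>
              (\<forall>Q\<in>G. dpoly_eval_ext L e h x Q \<noteq> \<zero>\<^bsub>L\<^esub>)))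
        \<longrightarrow> (\<exists>x \<in> points n UNIV. (\<forall>P\<in>F. dpoly_eval \<delta> x P = 0) \<and> (\<forall>Q\<in>G. dpoly_eval \<delta> x Q \<noteq> 0)))"

section \<open>Differential algebraic varieties and the Kolchin topology\<close>

definition zeros ::
  "('d \<Rightarrow> 'a \<Rightarrow> 'a) \<Rightarrow> nat \<Rightarrow> ('d, 'a) dpoly set \<Rightarrow> (nat \<Rightarrow> 'a::comm_ring_1) set" where
  "zeros \<delta> n S = {x \<in> points n UNIV. \<forall>P\<in>S. dpoly_eval \<delta> x P = 0}"

definition differential_ideal ::
  "'d set \<Rightarrow> ('d \<Rightarrow> 'a \<Rightarrow> 'a) \<Rightarrow> nat \<Rightarrow> ('d, 'a::comm_ring_1) dpoly set \<Rightarrow> bool" where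
  "differential_ideal \<Delta> \<delta> n I \<longleftrightarrow>
     I \<subseteq> dpolys \<Delta> n \<and> 0 \<in> I \<and> (\<forall>P\<in>I. \<forall>Q\<in>I. P + Q \<in> I) \<and>
     (\<forall>P\<in>I. \<forall>R \<in> dpolys \<Delta> n. R * P \<in> I) \<and> (\<forall>P\<in>I. \<forall>j\<in>\<Delta>. dpoly_deriv \<delta> j P \<in> I)"

definition differential_variety ::
  "'d set \<Rightarrow> ('d \<Rightarrow> 'a \<Rightarrow> 'a) \<Rightarrow> nat \<Rightarrow> (nat \<Rightarrow> 'a::comm_ring_1) set \<Rightarrow> bool" where
  "differential_variety \<Delta> \<delta> n X \<longleftrightarrow> (\<exists>I. differential_ideal \<Delta> \<delta> n I \<and> X = zeros \<delta> n I)"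

definition kolchin :: "'d set \<Rightarrow> ('d \<Rightarrow> 'a \<Rightarrow> 'a) \<Rightarrow> nat \<Rightarrow> (nat \<Rightarrow> 'a::idom) topology" where
  "kolchin \<Delta> \<delta> n = topology (\<lambda>U. \<exists>S \<subseteq> dpolys \<Delta> n. U = points n UNIV - zeros \<delta> n S)"

definition irreducible_space :: "'b topology \<Rightarrow> bool" where
  "irreducible_space T \<longleftrightarrow> topspace T \<noteq> {} \<and>
     (\<forall>A B. closedin T A \<and> closedin T B \<and> A \<union> B = topspace T \<longrightarrow> A = topspace T \<or> B = topspace T)"

definition regular_function ::
  "'d set \<Rightarrow> ('d \<Rightarrow> 'a \<Rightarrow> 'a) \<Rightarrow> nat \<Rightarrow> (nat \<Rightarrow> 'a::field) set \<Rightarrow> ((nat \<Rightarrow> 'a) \<Rightarrow> 'a) \<Rightarrow> bool" where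
  "regular_function \<Delta> \<delta> n X f \<longleftrightarrow>
     (\<forall>x\<in>X. \<exists>W. openin (subtopology (kolchin \<Delta> \<delta> n) X) W \<and> x \<in> W \<and>
        (\<exists>P \<in> dpolys \<Delta> n. \<exists>Q \<in> dpolys \<Delta> n.
           \<forall>w\<in>W. dpoly_eval \<delta> w Q \<noteq> 0 \<and> f w = dpoly_eval \<delta> w P / dpoly_eval \<delta> w Q))"

definition morphism ::
  "'d set \<Rightarrow> ('d \<Rightarrow> 'a \<Rightarrow> 'a) \<Rightarrow> nat \<Rightarrow> (nat \<Rightarrow> 'a::field) set \<Rightarrow> nat \<Rightarrow> (nat \<Rightarrow> 'a) set \<Rightarrow>
    ((nat \<Rightarrow> 'a) \<Rightarrow> (nat \<Rightarrow> 'a)) \<Rightarrow> bool" where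
  "morphism \<Delta> \<delta> n X m Y \<phi> \<longleftrightarrow>
     \<phi> \<in> X \<rightarrow> Y \<and> (\<forall>i<m. regular_function \<Delta> \<delta> n X (\<lambda>x. \<phi> x i))"

definition dominant ::
  "'d set \<Rightarrow> ('d \<Rightarrow> 'a \<Rightarrow> 'a) \<Rightarrow> (nat \<Rightarrow> 'a::field) set \<Rightarrow> nat \<Rightarrow> (nat \<Rightarrow> 'a) set \<Rightarrow>
    ((nat \<Rightarrow> 'a) \<Rightarrow> (nat \<Rightarrow> 'a)) \<Rightarrow> bool" where
  "dominant \<Delta> \<delta> X m Y \<phi> \<longleftrightarrow> subtopology (kolchin \<Delta> \<delta> m) Y closure_of (\<phi> ` X) = Y"

section \<open>Basic properties\<close>

lemma ders_add_mset_on: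
  fixes D :: "'d \<Rightarrow> 'b \<Rightarrow> 'b"
  assumes cl: "\<And>j a. j \<in> \<Delta> \<Longrightarrow> a \<in> C \<Longrightarrow> D j a \<in> C"
    and co: "\<And>i j a. i \<in> \<Delta> \<Longrightarrow> j \<in> \<Delta> \<Longrightarrow> a \<in> C \<Longrightarrow> D i (D j a) = D j (D i a)"
    and a: "a \<in> C" and \<theta>: "set_mset \<theta> \<subseteq> \<Delta>" and j: "j \<in> \<Delta>"
  shows "ders D (add_mset j \<theta>) a = D j (ders D \<theta> a)" and "ders D \<theta> a \<in> C"
proof -
  define g where "g = (\<lambda>j a. if j \<in> \<Delta> \<and> a \<in> C then D j a else a)"
  interpret g: comp_fun_commute g
  proof
    fix i j
    show "g j \<circ> g i = g i \<circ> g j"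
    proof
      fix a
      show "(g j \<circ> g i) a = (g i \<circ> g j) a"
        using cl[of i a] cl[of j a] co[of i j a] by (auto simp: g_def)
    qed
  qed
  have pow: "(g i ^^ k) b = (D i ^^ k) b \<and> (D i ^^ k) b \<in> C" if "i \<in> \<Delta>" "b \<in> C" for i k b
    by (induction k) (use that cl in \<open>auto simp: g_def\<close>)
  have 1: "fold_graph (\<lambda>i. D i ^^ c i) a A y \<Longrightarrow> A \<subseteq> \<Delta> \<Longrightarrow>
      fold_graph (\<lambda>i. g i ^^ c i) a A y \<and> y \<in> C" for A y and c :: "'d \<Rightarrow> nat"
  proof (induction rule: fold_graph.induct)
    case emptyI
    then show ?case using a by (auto intro: fold_graph.intros)
  next
    case (insertI i A y)
    have i: "i \<in> \<Delta>" and A: "A \<subseteq> \<Delta>" using insertI.prems by blast+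
    note IH = insertI.IH[OF A]
    have eq: "(g i ^^ c i) y = (D i ^^ c i) y" and C: "(D i ^^ c i) y \<in> C"
      using pow[OF i conjunct2[OF IH], of "c i"] by blast+
    show ?case
      using fold_graph.insertI[OF insertI.hyps(1) conjunct1[OF IH]] C unfolding eq by blast
  qed
  have 2: "fold_graph (\<lambda>i. g i ^^ c i) a A y \<Longrightarrow> A \<subseteq> \<Delta> \<Longrightarrow>
      fold_graph (\<lambda>i. D i ^^ c i) a A y \<and> y \<in> C" for A y and c :: "'d \<Rightarrow> nat"
  proof (induction rule: fold_graph.induct)
    case emptyI
    then show ?case using a by (auto intro: fold_graph.intros)
  next
    case (insertI i A y)
    have i: "i \<in> \<Delta>" and A: "A \<subseteq> \<Delta>" using insertI.prems by blast+
    note IH = insertI.IH[OF A]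
    have eq: "(g i ^^ c i) y = (D i ^^ c i) y" and C: "(D i ^^ c i) y \<in> C"
      using pow[OF i conjunct2[OF IH], of "c i"] by blast+
    show ?case
      using fold_graph.insertI[OF insertI.hyps(1) conjunct1[OF IH]] C unfolding eq by blast
  qed
  have eq: "ders D \<eta> a = fold_mset g a \<eta>" if "set_mset \<eta> \<subseteq> \<Delta>" for \<eta>
  proof -
    have "fold_graph (\<lambda>i. D i ^^ count \<eta> i) a (set_mset \<eta>) =
      fold_graph (\<lambda>i. g i ^^ count \<eta> i) a (set_mset \<eta>)"
      by (intro ext iffI) (use 1[OF _ that] 2[OF _ that] in blast)+
    then show ?thesis unfolding ders_def fold_mset_def Finite_Set.fold_def by simp
  qed
  have gC: "g i b \<in> C" if "b \<in> C" for i b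
    using that cl[of i b] by (auto simp: g_def)
  have C: "fold_mset g a \<eta> \<in> C" for \<eta>
    by (induction \<eta>) (use a gC in auto)
  show "ders D \<theta> a \<in> C" using C eq[OF \<theta>] by simp
  show "ders D (add_mset j \<theta>) a = D j (ders D \<theta> a)"
  proof -
    have "ders D (add_mset j \<theta>) a = g j (fold_mset g a \<theta>)"
      using eq[of "add_mset j \<theta>"] \<theta> j by simp
    also have "\<dots> = D j (fold_mset g a \<theta>)"
      using j C[of \<theta>] unfolding g_def by simp
    finally show ?thesis using eq[OF \<theta>] by simp
  qed
qed

lemma ders_empty [simp]: "ders D {#} a = a"
  by (simp add: ders_def)

lemma ders_add_mset:
  assumes "differential_field \<Delta> \<delta>" "set_mset \<theta> \<subseteq> \<Delta>" "j \<in> \<Delta>"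
  shows "ders \<delta> (add_mset j \<theta>) a = \<delta> j (ders \<delta> \<theta> a)"
  by (rule ders_add_mset_on[of \<Delta> UNIV]) (use assms in \<open>auto simp: differential_field_def\<close>)

lemma ders_add_mset_ext:
  assumes "differential_extension \<Delta> \<delta> L e h" "a \<in> carrier L" "set_mset \<theta> \<subseteq> \<Delta>" "j \<in> \<Delta>"
  shows "ders e (add_mset j \<theta>) a = e j (ders e \<theta> a)"
  by (rule ders_add_mset_on[of \<Delta> "carrier L"])
    (use assms in \<open>auto simp: differential_extension_def Pi_iff\<close>)

lemma monom_eval_superset:
  assumes "finite V" "Poly_Mapping.keys M \<subseteq> V"
  shows "monom_eval \<delta> x M = (\<Prod>(i, \<theta>) \<in> V. ders \<delta> \<theta> (x i) ^ Poly_Mapping.lookup M (i, \<theta>))"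
  unfolding monom_eval_def
  by (rule prod.mono_neutral_left) (use assms in \<open>auto simp: in_keys_iff\<close>)

lemma monom_eval_add: "monom_eval \<delta> x (M + N) = monom_eval \<delta> x M * monom_eval \<delta> x N"
proof -
  let ?V = "Poly_Mapping.keys M \<union> Poly_Mapping.keys N"
  have "Poly_Mapping.keys (M + N) \<subseteq> ?V" by (rule Poly_Mapping.keys_add)
  then show ?thesis
    by (simp add: monom_eval_superset[of ?V] lookup_add power_add prod.distrib case_prod_unfold)
qed

lemma monom_eval_0 [simp]: "monom_eval \<delta> x 0 = 1"
  by (simp add: monom_eval_def)

lemma monom_eval_single [simp]:
  "monom_eval \<delta> x (Poly_Mapping.single (i, \<theta>) k) = ders \<delta> \<theta> (x i) ^ k"
  by (subst monom_eval_superset[of "{(i, \<theta>)}"]) auto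

lemma dpoly_eval_superset:
  assumes "finite V" "Poly_Mapping.keys P \<subseteq> V"
  shows "dpoly_eval \<delta> x P = (\<Sum>M\<in>V. Poly_Mapping.lookup P M * monom_eval \<delta> x M)"
  unfolding dpoly_eval_def
  by (rule sum.mono_neutral_left) (use assms in \<open>auto simp: in_keys_iff\<close>)

lemma dpoly_eval_add: "dpoly_eval \<delta> x (P + Q) = dpoly_eval \<delta> x P + dpoly_eval \<delta> x Q"
proof -
  let ?V = "Poly_Mapping.keys P \<union> Poly_Mapping.keys Q"
  have "Poly_Mapping.keys (P + Q) \<subseteq> ?V" by (rule Poly_Mapping.keys_add)
  then show ?thesis
    by (simp add: dpoly_eval_superset[of ?V] lookup_add distrib_right sum.distrib)
qed

lemma dpoly_eval_0 [simp]: "dpoly_eval \<delta> x 0 = 0"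
  by (simp add: dpoly_eval_def)

lemma dpoly_eval_sum: "dpoly_eval \<delta> x (sum f A) = (\<Sum>a\<in>A. dpoly_eval \<delta> x (f a))"
  by (induction A rule: infinite_finite_induct) (auto simp: dpoly_eval_add)

lemma dpoly_eval_single [simp]:
  "dpoly_eval \<delta> x (Poly_Mapping.single M c) = c * monom_eval \<delta> x M"
  by (subst dpoly_eval_superset[of "{M}"]) auto

lemma dpoly_eval_1 [simp]: "dpoly_eval \<delta> x 1 = 1"
  using dpoly_eval_single[of \<delta> x 0 1] by simp

lemma dpoly_eq_sum:
  "P = (\<Sum>M \<in> Poly_Mapping.keys P. Poly_Mapping.single M (Poly_Mapping.lookup P M))"
  by (rule poly_mapping_eqI)
    (auto simp: lookup_sum lookup_single when_def in_keys_iff sum.delta)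

lemma dpoly_eval_mult: "dpoly_eval \<delta> x (P * Q) = dpoly_eval \<delta> x P * dpoly_eval \<delta> x Q"
proof -
  have "dpoly_eval \<delta> x (P * Q) = dpoly_eval \<delta> x
     ((\<Sum>M \<in> Poly_Mapping.keys P. Poly_Mapping.single M (Poly_Mapping.lookup P M)) *
      (\<Sum>M \<in> Poly_Mapping.keys Q. Poly_Mapping.single M (Poly_Mapping.lookup Q M)))"
    using dpoly_eq_sum[of P] dpoly_eq_sum[of Q] by simp
  also have "\<dots> = dpoly_eval \<delta> x P * dpoly_eval \<delta> x Q"
    unfolding sum_product dpoly_eval_sum mult_single dpoly_eval_single monom_eval_add
    by (simp add: dpoly_eval_def sum_product mult_ac)
  finally show ?thesis .
qed

lemma dpolys_0 [simp]: "0 \<in> dpolys \<Delta> n"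
  by (simp add: dpolys_def)

lemma dpolys_1 [simp]: "1 \<in> dpolys \<Delta> n"
  by (simp add: dpolys_def)

lemma dpolysD:
  assumes "P \<in> dpolys \<Delta> n" "M \<in> Poly_Mapping.keys P" "(i, \<theta>) \<in> Poly_Mapping.keys M"
  shows "i < n" "set_mset \<theta> \<subseteq> \<Delta>"
  using bspec[OF bspec[OF assms(1)[unfolded dpolys_def mem_Collect_eq] assms(2)] assms(3)]
  by simp_all

lemma dpolys_mult:
  assumes P: "P \<in> dpolys \<Delta> n" and Q: "Q \<in> dpolys \<Delta> n"
  shows "P * Q \<in> dpolys \<Delta> n"
proof -
  have "i < n \<and> set_mset \<theta> \<subseteq> \<Delta>"
    if M: "M \<in> Poly_Mapping.keys (P * Q)" and v: "(i, \<theta>) \<in> Poly_Mapping.keys M" for M i \<theta>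
  proof -
    obtain A B where AB: "M = A + B" "A \<in> Poly_Mapping.keys P" "B \<in> Poly_Mapping.keys Q"
      using M keys_mult[of P Q] by blast
    have "(i, \<theta>) \<in> Poly_Mapping.keys A \<union> Poly_Mapping.keys B"
      using v Poly_Mapping.keys_add[of A B] unfolding AB(1) by (rule subsetD[rotated])
    then show ?thesis
      using dpolysD[OF P AB(2), of i \<theta>] dpolysD[OF Q AB(3), of i \<theta>] by (elim UnE) simp_all
  qed
  then show ?thesis unfolding dpolys_def by auto
qed

lemma dpoly_eval_deriv:
  fixes \<delta> :: "'d \<Rightarrow> 'a::field \<Rightarrow> 'a"
  assumes K: "differential_field \<Delta> \<delta>" and j: "j \<in> \<Delta>" and P: "P \<in> dpolys \<Delta> n"
  shows "dpoly_eval \<delta> x (dpoly_deriv \<delta> j P) = \<delta> j (dpoly_eval \<delta> x P)"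
proof -
  have add: "\<delta> j (a + b) = \<delta> j a + \<delta> j b" and mult: "\<delta> j (a * b) = \<delta> j a * b + a * \<delta> j b" for a b
    using K j unfolding differential_field_def by blast+
  have zero: "\<delta> j 0 = 0" using add[of 0 0] unfolding add_0_right add_cancel_right_right .
  have one: "\<delta> j 1 = 0" using mult[of 1 1] unfolding mult_1_left mult_1_right add_cancel_right_right .
  have sum: "\<delta> j (sum f A) = (\<Sum>a\<in>A. \<delta> j (f a))" for f :: "'b \<Rightarrow> 'a" and A
    by (induction A rule: infinite_finite_induct) (auto simp: zero add)
  have prod: "\<delta> j (prod f A) = (\<Sum>a\<in>A. \<delta> j (f a) * prod f (A - {a}))"
    if "finite A" for f :: "'b \<Rightarrow> 'a" and A
    using that
  proof induction
    case (insert a A)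
    have "(\<Sum>b\<in>A. \<delta> j (f b) * prod f (insert a A - {b})) = (\<Sum>b\<in>A. f a * (\<delta> j (f b) * prod f (A - {b})))"
    proof (rule sum.cong)
      fix b assume b: "b \<in> A"
      then have "insert a A - {b} = insert a (A - {b})" using insert by auto
      then show "\<delta> j (f b) * prod f (insert a A - {b}) = f a * (\<delta> j (f b) * prod f (A - {b}))"
        using insert by simp
    qed simp
    then show ?case using insert by (simp add: mult sum_distrib_left)
  qed (simp add: one)
  have pow: "\<delta> j (a ^ k) = of_nat k * a ^ (k - 1) * \<delta> j a" for a k
  proof (induction k)
    case (Suc k)
    have "\<delta> j (a ^ Suc k) = \<delta> j a * a ^ k + a * (of_nat k * a ^ (k - 1) * \<delta> j a)"
      using Suc by (simp add: mult)
    also have "\<dots> = of_nat (Suc k) * a ^ (Suc k - 1) * \<delta> j a"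
      by (cases k) (simp_all add: algebra_simps)
    finally show ?case .
  qed (simp add: one)
  have mon: "\<delta> j (monom_eval \<delta> x M) = (\<Sum>(i, \<theta>) \<in> Poly_Mapping.keys M.
      of_nat (Poly_Mapping.lookup M (i, \<theta>)) * monom_eval \<delta> x
        (M - Poly_Mapping.single (i, \<theta>) 1 + Poly_Mapping.single (i, add_mset j \<theta>) 1))"
    if M: "M \<in> Poly_Mapping.keys P" for M
    unfolding monom_eval_def[of _ _ M]
  proof (subst prod[OF finite_keys], rule sum.cong[OF refl], clarify)
    fix i \<theta> assume v: "(i, \<theta>) \<in> Poly_Mapping.keys M"
    have \<theta>: "set_mset \<theta> \<subseteq> \<Delta>" using dpolysD(2)[OF P M v] .
    let ?N = "M - Poly_Mapping.single (i, \<theta>) 1" and ?V = "Poly_Mapping.keys M"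
    have N: "Poly_Mapping.lookup ?N u = (if u = (i, \<theta>) then Poly_Mapping.lookup M u - 1
        else Poly_Mapping.lookup M u)" for u
      by (auto simp: lookup_minus lookup_single)
    let ?f = "\<lambda>M (i, \<theta>). ders \<delta> \<theta> (x i) ^ Poly_Mapping.lookup M (i, \<theta>)"
    have "monom_eval \<delta> x ?N = prod (?f ?N) ?V"
      by (rule monom_eval_superset) (auto simp: in_keys_iff lookup_minus)
    also have "\<dots> = ?f ?N (i, \<theta>) * prod (?f ?N) (?V - {(i, \<theta>)})"
      by (rule prod.remove[OF finite_keys v])
    also have "prod (?f ?N) (?V - {(i, \<theta>)}) = prod (?f M) (?V - {(i, \<theta>)})"
      by (rule prod.cong) (auto simp: N[unfolded One_nat_def] split: if_splits)
    finally have *: "monom_eval \<delta> x ?N =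
        ders \<delta> \<theta> (x i) ^ (Poly_Mapping.lookup M (i, \<theta>) - 1) * prod (?f M) (?V - {(i, \<theta>)})"
      by (simp add: N[unfolded One_nat_def])
    show "\<delta> j (ders \<delta> \<theta> (x i) ^ Poly_Mapping.lookup M (i, \<theta>)) * prod (?f M) (?V - {(i, \<theta>)}) =
      of_nat (Poly_Mapping.lookup M (i, \<theta>)) *
        monom_eval \<delta> x (?N + Poly_Mapping.single (i, add_mset j \<theta>) 1)"
      unfolding monom_eval_add * pow monom_eval_single ders_add_mset[OF K \<theta> j] by simp
  qed
  have "dpoly_eval \<delta> x (dpoly_deriv \<delta> j P) = (\<Sum>M \<in> Poly_Mapping.keys P.
      \<delta> j (Poly_Mapping.lookup P M) * monom_eval \<delta> x M +
      Poly_Mapping.lookup P M * \<delta> j (monom_eval \<delta> x M))"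
    unfolding dpoly_deriv_def dpoly_eval_sum dpoly_eval_add dpoly_eval_single case_prod_unfold
  proof (rule sum.cong[OF refl])
    fix M assume M: "M \<in> Poly_Mapping.keys P"
    show "\<delta> j (Poly_Mapping.lookup P M) * monom_eval \<delta> x M +
        (\<Sum>v \<in> Poly_Mapping.keys M.
          of_nat (Poly_Mapping.lookup M (fst v, snd v)) * Poly_Mapping.lookup P M * monom_eval \<delta> x
            (M - Poly_Mapping.single (fst v, snd v) 1 +
              Poly_Mapping.single (fst v, add_mset j (snd v)) 1)) =
      \<delta> j (Poly_Mapping.lookup P M) * monom_eval \<delta> x M +
        Poly_Mapping.lookup P M * \<delta> j (monom_eval \<delta> x M)"
      unfolding mon[OF M] case_prod_unfold sum_distrib_left
      by (intro arg_cong2[of _ _ _ _ "(+)"] refl sum.cong) (simp only: mult_ac)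
  qed
  also have "\<dots> = \<delta> j (dpoly_eval \<delta> x P)"
    unfolding dpoly_eval_def sum mult ..
  finally show ?thesis .
qed

lemma istopology_kolchin:
  fixes \<delta> :: "'d \<Rightarrow> 'a::idom \<Rightarrow> 'a"
  shows "istopology (\<lambda>U. \<exists>S \<subseteq> dpolys \<Delta> n. U = points n UNIV - zeros \<delta> n S)"
  unfolding istopology_def
proof (intro conjI allI impI)
  fix U V :: "(nat \<Rightarrow> 'a) set"
  assume "\<exists>S \<subseteq> dpolys \<Delta> n. U = points n UNIV - zeros \<delta> n S"
    and "\<exists>S \<subseteq> dpolys \<Delta> n. V = points n UNIV - zeros \<delta> n S"
  then obtain S T where S: "S \<subseteq> dpolys \<Delta> n" "U = points n UNIV - zeros \<delta> n S"
    and T: "T \<subseteq> dpolys \<Delta> n" "V = points n UNIV - zeros \<delta> n T" by blast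
  have "U \<inter> V = points n UNIV - zeros \<delta> n {P * Q | P Q. P \<in> S \<and> Q \<in> T}"
  proof (rule Set.set_eqI)
    fix x
    have "x \<in> U \<inter> V \<longleftrightarrow> x \<in> points n UNIV \<and>
        (\<exists>P\<in>S. dpoly_eval \<delta> x P \<noteq> 0) \<and> (\<exists>Q\<in>T. dpoly_eval \<delta> x Q \<noteq> 0)"
      unfolding S(2) T(2) zeros_def by blast
    also have "\<dots> \<longleftrightarrow> x \<in> points n UNIV \<and> (\<exists>P\<in>S. \<exists>Q\<in>T. dpoly_eval \<delta> x (P * Q) \<noteq> 0)"
      unfolding dpoly_eval_mult mult_eq_0_iff by blast
    also have "\<dots> \<longleftrightarrow> x \<in> points n UNIV - zeros \<delta> n {P * Q | P Q. P \<in> S \<and> Q \<in> T}"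
      unfolding zeros_def by blast
    finally show "x \<in> U \<inter> V \<longleftrightarrow> x \<in> points n UNIV - zeros \<delta> n {P * Q | P Q. P \<in> S \<and> Q \<in> T}" .
  qed
  moreover have "{P * Q | P Q. P \<in> S \<and> Q \<in> T} \<subseteq> dpolys \<Delta> n"
    using S(1) T(1) by (blast intro: dpolys_mult)
  ultimately show "\<exists>S \<subseteq> dpolys \<Delta> n. U \<inter> V = points n UNIV - zeros \<delta> n S" by blast
next
  fix \<U> :: "(nat \<Rightarrow> 'a) set set"
  assume "\<forall>U\<in>\<U>. \<exists>S \<subseteq> dpolys \<Delta> n. U = points n UNIV - zeros \<delta> n S"
  then obtain S where S: "\<And>U. U \<in> \<U> \<Longrightarrow> S U \<subseteq> dpolys \<Delta> n"
    "\<And>U. U \<in> \<U> \<Longrightarrow> U = points n UNIV - zeros \<delta> n (S U)" by metis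
  have "(\<Union>U\<in>\<U>. U) = (\<Union>U\<in>\<U>. points n UNIV - zeros \<delta> n (S U))"
    using S(2) by (rule SUP_cong[OF refl])
  also have "\<dots> = points n UNIV - zeros \<delta> n (\<Union>U\<in>\<U>. S U)"
    unfolding zeros_def by blast
  finally have "\<Union>\<U> = points n UNIV - zeros \<delta> n (\<Union>U\<in>\<U>. S U)" by simp
  then show "\<exists>S \<subseteq> dpolys \<Delta> n. \<Union>\<U> = points n UNIV - zeros \<delta> n S"
    using S(1) by (intro exI[of _ "\<Union>U\<in>\<U>. S U"] conjI UN_least)
qed

lemma openin_kolchin:
  "openin (kolchin \<Delta> \<delta> n) U \<longleftrightarrow> (\<exists>S \<subseteq> dpolys \<Delta> n. U = points n UNIV - zeros \<delta> n S)"
  unfolding kolchin_def topology_inverse'[OF istopology_kolchin] ..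

lemma topspace_kolchin [simp]: "topspace (kolchin \<Delta> \<delta> n) = points n UNIV"
proof -
  have "openin (kolchin \<Delta> \<delta> n) (points n UNIV)"
    unfolding openin_kolchin by (intro exI[of _ "{1}"]) (auto simp: zeros_def)
  then show ?thesis
    unfolding topspace_def openin_kolchin by auto
qed

lemma closedin_kolchin:
  "closedin (kolchin \<Delta> \<delta> n) Z \<longleftrightarrow> (\<exists>S \<subseteq> dpolys \<Delta> n. Z = zeros \<delta> n S)"
proof -
  have "zeros \<delta> n S \<subseteq> points n UNIV" for S by (auto simp: zeros_def)
  then show ?thesis unfolding closedin_def openin_kolchin topspace_kolchin by blast
qed

end

theory Submission
  imports Defs "HOL-Algebra.Algebraic_Closure_Type" "HOL-Library.Multiset_Order"
begin

text \<open>
  The functions \<open>G(\<phi>(x), x)\<close> vanishing on \<open>X\<close> form a prime differential ideal \<open>P\<close>, whose zero set is the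
  graph of \<open>\<phi>\<close> and which meets \<open>K{y}\<close> in functions vanishing on \<open>Y\<close>. Rank the derivatives of the \<open>x\<^sub>i\<close> and
  call a derivative a leader if, modulo \<open>P\<close>, it is algebraic over the \<open>y\<close>-derivatives and the lower
  \<open>x\<close>-derivatives. By Dickson's lemma all leaders are derivatives of finitely many of them, and the
  proper ones among these satisfy a linear equation whose initial is a separant of the finitely many.
  Where these finitely many initials and separants do not vanish (this defines \<open>U\<close>), a condition \<open>b \<noteq> 0\<close> can be
  pushed down to \<open>K{y}\<close> by eliminating its highest derivative: one takes coefficients if the
  derivative is free, and coefficients of a pseudo-remainder if it is a leader. So the set of
  \<open>y\<close> over which \<open>P\<close> has a regular zero with \<open>b \<noteq> 0\<close>, the derivatives being independent unknowns in an
  algebraic closure, is open. Such a zero is a prime ideal; the largest differential ideal inside it is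
  again prime, and its residue field is a differential field in which the finitely many
  characteristic equations of \<open>P\<close> have a solution over \<open>y\<close>. Differential closedness gives one in \<open>K\<close>.
\<close>

text \<open>The equations chosen for the leaders need no compatibility among their derivatives. All
  of \<open>P\<close> is at hand, and \<open>pp v\<close> has least degree in \<open>P\<close>
  modulo the lower variables, so a pseudo-remainder by \<open>pp v\<close> of an element of
  \<open>P\<close> has all coefficients in \<open>P\<close>. Over a point of the lower part of
  \<open>P\<close>, the one equation \<open>pp v\<close> with non-zero initial thus implies every
  equation of \<open>P\<close> up to \<open>v\<close>. The algebraic closure enters because only
  there is divisibility controlled by roots; a point found there need not respect the derivations,
  whence the detour through a prime differential ideal. Characteristic zero keeps separants outside
  \<open>P\<close> and makes the binomial coefficients of the Leibniz rule invertible.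
  \<open>U\<close> has to be open and independent of \<open>b\<close>, so its definition can afford
  only finitely many initials and separants. Finally, the extension fields in
  \<open>differentially_closed\<close> are carried by subsets of the type of \<open>K\<close>, so
  the residue field must be coded by elements of \<open>K\<close>.\<close>

text \<open>HOL-Algebra reserves the identifier \<open>X\<close> for an indeterminate.\<close>
no_notation Polynomials.var (\<open>X\<index>\<close>)

alias keys = Poly_Mapping.keys
alias lookup = Poly_Mapping.lookup
alias single = Poly_Mapping.single

type_synonym ('v, 'a) mpol = "('v \<Rightarrow>\<^sub>0 nat) \<Rightarrow>\<^sub>0 'a"

section \<open>Polynomial rings with a set of variables\<close>

definition pvars :: "'v set \<Rightarrow> (('v, 'a::zero) mpol) set" where
  "pvars D = {P. \<forall>M \<in> keys P. keys M \<subseteq> D}"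

definition pconst :: "'a::zero \<Rightarrow> ('v, 'a) mpol" where
  "pconst c = single 0 c"

definition pvar :: "'v \<Rightarrow> ('v, 'a::zero_neq_one) mpol" where
  "pvar v = single (single v 1) 1"

lemma pvarsI: "(\<And>M. M \<in> keys P \<Longrightarrow> keys M \<subseteq> D) \<Longrightarrow> P \<in> pvars D"
  by (auto simp: pvars_def)

lemma pvars_mono: "P \<in> pvars D \<Longrightarrow> D \<subseteq> D' \<Longrightarrow> P \<in> pvars D'"
  by (auto simp: pvars_def)

lemma pvars_const [simp]: "pconst c \<in> pvars D"
  by (auto simp: pvars_def pconst_def split: if_splits)

lemma pvars_0 [simp]: "0 \<in> pvars D"
  by (auto simp: pvars_def)

lemma pvars_1 [simp]: "1 \<in> pvars D"
  by (auto simp: pvars_def)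

lemma pvars_var [simp]: "v \<in> D \<Longrightarrow> pvar v \<in> pvars D"
  by (auto simp: pvars_def pvar_def split: if_splits)

lemma pvars_add: "P \<in> pvars D \<Longrightarrow> Q \<in> pvars D \<Longrightarrow> P + Q \<in> pvars D"
  using Poly_Mapping.keys_add[of P Q] unfolding pvars_def by blast

lemma pvars_uminus: "(P :: ('v, 'a::comm_ring_1) mpol) \<in> pvars D \<Longrightarrow> - P \<in> pvars D"
  by (auto simp: pvars_def in_keys_iff)

lemma pvars_diff:
  "(P :: ('v, 'a::comm_ring_1) mpol) \<in> pvars D \<Longrightarrow> Q \<in> pvars D \<Longrightarrow> P - Q \<in> pvars D"
  using pvars_add[OF _ pvars_uminus, of P D Q] by simp

lemma pvars_mult:
  fixes P Q :: "('v, 'a::comm_ring_1) mpol"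
  assumes "P \<in> pvars D" "Q \<in> pvars D"
  shows "P * Q \<in> pvars D"
proof (rule pvarsI)
  fix M assume "M \<in> keys (P * Q)"
  then obtain A B where AB: "M = A + B" "A \<in> keys P" "B \<in> keys Q"
    using keys_mult[of P Q] by blast
  have "keys M \<subseteq> keys A \<union> keys B"
    unfolding AB(1) by (rule Poly_Mapping.keys_add)
  then show "keys M \<subseteq> D" using AB(2,3) assms unfolding pvars_def by blast
qed

lemma pvars_power: "(P :: ('v, 'a::comm_ring_1) mpol) \<in> pvars D \<Longrightarrow> P ^ k \<in> pvars D"
  by (induction k) (auto intro: pvars_mult)

lemma pvars_sum:
  "(\<And>a. a \<in> A \<Longrightarrow> (f a :: ('v, 'a::comm_ring_1) mpol) \<in> pvars D) \<Longrightarrow> sum f A \<in> pvars D"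
  by (induction A rule: infinite_finite_induct) (auto intro: pvars_add)

lemma pconst_0 [simp]: "pconst 0 = 0" and pconst_1 [simp]: "pconst 1 = 1"
  and pconst_add: "pconst (a + b) = pconst a + pconst b"
  by (auto simp: pconst_def single_add)

lemma pconst_mult: "pconst (a * b) = (pconst a * pconst b :: ('v, 'a::comm_ring_1) mpol)"
  by (simp add: pconst_def mult_single)

lemma pconst_of_nat: "pconst (of_nat k) = (of_nat k :: ('v, 'a::comm_ring_1) mpol)"
  by (simp add: pconst_def)

lemma poly_mapping_eq_sum_single:
  "(\<Sum>M \<in> keys P. single M (lookup P M)) = P"
  by (rule poly_mapping_eqI)
    (auto simp: lookup_sum lookup_single when_def in_keys_iff sum.delta)

lemma single_eq_prod_pvar:
  "single M c = pconst c *
     (\<Prod>v \<in> keys M. pvar v ^ lookup M v :: ('v, 'a::comm_ring_1) mpol)"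
proof -
  have pow: "pvar v ^ k = (single (single v k) 1 :: ('v, 'a) mpol)"
    for v k by (induction k) (auto simp: pvar_def mult_single single_add[symmetric])
  have "(\<Prod>v\<in>A. pvar v ^ f v) =
      (single (\<Sum>v\<in>A. single v (f v)) 1 :: ('v, 'a) mpol)"
    if "finite A" for A and f :: "'v \<Rightarrow> nat"
    using that by induction (auto simp: pow mult_single)
  then show ?thesis by (simp add: pconst_def mult_single poly_mapping_eq_sum_single)
qed

lemma pvars_induct [consumes 1, case_names const var add mult]:
  fixes P :: "('v, 'a::comm_ring_1) mpol"
  assumes P: "P \<in> pvars D"
    and c: "\<And>c. \<Phi> (pconst c)" and v: "\<And>v. v \<in> D \<Longrightarrow> \<Phi> (pvar v)"
    and a: "\<And>P Q. P \<in> pvars D \<Longrightarrow> Q \<in> pvars D \<Longrightarrow> \<Phi> P \<Longrightarrow> \<Phi> Q \<Longrightarrow> \<Phi> (P + Q)"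
    and m: "\<And>P Q. P \<in> pvars D \<Longrightarrow> Q \<in> pvars D \<Longrightarrow> \<Phi> P \<Longrightarrow> \<Phi> Q \<Longrightarrow> \<Phi> (P * Q)"
  shows "\<Phi> P"
proof -
  define G where "G = {P \<in> pvars D. \<Phi> P}"
  have c': "pconst c \<in> G" for c using c by (auto simp: G_def)
  have 1: "1 \<in> G" using c'[of 1] by simp
  have 0: "0 \<in> G" using c'[of 0] by simp
  have m': "p \<in> G \<Longrightarrow> q \<in> G \<Longrightarrow> p * q \<in> G" for p q using m by (auto simp: G_def pvars_mult)
  have a': "p \<in> G \<Longrightarrow> q \<in> G \<Longrightarrow> p + q \<in> G" for p q using a by (auto simp: G_def pvars_add)
  have v': "v \<in> D \<Longrightarrow> pvar v \<in> G" for v using v by (auto simp: G_def)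
  have pw: "p \<in> G \<Longrightarrow> p ^ k \<in> G" for p k by (induction k) (auto simp: 1 m')
  have pr: "(\<And>a. a \<in> A \<Longrightarrow> f a \<in> G) \<Longrightarrow> prod f A \<in> G" for A :: "'v set" and f
    by (induction A rule: infinite_finite_induct) (auto simp: 1 m')
  have sm: "(\<And>a. a \<in> A \<Longrightarrow> f a \<in> G) \<Longrightarrow> sum f A \<in> G" for A :: "('v \<Rightarrow>\<^sub>0 nat) set" and f
    by (induction A rule: infinite_finite_induct) (auto simp: 0 a')
  have "single M (lookup P M) \<in> G" if "M \<in> keys P" for M
    unfolding single_eq_prod_pvar[of M] using that P
    by (intro m' c' pr pw v') (auto simp: pvars_def)
  then have "(\<Sum>M \<in> keys P. single M (lookup P M)) \<in> G"
    by (rule sm)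
  then show ?thesis by (simp add: G_def poly_mapping_eq_sum_single)
qed

text \<open>\<open>W\<close> may have no highest variable, but each polynomial involves finitely
  many; with \<open>top_variable\<close> this starts the inductions on rank.\<close>

lemma pvars_finite_support:
  assumes "P \<in> pvars D"
  obtains A where "finite A" "A \<subseteq> D" "P \<in> pvars A"
  by (rule that[of "\<Union>M\<in>keys P. keys M"]) (use assms in \<open>auto simp: pvars_def\<close>)

section \<open>Evaluation\<close>

text \<open>Covers the identity of \<open>K\<close>, the embedding \<open>to_ac\<close> and the
  evaluations \<open>pev h t\<close> alike.\<close>

definition rhom :: "('a::comm_ring_1 \<Rightarrow> 'e::comm_ring_1) \<Rightarrow> bool" where
  "rhom h \<longleftrightarrow> h 1 = 1 \<and> (\<forall>a b. h (a + b) = h a + h b) \<and> (\<forall>a b. h (a * b) = h a * h b)"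

lemma rhomD:
  assumes "rhom h"
  shows "h 1 = 1" "h (a + b) = h a + h b" "h (a * b) = h a * h b" "h 0 = 0"
    "h (- a) = - h a" "h (a - b) = h a - h b" "h (a ^ k) = h a ^ k" "h (of_nat k) = of_nat k"
    "h (sum f A) = (\<Sum>x\<in>A. h (f x))" "h (prod f A) = (\<Prod>x\<in>A. h (f x))"
proof -
  show 1: "h 1 = 1" and a: "h (a + b) = h a + h b" and m: "h (a * b) = h a * h b" for a b
    using assms by (auto simp: rhom_def)
  show 0: "h 0 = 0" using a[of 0 0] by simp
  show u: "h (- a) = - h a" for a using a[of a "- a"] 0 by (simp add: eq_neg_iff_add_eq_0 add.commute)
  show "h (a - b) = h a - h b" using a[of a "- b"] u by simp
  show "h (a ^ k) = h a ^ k" by (induction k) (auto simp: 1 m)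
  show "h (of_nat k) = of_nat k" by (induction k) (auto simp: 0 1 a)
  show "h (sum f A) = (\<Sum>x\<in>A. h (f x))" by (induction A rule: infinite_finite_induct) (auto simp: 0 a)
  show "h (prod f A) = (\<Prod>x\<in>A. h (f x))" by (induction A rule: infinite_finite_induct) (auto simp: 1 m)
qed

lemma rhom_id: "rhom (\<lambda>x. x)"
  by (auto simp: rhom_def)

text \<open>The values \<open>t v\<close> are arbitrary, so for differential variables this is a
  point at which the derivatives are independent unknowns. Evaluation at a differential point is the
  special case \<open>dpoly_eval_eq_pev\<close>.\<close>

definition pev ::
  "('a::comm_ring_1 \<Rightarrow> 'e::comm_ring_1) \<Rightarrow> ('v \<Rightarrow> 'e) \<Rightarrow> ('v, 'a) mpol \<Rightarrow> 'e" where
  "pev h t P = (\<Sum>M \<in> keys P. h (lookup P M) *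
     (\<Prod>v \<in> keys M. t v ^ lookup M v))"

lemma rhom_pev:
  assumes h: "rhom h"
  shows "rhom (pev h t)"
proof -
  let ?m = "\<lambda>M. \<Prod>v \<in> keys M. t v ^ lookup M v"
  have m_sup: "?m M = (\<Prod>v\<in>V. t v ^ lookup M v)"
    if "finite V" "keys M \<subseteq> V" for M V
    by (rule prod.mono_neutral_left) (use that in \<open>auto simp: in_keys_iff\<close>)
  have m_add: "?m (M + N) = ?m M * ?m N" for M N
  proof -
    let ?V = "keys M \<union> keys N"
    have "keys (M + N) \<subseteq> ?V" by (rule Poly_Mapping.keys_add)
    then show ?thesis
      using m_sup[of ?V "M + N"] m_sup[of ?V M] m_sup[of ?V N]
      by (simp add: lookup_add power_add prod.distrib)
  qed
  have sup: "pev h t P = (\<Sum>M\<in>V. h (lookup P M) * ?m M)"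
    if "finite V" "keys P \<subseteq> V" for V P
    unfolding pev_def
    by (rule sum.mono_neutral_left) (use that rhomD(4)[OF h] in \<open>auto simp: in_keys_iff\<close>)
  have add: "pev h t (P + Q) = pev h t P + pev h t Q" for P Q
  proof -
    let ?V = "keys P \<union> keys Q"
    have "keys (P + Q) \<subseteq> ?V" by (rule Poly_Mapping.keys_add)
    then show ?thesis
      using sup[of ?V "P + Q"] sup[of ?V P] sup[of ?V Q]
      by (simp add: lookup_add distrib_right sum.distrib rhomD(2)[OF h])
  qed
  have sum: "pev h t (sum f A) = (\<Sum>a\<in>A. pev h t (f a))" for f and A :: "('v \<Rightarrow>\<^sub>0 nat) set"
    by (induction A rule: infinite_finite_induct) (simp_all add: add, simp_all add: pev_def)
  have single: "pev h t (single M c) = h c * ?m M" for M c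
    by (subst sup[of "{M}"]) auto
  have mult: "pev h t (P * Q) = pev h t P * pev h t Q" for P Q
  proof -
    have "pev h t (P * Q) = pev h t
       ((\<Sum>M \<in> keys P. single M (lookup P M)) *
        (\<Sum>M \<in> keys Q. single M (lookup Q M)))"
      by (simp only: poly_mapping_eq_sum_single)
    also have "\<dots> = pev h t P * pev h t Q"
      unfolding sum_product sum mult_single single m_add
      by (simp add: pev_def sum_product mult_ac rhomD(3)[OF h])
    finally show ?thesis .
  qed
  have "pev h t 1 = 1" using single[of 0 1] rhomD(1)[OF h] by simp
  with add mult show ?thesis by (simp add: rhom_def)
qed

lemma pev_const [simp]: "rhom h \<Longrightarrow> pev h t (pconst c) = h c"
  using rhomD(4)[of h] by (cases "c = 0") (auto simp: pev_def pconst_def)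

lemma pev_var [simp]: "rhom h \<Longrightarrow> pev h t (pvar v) = t v"
  using rhomD(1)[of h] by (auto simp: pev_def pvar_def)

lemma pev_cong:
  assumes "P \<in> pvars D" "\<And>v. v \<in> D \<Longrightarrow> t v = t' v"
  shows "pev h t P = pev h t' P"
  unfolding pev_def
  by (intro sum.cong prod.cong arg_cong2[of _ _ _ _ "(*)"] refl)
    (use assms in \<open>auto simp: pvars_def subset_iff\<close>)

section \<open>Polynomials in one distinguished variable\<close>

text \<open>The library's \<open>pderiv\<close> needs a coefficient type without zero divisors.\<close>

definition formal_deriv :: "'r::comm_ring_1 poly \<Rightarrow> 'r poly" where
  "formal_deriv q = (\<Sum>i\<le>degree q.
     monom (of_nat i * coeff q i) (i - 1))"

lemma coeff_formal_deriv:
  "coeff (formal_deriv q) i = of_nat (Suc i) * coeff q (Suc i)"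
proof -
  have "coeff (formal_deriv q) i =
      (\<Sum>k\<le>degree q. if k = Suc i then of_nat k * coeff q k else 0)"
    unfolding formal_deriv_def Polynomial.coeff_sum
  proof (rule sum.cong[OF refl])
    fix k
    show "coeff (monom (of_nat k * coeff q k) (k - 1)) i =
        (if k = Suc i then of_nat k * coeff q k else 0)"
      by (cases k) auto
  qed
  also have "\<dots> = of_nat (Suc i) * coeff q (Suc i)"
    by (auto simp: sum.delta coeff_eq_0)
  finally show ?thesis .
qed

lemma formal_deriv_pCons: "formal_deriv (pCons a q) = q + pCons 0 (formal_deriv q)"
  by (rule poly_eqI)
    (auto simp: coeff_formal_deriv Polynomial.coeff_pCons algebra_simps split: nat.splits)

text \<open>Subrings are sets within one type, so a polynomial in the lower variables serves as a
  coefficient and also as an element of the larger ring that contains \<open>pvar v\<close>.\<close>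

definition cpoly :: "'r::comm_ring_1 set \<Rightarrow> 'r poly set" where
  "cpoly A = {q. \<forall>i. coeff q i \<in> A}"

definition subring_set :: "'r::comm_ring_1 set \<Rightarrow> bool" where
  "subring_set A \<longleftrightarrow> 1 \<in> A \<and> (\<forall>a\<in>A. \<forall>b\<in>A. a - b \<in> A \<and> a * b \<in> A)"

lemma subring_setD:
  assumes "subring_set A"
  shows "1 \<in> A" "0 \<in> A" "a \<in> A \<Longrightarrow> b \<in> A \<Longrightarrow> a - b \<in> A" "a \<in> A \<Longrightarrow> - a \<in> A"
    "a \<in> A \<Longrightarrow> b \<in> A \<Longrightarrow> a + b \<in> A" "a \<in> A \<Longrightarrow> b \<in> A \<Longrightarrow> a * b \<in> A"
    "a \<in> A \<Longrightarrow> a ^ k \<in> A" "of_nat k \<in> A" "(\<And>x. x \<in> S \<Longrightarrow> f x \<in> A) \<Longrightarrow> sum f S \<in> A"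
proof -
  show 1: "1 \<in> A" and d: "a \<in> A \<Longrightarrow> b \<in> A \<Longrightarrow> a - b \<in> A" and m: "a \<in> A \<Longrightarrow> b \<in> A \<Longrightarrow> a * b \<in> A" for a b
    using assms by (auto simp: subring_set_def)
  show 0: "0 \<in> A" using d[OF 1 1] by simp
  show u: "a \<in> A \<Longrightarrow> - a \<in> A" for a using d[OF 0, of a] by simp
  show a: "a \<in> A \<Longrightarrow> b \<in> A \<Longrightarrow> a + b \<in> A" for a b using d[of a "- b"] u by simp
  show "a \<in> A \<Longrightarrow> a ^ k \<in> A" by (induction k) (auto simp: 1 m)
  show "of_nat k \<in> A" by (induction k) (auto simp: 0 1 a)
  show "(\<And>x. x \<in> S \<Longrightarrow> f x \<in> A) \<Longrightarrow> sum f S \<in> A"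
    by (induction S rule: infinite_finite_induct) (auto simp: 0 a)
qed

lemma subring_set_pvars: "subring_set (pvars D :: (('v, 'a::comm_ring_1) mpol) set)"
  by (auto simp: subring_set_def pvars_diff pvars_mult)

lemma cpolyD: "q \<in> cpoly A \<Longrightarrow> coeff q i \<in> A"
  by (simp add: cpoly_def)

lemma cpoly_closed:
  assumes A: "subring_set A"
  shows "p \<in> cpoly A \<Longrightarrow> q \<in> cpoly A \<Longrightarrow> p + q \<in> cpoly A"
    "p \<in> cpoly A \<Longrightarrow> q \<in> cpoly A \<Longrightarrow> p - q \<in> cpoly A"
    "p \<in> cpoly A \<Longrightarrow> q \<in> cpoly A \<Longrightarrow> p * q \<in> cpoly A"
    "c \<in> A \<Longrightarrow> p \<in> cpoly A \<Longrightarrow> smult c p \<in> cpoly A"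
    "c \<in> A \<Longrightarrow> monom c k \<in> cpoly A"
    "c \<in> A \<Longrightarrow> [:c:] \<in> cpoly A"
    "p \<in> cpoly A \<Longrightarrow> formal_deriv p \<in> cpoly A"
    "p \<in> cpoly A \<Longrightarrow> p ^ k \<in> cpoly A"
    "0 \<in> cpoly A" "[:0, 1:] \<in> cpoly A"
proof -
  note cl = subring_setD[OF A]
  show m: "p \<in> cpoly A \<Longrightarrow> q \<in> cpoly A \<Longrightarrow> p * q \<in> cpoly A" for p q
    by (auto simp: cpoly_def Polynomial.coeff_mult intro!: cl)
  show "c \<in> A \<Longrightarrow> [:c:] \<in> cpoly A" "[:0, 1:] \<in> cpoly A"
    by (auto simp: cpoly_def Polynomial.coeff_pCons cl split: nat.splits)
  show "p \<in> cpoly A \<Longrightarrow> formal_deriv p \<in> cpoly A"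
    by (auto simp: cpoly_def coeff_formal_deriv intro!: cl(6) cl(5) cl)
  show "p \<in> cpoly A \<Longrightarrow> p ^ k \<in> cpoly A"
  proof (induction k)
    case 0
    show ?case by (auto simp: cpoly_def cl Polynomial.coeff_1)
  qed (auto intro: m)
  show "p \<in> cpoly A \<Longrightarrow> q \<in> cpoly A \<Longrightarrow> p + q \<in> cpoly A"
    "p \<in> cpoly A \<Longrightarrow> q \<in> cpoly A \<Longrightarrow> p - q \<in> cpoly A"
    "c \<in> A \<Longrightarrow> p \<in> cpoly A \<Longrightarrow> smult c p \<in> cpoly A"
    "c \<in> A \<Longrightarrow> monom c k \<in> cpoly A" "0 \<in> cpoly A"
    by (auto simp: cpoly_def cl)
qed

lemma poly_in_pvars:
  fixes q :: "(('v, 'a::comm_ring_1) mpol) poly"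
  assumes "q \<in> cpoly (pvars D)" "x \<in> pvars D'" "D \<subseteq> D'"
  shows "poly q x \<in> pvars D'"
  unfolding poly_altdef using assms
  by (intro pvars_sum pvars_mult pvars_power) (auto simp: cpoly_def intro: pvars_mono)

lemma pvars_insertE:
  fixes Q :: "('v, 'a::comm_ring_1) mpol"
  assumes "Q \<in> pvars (insert v D)"
  obtains q where "q \<in> cpoly (pvars D)" "poly q (pvar v) = Q"
proof -
  note cl = cpoly_closed[OF subring_set_pvars]
  have "\<exists>q \<in> cpoly (pvars D). poly q (pvar v) = Q"
    using assms
  proof (induction rule: pvars_induct)
    case (const c)
    show ?case by (rule bexI[of _ "[:pconst c:]"]) (auto intro: cl)
  next
    case (var w)
    show ?case
    proof (cases "w = v")
      case True
      then show ?thesis by (intro bexI[of _ "[:0, 1:]"]) (auto intro: cl)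
    next
      case False
      then show ?thesis using var by (intro bexI[of _ "[:pvar w:]"]) (auto intro: cl)
    qed
  next
    case (add P Q)
    then obtain p q where "p \<in> cpoly (pvars D)" "poly p (pvar v) = P"
      "q \<in> cpoly (pvars D)" "poly q (pvar v) = Q" by blast
    then show ?case by (intro bexI[of _ "p + q"]) (auto intro: cl)
  next
    case (mult P Q)
    then obtain p q where "p \<in> cpoly (pvars D)" "poly p (pvar v) = P"
      "q \<in> cpoly (pvars D)" "poly q (pvar v) = Q" by blast
    then show ?case by (intro bexI[of _ "p * q"]) (auto intro: cl)
  qed
  then show ?thesis using that by blast
qed

section \<open>Coefficientwise homomorphisms, pseudo-division and divisibility by roots\<close>

lemma rhom_poly:
  assumes "rhom f"
  shows "f (poly q x) = poly (map_poly f q) (f x)"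
  by (induction q) (simp_all add: map_poly_pCons rhomD(2-4)[OF assms])

lemma map_poly_rhom:
  assumes "rhom f"
  shows "map_poly f (p + q) = map_poly f p + map_poly f q"
    "map_poly f (p * q) = map_poly f p * map_poly f q"
    "map_poly f (smult c p) = smult (f c) (map_poly f p)"
    "map_poly f (p ^ k) = map_poly f p ^ k"
    "map_poly f (formal_deriv p) = formal_deriv (map_poly f p)"
proof -
  note f = rhomD[OF assms]
  show "map_poly f (p + q) = map_poly f p + map_poly f q"
    by (rule poly_eqI) (auto simp: coeff_map_poly f)
  show m: "map_poly f (p * q) = map_poly f p * map_poly f q" for p q
    by (rule poly_eqI) (auto simp: coeff_map_poly f Polynomial.coeff_mult)
  show "map_poly f (smult c p) = smult (f c) (map_poly f p)"
    by (rule poly_eqI) (auto simp: coeff_map_poly f)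
  show "map_poly f (p ^ k) = map_poly f p ^ k"
    by (induction k) (auto simp: m f)
  have "f (1 + of_nat n) = 1 + of_nat n" for n using f(8)[of "Suc n"] by simp
  then show "map_poly f (formal_deriv p) = formal_deriv (map_poly f p)"
    by (intro poly_eqI) (auto simp: coeff_map_poly f coeff_formal_deriv)
qed

text \<open>Each cancellation of a leading term multiplies \<open>q\<close> by
  \<open>lead_coeff p\<close> instead of dividing by it, so all coefficients stay in
  \<open>A\<close>.\<close>

lemma pseudo_division:
  fixes p q :: "'r::comm_ring_1 poly"
  assumes A: "subring_set A" and p: "p \<in> cpoly A" and d: "0 < degree p"
    and q: "q \<in> cpoly A"
  obtains N a r where "a \<in> cpoly A" "r \<in> cpoly A" "degree r < degree p"
    "smult (lead_coeff p ^ N) q = a * p + r"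
proof -
  note cl = cpoly_closed[OF A]
  define c where "c = lead_coeff p"
  have c: "c \<in> A" using p by (simp add: c_def cpoly_def)
  have "\<exists>N. \<exists>a\<in>cpoly A. \<exists>r\<in>cpoly A. degree r < degree p \<and>
      smult (c ^ N) q = a * p + r"
    using q
  proof (induction "degree q" arbitrary: q rule: less_induct)
    case less
    show ?case
    proof (cases "degree q < degree p")
      case True
      then show ?thesis using less.prems cl(9)
        by (intro exI[of _ 0] bexI[of _ 0] bexI[of _ q]) auto
    next
      case False
      define k where "k = degree q - degree p"
      define b where "b = monom (lead_coeff q) k"
      define q' where "q' = smult c q - b * p"
      have b: "b \<in> cpoly A" unfolding b_def using less.prems by (intro cl) (simp add: cpoly_def)
      have q': "q' \<in> cpoly A" unfolding q'_def using less.prems p b c by (intro cl)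
      have kd: "degree q = k + degree p" using False by (simp add: k_def)
      have "degree b \<le> k" by (simp add: b_def degree_monom_le)
      then have "degree (b * p) \<le> degree q"
        using Polynomial.degree_mult_le[of b p] kd by linarith
      moreover have "coeff (b * p) (degree q) = lead_coeff q * c"
        unfolding b_def by (simp add: coeff_monom_mult kd c_def)
      moreover have "degree (smult c q) \<le> degree q"
        by (rule degree_smult_le)
      ultimately have "degree q' \<le> degree q"
        "coeff q' (degree q) = 0"
        unfolding q'_def by (auto intro: Polynomial.degree_diff_le)
      \<comment> \<open>If the degree did not drop, \<open>q'\<close> would be zero and
        \<open>degree q = 0\<close>, contrary to \<open>0 < degree p \<le> degree q\<close>.\<close>
      then have "degree q' < degree q"
        using kd d by (metis add_gr_0 degree_0 leading_coeff_0_iff le_neq_implies_less)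
      from less.hyps[OF this q'] obtain N a r where *: "a \<in> cpoly A" "r \<in> cpoly A"
        "degree r < degree p" "smult (c ^ N) q' = a * p + r" by blast
      have "smult (c ^ Suc N) q =
          smult (c ^ N) q' + smult (c ^ N) b * p"
        unfolding q'_def by (simp add: smult_diff_right mult.commute)
      also have "\<dots> = (a + smult (c ^ N) b) * p + r"
        unfolding * by (simp add: algebra_simps)
      finally show ?thesis using * b c subring_setD(7)[OF A c]
        by (intro exI[of _ "Suc N"] bexI[of _ "a + smult (c ^ N) b"] bexI[of _ r])
          (auto intro: cl)
    qed
  qed
  then show ?thesis using that unfolding c_def by blast
qed

text \<open>Up to a constant, \<open>p\<close> is a product of \<open>degree p\<close> linear
  factors, each of which divides \<open>g\<close>. The exponent \<open>degree p\<close> pays for all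
  multiplicities at once.\<close>

lemma dvd_power_degree_if_roots:
  fixes p g :: "'e::alg_closed_field poly"
  assumes "p \<noteq> 0" and roots: "\<And>x. poly p x = 0 \<Longrightarrow> poly g x = 0"
  shows "p dvd g ^ degree p"
proof -
  obtain A where A: "size A = degree p"
    "p = smult (lead_coeff p) (\<Prod>x\<in>#A. [:-x, 1:])"
    using alg_closed_imp_factorization[OF assms(1)] by blast
  have *: "(\<Prod>x\<in>#B. [:-x, 1:]) dvd g ^ size B" if "\<And>x. x \<in># B \<Longrightarrow> poly g x = 0" for B
    using that
  proof (induction B)
    case (add x B)
    then have "[:-x, 1:] * (\<Prod>x\<in>#B. [:-x, 1:]) dvd g * g ^ size B"
      by (intro mult_dvd_mono) (auto simp: poly_eq_0_iff_dvd)
    then show ?case by simp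
  qed auto
  have "poly p x = 0" if x: "x \<in># A" for x
  proof -
    obtain B where "A = add_mset x B" using multi_member_split[OF x] by blast
    then have "p = smult (lead_coeff p) ([:-x, 1:] * (\<Prod>x\<in>#B. [:-x, 1:]))"
      using A(2) by simp
    then have "poly p x = poly (smult (lead_coeff p) ([:-x, 1:] * (\<Prod>x\<in>#B. [:-x, 1:]))) x"
      by (rule arg_cong)
    then show ?thesis by simp
  qed
  then have "(\<Prod>x\<in>#A. [:-x, 1:]) dvd g ^ degree p" using *[of A] roots A(1) by metis
  then show ?thesis using A(2) assms(1) by (metis leading_coeff_0_iff smult_dvd)
qed

section \<open>Eliminating variables from the points of an ideal\<close>

text \<open>The value at \<open>v\<close> can be changed without touching \<open>B\<close>. This
  turns the search for an extended point into the search for one field element.\<close>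

lemma ex_extension_iff: "v \<notin> B \<Longrightarrow> (\<exists>t'. (\<forall>w\<in>B. t' w = t w) \<and> \<Phi> (t' v)) \<longleftrightarrow> (\<exists>e. \<Phi> e)"
proof
  assume v: "v \<notin> B" and "\<exists>e. \<Phi> e"
  then obtain e where "\<Phi> e" by blast
  then show "\<exists>t'. (\<forall>w\<in>B. t' w = t w) \<and> \<Phi> (t' v)" using v by (intro exI[of _ "t(v := e)"]) auto
qed blast

lemma degree_map_poly_rhom:
  "rhom f \<Longrightarrow> degree (map_poly f p) \<le> degree p"
  by (rule degree_le) (auto simp: coeff_map_poly coeff_eq_0 rhomD(4))

text \<open>Keeps the sets of coefficient conditions finite, as \<open>projects\<close>
  demands.\<close>

lemma ex_coeff_iff:
  assumes "f 0 = 0"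
  shows "(\<exists>i. f (coeff q i) \<noteq> 0) \<longleftrightarrow> (\<exists>i\<in>{..degree q}. f (coeff q i) \<noteq> 0)"
proof
  assume "\<exists>i. f (coeff q i) \<noteq> 0"
  then obtain i where i: "f (coeff q i) \<noteq> 0" by blast
  then have "coeff q i \<noteq> 0" using assms by auto
  then have "i \<le> degree q" by (rule le_degree)
  with i show "\<exists>i\<in>{..degree q}. f (coeff q i) \<noteq> 0" by blast
qed blast

text \<open>
  \<open>P\<close> is an ideal in the variables \<open>W\<close>, and the variables in \<open>Y\<close> are parameters. The leaders \<open>L\<close> are
  the variables algebraic modulo \<open>P\<close> over the ones below them, \<open>pp v\<close> being an equation of least
  degree with \<open>init v\<close> and \<open>sep v\<close> its initial and separant. Outside the finite set \<open>Mn\<close> the equation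
  is linear with the separant of some element of \<open>Mn\<close> as initial.
\<close>

locale ranked_ideal =
  fixes W Y :: "'v set" and key :: "'v \<Rightarrow> 'k::wellorder"
    and P :: "(('v, 'a::field_char_0) mpol) set"
    and L Mn :: "'v set" and pp :: "'v \<Rightarrow> ('v, 'a) mpol poly"
    and below :: "'v \<Rightarrow> 'v set" and init sep :: "'v \<Rightarrow> ('v, 'a) mpol"
  defines "below \<equiv> \<lambda>v. Y \<union> {w \<in> W. key w < key v}"
    and "init \<equiv> \<lambda>v. lead_coeff (pp v)"
    and "sep \<equiv> \<lambda>v. poly (formal_deriv (pp v)) (pvar v)"
  assumes YW: "Y \<subseteq> W" and inj: "inj_on key (W - Y)"
    and P_add: "f \<in> P \<Longrightarrow> g \<in> P \<Longrightarrow> f + g \<in> P"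
    and P_mult: "f \<in> P \<Longrightarrow> g \<in> pvars W \<Longrightarrow> g * f \<in> P"
    and LW: "L \<subseteq> W - Y" and MnL: "Mn \<subseteq> L" and fin: "finite Mn"
    and free: "v \<in> W - Y \<Longrightarrow> v \<notin> L \<Longrightarrow> q \<in> cpoly (pvars (below v)) \<Longrightarrow>
      poly q (pvar v) \<in> P \<Longrightarrow> coeff q i \<in> P"
    and pp: "v \<in> L \<Longrightarrow> pp v \<in> cpoly (pvars (below v))" "v \<in> L \<Longrightarrow> poly (pp v) (pvar v) \<in> P"
      "v \<in> L \<Longrightarrow> 0 < degree (pp v)"
    and pp_min: "v \<in> L \<Longrightarrow> q \<in> cpoly (pvars (below v)) \<Longrightarrow> poly q (pvar v) \<in> P \<Longrightarrow>
      degree q < degree (pp v) \<Longrightarrow> coeff q i \<in> P"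
    and derived: "v \<in> L - Mn \<Longrightarrow> degree (pp v) = 1"
      "v \<in> L - Mn \<Longrightarrow> \<exists>u\<in>Mn. key u < key v \<and> init v = sep u"
begin

text \<open>Initial segments of the ranking that contain the parameters; points are restricted and
  extended between them.\<close>

definition down :: "'v set \<Rightarrow> bool" where
  "down D \<longleftrightarrow> Y \<subseteq> D \<and> D \<subseteq> W \<and> (\<forall>v\<in>D - Y. below v \<subseteq> D)"

definition vanish :: "('a \<Rightarrow> 'e::comm_ring_1) \<Rightarrow> 'v set \<Rightarrow> ('v \<Rightarrow> 'e) \<Rightarrow> bool" where
  "vanish h D t \<longleftrightarrow> (\<forall>Q \<in> P \<inter> pvars D. pev h t Q = 0)"

text \<open>Conditions on \<open>Mn\<close> control all leaders of an initial segment, since the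
  initial of any other leader is the separant of a lower element of \<open>Mn\<close>.\<close>

definition regular_point :: "('a \<Rightarrow> 'e::comm_ring_1) \<Rightarrow> 'v set \<Rightarrow> ('v \<Rightarrow> 'e) \<Rightarrow> bool" where
  "regular_point h D t \<longleftrightarrow> vanish h D t \<and> (\<forall>u \<in> Mn \<inter> D. pev h t (init u * sep u) \<noteq> 0)"

abbreviation (input) "through v \<equiv> insert v (below v)"

section \<open>Initial segments and restriction of points\<close>

lemma below_W: "below v \<subseteq> W" and Y_below: "Y \<subseteq> below v"
  using YW by (auto simp: below_def)

lemma below_trans: "w \<in> below v - Y \<Longrightarrow> below w \<subseteq> below v"
  by (auto simp: below_def)

lemma down_below: "down (below v)"
  unfolding down_def using below_W Y_below below_trans by blast

lemma down_insert: "v \<in> W \<Longrightarrow> down (through v)"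
  unfolding down_def using below_W Y_below below_trans by blast

lemma down_W: "down W"
  unfolding down_def using below_W YW by blast

lemma down_Y: "down Y"
  unfolding down_def using YW by blast

lemma not_below: "v \<notin> Y \<Longrightarrow> v \<notin> below v"
  by (auto simp: below_def)

lemma init_below: "v \<in> L \<Longrightarrow> init v \<in> pvars (below v)"
  using pp(1) by (simp add: init_def cpoly_def)

lemma sep_in: "v \<in> L \<Longrightarrow> sep v \<in> pvars (through v)"
  unfolding sep_def
  by (rule poly_in_pvars[of _ "below v"]) (auto intro: cpoly_closed(7)[OF subring_set_pvars] pp(1))

lemma vanish_cong:
  "(\<And>v. v \<in> D \<Longrightarrow> t v = t' v) \<Longrightarrow> vanish h D t \<longleftrightarrow> vanish h D t'"
  unfolding vanish_def using pev_cong[of _ D t t' h] by auto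

text \<open>The initial and separant of \<open>u\<close> involve only \<open>u\<close> and what lies
  below it, and these variables stay in \<open>D\<close> because \<open>D\<close> is an initial
  segment.\<close>

lemma regular_point_cong:
  assumes "down D" "\<And>v. v \<in> D \<Longrightarrow> t v = t' v"
  shows "regular_point h D t \<longleftrightarrow> regular_point h D t'"
proof -
  have "pev h t (init u * sep u) = pev h t' (init u * sep u)" if u: "u \<in> Mn \<inter> D" for u
  proof (rule pev_cong[of _ D])
    have uL: "u \<in> L" using u MnL by blast
    then have uY: "u \<in> D - Y" using u LW by blast
    then have "below u \<subseteq> D" using assms(1) by (simp add: down_def)
    then show "init u * sep u \<in> pvars D"
      using init_below[OF uL] sep_in[OF uL] uY by (auto intro!: pvars_mult elim!: pvars_mono)
  qed (rule assms(2))
  then show ?thesis unfolding regular_point_def using vanish_cong[OF assms(2)] by auto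
qed

lemma vanish_mono: "vanish h D t \<Longrightarrow> D' \<subseteq> D \<Longrightarrow> vanish h D' t"
  unfolding vanish_def using pvars_mono by blast

lemma regular_point_mono: "regular_point h D t \<Longrightarrow> D' \<subseteq> D \<Longrightarrow> regular_point h D' t"
  unfolding regular_point_def using vanish_mono by blast

text \<open>As \<open>key\<close> is injective off the parameters, the maximum is attained once, so
  all other members of \<open>A\<close> lie strictly below \<open>v\<close> or are
  parameters.\<close>

lemma top_variable:
  assumes "finite A" "A \<subseteq> W" "\<not> A \<subseteq> Y"
  obtains v where "v \<in> A - Y" "A \<subseteq> through v"
proof -
  have "finite (key ` (A - Y))" "key ` (A - Y) \<noteq> {}" using assms by auto
  then obtain v where v: "v \<in> A - Y" "key v = Max (key ` (A - Y))"
    using Max_in by (metis imageE)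
  have "w \<in> through v" if "w \<in> A" for w
  proof (cases "w \<in> Y")
    case False
    then have "key w \<le> key v" unfolding v(2) using that assms(1) by simp
    moreover have "key w \<noteq> key v \<or> w = v"
      using inj that False v(1) assms(2) by (auto simp: inj_on_def)
    ultimately show ?thesis using that assms(2) by (auto simp: below_def)
  qed (use Y_below in auto)
  then show ?thesis using that v(1) by blast
qed

text \<open>For a free \<open>v\<close>, the coefficients of any element of \<open>P\<close> are
  themselves in \<open>P\<close>; they vanish at \<open>t\<close>, so the value at \<open>v\<close>
  is unconstrained.\<close>

lemma vanish_free:
  assumes h: "rhom h" and v: "v \<in> W - Y - L" and t: "vanish h (below v) t"
  shows "vanish h (through v) t"
  unfolding vanish_def
proof
  fix Q assume Q: "Q \<in> P \<inter> pvars (through v)"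
  obtain q where q: "q \<in> cpoly (pvars (below v))" "poly q (pvar v) = Q"
    by (rule pvars_insertE[OF IntD2[OF Q]])
  have "pev h t (coeff q i) = 0" for i
  proof -
    have "coeff q i \<in> P" using free[of v q i] v q Q by simp
    then show ?thesis using t cpolyD[OF q(1), of i] by (simp add: vanish_def)
  qed
  then have "map_poly (pev h t) q = 0"
    by (intro poly_eqI) (simp add: coeff_map_poly rhomD(4)[OF rhom_pev[OF h]])
  then show "pev h t Q = 0"
    using rhom_poly[OF rhom_pev[OF h], of t q "pvar v"] q(2) by simp
qed

lemma poly_pp_eval: "rhom h \<Longrightarrow> pev h t (poly q (pvar v)) = poly (map_poly (pev h t) q) (t v)"
  by (simp add: rhom_poly[OF rhom_pev])

text \<open>\<open>init v ^ N * Q\<close> is a multiple of \<open>pp v\<close> plus the value of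
  \<open>r\<close>. That value is a combination of elements of \<open>P\<close>, and
  \<open>r\<close> has smaller degree than \<open>pp v\<close>, so \<open>pp_min\<close> puts its
  coefficients into \<open>P\<close> and they vanish at \<open>t\<close>.\<close>

lemma vanish_leader:
  fixes h :: "'a \<Rightarrow> 'e::field"
  assumes h: "rhom h" and v: "v \<in> L" and t: "vanish h (below v) t"
    and i: "pev h t (init v) \<noteq> 0" and p: "pev h t (poly (pp v) (pvar v)) = 0"
  shows "vanish h (through v) t"
  unfolding vanish_def
proof
  note hom = rhomD[OF rhom_pev[OF h, of t]]
  fix Q assume Q: "Q \<in> P \<inter> pvars (through v)"
  obtain q where q: "q \<in> cpoly (pvars (below v))" "poly q (pvar v) = Q"
    by (rule pvars_insertE[OF IntD2[OF Q]])
  obtain N a r where ar: "a \<in> cpoly (pvars (below v))" "r \<in> cpoly (pvars (below v))"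
      "degree r < degree (pp v)"
      "smult (init v ^ N) q = a * pp v + r"
    using pseudo_division[OF subring_set_pvars pp(1,3)[OF v] q(1)] unfolding init_def by metis
  have eq: "init v ^ N * Q = poly a (pvar v) * poly (pp v) (pvar v) + poly r (pvar v)"
    using arg_cong[OF ar(4), of "\<lambda>p. poly p (pvar v)"] q(2) by simp
  have vW: "through v \<subseteq> W" using v LW below_W by blast
  have "poly r (pvar v) = init v ^ N * Q + (- poly a (pvar v)) * poly (pp v) (pvar v)"
    using eq by simp
  moreover have "poly a (pvar v) \<in> pvars W"
    using poly_in_pvars[OF ar(1), of "pvar v" W] vW by simp
  moreover have "init v ^ N \<in> pvars W"
    using pvars_mono[OF init_below[OF v] below_W] by (rule pvars_power)
  ultimately have "poly r (pvar v) \<in> P"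
    using P_add[OF P_mult[of Q "init v ^ N"] P_mult[OF pp(2)[OF v], of "- poly a (pvar v)"]] Q
      pvars_uminus by auto
  then have "pev h t (coeff r i) = 0" for i
    using pp_min[OF v ar(2) _ ar(3)] cpolyD[OF ar(2)] t by (simp add: vanish_def)
  then have "map_poly (pev h t) r = 0"
    by (intro poly_eqI) (simp add: coeff_map_poly hom)
  then have "pev h t (poly r (pvar v)) = 0" by (simp add: poly_pp_eval[OF h])
  then have "pev h t (init v) ^ N * pev h t Q = 0"
    using arg_cong[OF eq, of "pev h t"] p by (simp add: hom)
  then show "pev h t Q = 0" using i by simp
qed

text \<open>Induction on rank, free variables by \<open>vanish_free\<close> and leaders by
  \<open>vanish_leader\<close>. Vanishing of an infinite ideal is thereby reduced to one equation
  and one inequation per leader outside \<open>D0\<close>.\<close>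

lemma vanish_down:
  fixes h :: "'a \<Rightarrow> 'e::field"
  assumes h: "rhom h" and D: "down D" and D0: "down D0" "D0 \<subseteq> D" and t: "vanish h D0 t"
    and lead: "\<And>v. v \<in> L \<inter> D - D0 \<Longrightarrow> vanish h (below v) t \<Longrightarrow>
      pev h t (init v) \<noteq> 0 \<and> pev h t (poly (pp v) (pvar v)) = 0"
  shows "vanish h D t"
proof -
  have DW: "D \<subseteq> W" using D by (simp add: down_def)
  have YD0: "Y \<subseteq> D0" using D0 by (simp add: down_def)
  \<comment> \<open>Stated for an arbitrary \<open>D'\<close> since it serves for
    \<open>below v\<close> inside the induction and for \<open>D\<close> at the end.\<close>
  have split: "pev h t Q = 0"
    if IH: "\<And>w. w \<in> D' - Y \<Longrightarrow> vanish h (through w) t"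
      and Q: "Q \<in> P \<inter> pvars D'" and D': "D' \<subseteq> D" for D' Q
  proof -
    obtain A where A: "finite A" "A \<subseteq> D'" "Q \<in> pvars A" by (rule pvars_finite_support[OF IntD2[OF Q]])
    show ?thesis
    proof (cases "A \<subseteq> Y")
      case True
      then have "Q \<in> P \<inter> pvars D0" using A(3) Q YD0 pvars_mono by blast
      then show ?thesis using t by (simp add: vanish_def)
    next
      case False
      obtain w where w: "w \<in> A - Y" "A \<subseteq> through w"
        by (rule top_variable[OF A(1) _ False]) (use A(2) D' DW in auto)
      then have "vanish h (through w) t" using IH A(2) by blast
      then show ?thesis unfolding vanish_def using Q pvars_mono[OF A(3) w(2)] by blast
    qed
  qed
  have step: "vanish h (through v) t" if "v \<in> D - Y" for v
    using that
  proof (induction "key v" arbitrary: v rule: less_induct)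
    case less
    show ?case
    proof (cases "v \<in> D0")
      case True
      then have "through v \<subseteq> D0" using D0(1) less.prems by (auto simp: down_def)
      then show ?thesis using t vanish_mono by blast
    next
      case False
      have bD: "below v \<subseteq> D" using less.prems D by (auto simp: down_def)
      have b: "vanish h (below v) t"
        unfolding vanish_def
      proof
        fix Q assume Q: "Q \<in> P \<inter> pvars (below v)"
        show "pev h t Q = 0"
        proof (rule split[OF _ Q bD])
          fix w assume w: "w \<in> below v - Y"
          then have "key w < key v" by (auto simp: below_def)
          then show "vanish h (through w) t" using less.hyps w bD by blast
        qed
      qed
      show ?thesis
      proof (cases "v \<in> L")
        case True
        then show ?thesis using vanish_leader[OF h True b] lead[OF _ b] less.prems False by blast
      next
        case False
        then show ?thesis using vanish_free[OF h _ b] less.prems DW by blast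
      qed
    qed
  qed
  show ?thesis unfolding vanish_def using split[of D] step by blast
qed

text \<open>A variable of \<open>L - Mn\<close> is a root of a linear polynomial, so it can be solved for.\<close>

lemma regular_point_extend:
  fixes h :: "'a \<Rightarrow> 'e::field"
  assumes h: "rhom h" and D: "down D" and D0: "down D0" "D0 \<subseteq> D" "Mn \<inter> D \<subseteq> D0"
    and t: "regular_point h D0 t"
  obtains t' where "regular_point h D t'" "\<And>v. v \<in> D0 \<Longrightarrow> t' v = t v"
proof -
  have YD0: "Y \<subseteq> D0" using D0 by (simp add: down_def)
  have DW: "D \<subseteq> W" using D by (simp add: down_def)
  \<comment> \<open>The missing coordinates come from recursion on \<open>key\<close>: a leader
    outside \<open>Mn\<close> is the root of its linear equation at the earlier coordinates. The
    only other variables of \<open>D - D0\<close> are free, because \<open>Y\<close> and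
    \<open>Mn \<inter> D\<close> lie in \<open>D0\<close>; any value would do, and 0 is
    taken.\<close>
  define R where "R = (\<lambda>f v (r :: 'e). let s = (\<lambda>w. if w \<in> D0 then t w else f w) in
    r = (if v \<in> L - Mn then - pev h s (coeff (pp v) 0) / pev h s (coeff (pp v) 1)
         else 0))"
  have "\<exists>f. \<forall>v. R f v (f v)"
  proof (rule dependent_wf_choice[of "inv_image {(x, y). x < y} key" R])
    show "wf (inv_image {(x, y). x < y} key)" by (rule wf_inv_image[OF wf])
    fix f g :: "'v \<Rightarrow> 'e" and v r
    assume *: "\<And>z. (z, v) \<in> inv_image {(x, y). x < y} key \<Longrightarrow> f z = g z"
    show "R f v r = R g v r"
    proof (cases "v \<in> L - Mn")
      case True
      \<comment> \<open>The coefficients of \<open>pp v\<close> involve parameters, which lie in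
        \<open>D0\<close>, and variables of smaller key, where \<open>f\<close> and \<open>g\<close>
        agree.\<close>
      have "pev h (\<lambda>w. if w \<in> D0 then t w else f w) (coeff (pp v) i) =
        pev h (\<lambda>w. if w \<in> D0 then t w else g w) (coeff (pp v) i)" for i
        by (rule pev_cong[OF cpolyD[OF pp(1)]]) (use True * YD0 in \<open>auto simp: below_def\<close>)
      then show ?thesis unfolding R_def Let_def by simp
    qed (auto simp: R_def)
  qed (auto simp: R_def Let_def)
  then obtain f where f: "\<And>v. R f v (f v)" by blast
  define t' where "t' = (\<lambda>w. if w \<in> D0 then t w else f w)"
  have t'_D0: "t' v = t v" if "v \<in> D0" for v using that by (simp add: t'_def)
  note hom = rhomD[OF rhom_pev[OF h, of t']]
  have reg0: "regular_point h D0 t'"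
    using t regular_point_cong[OF D0(1), of t' t] t'_D0 by blast
  have "vanish h D t'"
  proof (rule vanish_down[OF h D D0(1,2)])
    show "vanish h D0 t'" using reg0 by (simp add: regular_point_def)
    fix v assume v: "v \<in> L \<inter> D - D0"
    then have vn: "v \<in> L - Mn" using D0(3) by blast
    obtain u where u: "u \<in> Mn" "key u < key v" "init v = sep u" using derived(2)[OF vn] by blast
    \<comment> \<open>The initial of \<open>v\<close> is the separant of \<open>u\<close>, and
      regularity on \<open>D0\<close> makes the latter non-zero.\<close>
    have "u \<in> below v" using u MnL LW by (auto simp: below_def)
    then have "u \<in> D" using v D LW by (auto simp: down_def)
    then have "pev h t' (init u * sep u) \<noteq> 0"
      using reg0 u(1) D0(3) by (auto simp: regular_point_def)
    then have i: "pev h t' (init v) \<noteq> 0" by (simp add: hom u(3))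
    have d: "degree (pp v) = 1" by (rule derived(1)[OF vn])
    have c1: "coeff (pp v) 1 = init v" by (simp add: init_def d)
    have "pp v = [:coeff (pp v) 0, coeff (pp v) 1:]"
      using d by (auto simp: poly_eq_iff Polynomial.coeff_pCons coeff_eq_0 split: nat.splits)
    then have "poly (pp v) (pvar v) = coeff (pp v) 0 + pvar v * coeff (pp v) 1"
      by (metis add.commute add.right_neutral mult_zero_right poly_0 poly_pCons)
    moreover have "t' v = - pev h t' (coeff (pp v) 0) / pev h t' (coeff (pp v) 1)"
      using f[of v] vn v unfolding R_def Let_def t'_def by simp
    ultimately have "pev h t' (poly (pp v) (pvar v)) = 0"
      using i h by (simp add: hom c1[unfolded One_nat_def])
    with i show "pev h t' (init v) \<noteq> 0 \<and> pev h t' (poly (pp v) (pvar v)) = 0" by blast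
  qed
  then have "regular_point h D t'"
    using reg0 D0(3) unfolding regular_point_def by blast
  then show ?thesis using that t'_D0 by blast
qed

section \<open>Elimination of variables from regular points\<close>

abbreviation (input) lifts :: "('a \<Rightarrow> 'e::comm_ring_1) \<Rightarrow> ('v \<Rightarrow> 'e) \<Rightarrow> 'v set \<Rightarrow> 'v set \<Rightarrow> ('v, 'a) mpol \<Rightarrow> bool" where
  "lifts h t D0 D b \<equiv> \<exists>t'. (\<forall>w\<in>D0. t' w = t w) \<and> regular_point h D t' \<and> pev h t' b \<noteq> 0"

text \<open>
  \<open>As\<close> describes the image of \<open>{b \<noteq> 0}\<close> under restriction of regular points from \<open>D\<close> to \<open>D0\<close>, as the
  union of the open sets \<open>{a \<noteq> 0}\<close>.
\<close>

definition projects :: "'e::field itself \<Rightarrow> 'v set \<Rightarrow> 'v set \<Rightarrow>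
    ('v, 'a) mpol \<Rightarrow> ('v, 'a) mpol set \<Rightarrow> bool" where
  "projects TYPE('e) D0 D b As \<longleftrightarrow> finite As \<and> As \<subseteq> pvars D0 \<and>
     (\<forall>(h :: 'a \<Rightarrow> 'e) t. rhom h \<longrightarrow> regular_point h D0 t \<longrightarrow>
       lifts h t D0 D b \<longleftrightarrow>
       (\<exists>a\<in>As. pev h t a \<noteq> 0))"

lemma projectsI:
  assumes "finite As" "As \<subseteq> pvars D0"
    "\<And>(h :: 'a \<Rightarrow> 'e::field) t. rhom h \<Longrightarrow> regular_point h D0 t \<Longrightarrow>
      lifts h t D0 D b \<longleftrightarrow>
      (\<exists>a\<in>As. pev h t a \<noteq> 0)"
  shows "projects TYPE('e) D0 D b As"
  using assms unfolding projects_def by blast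

lemma projectsD:
  fixes h :: "'a \<Rightarrow> 'e::field"
  assumes "projects TYPE('e) D0 D b As"
  shows "finite As" "As \<subseteq> pvars D0"
    "rhom h \<Longrightarrow> regular_point h D0 t \<Longrightarrow>
      lifts h t D0 D b \<longleftrightarrow>
      (\<exists>a\<in>As. pev h t a \<noteq> 0)"
  using assms unfolding projects_def by blast+

text \<open>
  Over an algebraically closed field, \<open>g\<close> is non-zero at some root of \<open>p\<close> iff \<open>p\<close> does not
  divide \<open>g ^ degree p\<close>, i.e. iff the pseudo-remainder does not vanish.
\<close>

lemma eliminate_variable:
  assumes v: "v \<in> W - Y" and b: "b \<in> pvars (through v)"
  shows "\<exists>As. projects TYPE('e::{alg_closed_field, field_char_0}) (below v) (through v) b As"
proof -
  obtain q where q: "q \<in> cpoly (pvars (below v))" "poly q (pvar v) = b"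
    by (rule pvars_insertE[OF b])
  have nb: "v \<notin> below v" using not_below v by blast
  have upd: "pev h t' a = pev h t a"
    if "\<forall>w\<in>below v. t' w = t w" "a \<in> pvars (below v)" for h :: "'a \<Rightarrow> 'e" and t t' a
    using that pev_cong by blast
  have upd_poly: "map_poly (pev h t') p = map_poly (pev h t) p"
    if "rhom h" "\<forall>w\<in>below v. t' w = t w" "p \<in> cpoly (pvars (below v))" for h :: "'a \<Rightarrow> 'e" and t t' p
    by (rule poly_eqI)
      (simp add: coeff_map_poly rhomD(4)[OF rhom_pev[OF that(1)]] upd[OF that(2) cpolyD[OF that(3)]])
  show ?thesis
  proof (cases "v \<in> L")
    case False
    show ?thesis
    \<comment> \<open>For a free \<open>v\<close> every value extends the point, so \<open>b\<close>
      can be made non-zero iff one of its coefficients is non-zero at \<open>t\<close>; the field is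
      infinite.\<close>
    proof (rule exI[of _ "coeff q ` {..degree q}"], rule projectsI)
      fix h :: "'a \<Rightarrow> 'e" and t assume h: "rhom h" and t: "regular_point h (below v) t"
      note hom = rhomD[OF rhom_pev[OF h]]
      define q' where "q' = map_poly (pev h t) q"
      have ev: "pev h t' b = poly q' (t' v)" if "\<forall>w\<in>below v. t' w = t w" for t'
        unfolding q(2)[symmetric] poly_pp_eval[OF h] upd_poly[OF h that q(1)] q'_def ..
      have "regular_point h (through v) t'" if "\<forall>w\<in>below v. t' w = t w" for t'
      proof -
        have "regular_point h (below v) t'"
          using t regular_point_cong[OF down_below, of v t' t] that by blast
        then show ?thesis
          using vanish_free[OF h, of v t'] v False MnL by (auto simp: regular_point_def)
      qed
      then have "lifts h t (below v) (through v) b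
          \<longleftrightarrow> (\<exists>t'. (\<forall>w\<in>below v. t' w = t w) \<and> poly q' (t' v) \<noteq> 0)"
        using ev by auto
      also have "\<dots> \<longleftrightarrow> (\<exists>e. poly q' e \<noteq> 0)"
        by (rule ex_extension_iff[OF nb])
      also have "\<dots> \<longleftrightarrow> q' \<noteq> 0" using poly_all_0_iff_0[of q'] by blast
      also have "\<dots> \<longleftrightarrow> (\<exists>i. pev h t (coeff q i) \<noteq> 0)"
        unfolding q'_def by (auto simp: poly_eq_iff coeff_map_poly hom)
      also have "\<dots> \<longleftrightarrow> (\<exists>a\<in>coeff q ` {..degree q}. pev h t a \<noteq> 0)"
        by (simp add: ex_coeff_iff hom)
      finally show "lifts h t (below v) (through v) b \<longleftrightarrow> (\<exists>a\<in>coeff q ` {..degree q}. pev h t a \<noteq> 0)" .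
    qed (use cpolyD[OF q(1)] in auto)
  next
    case True
    note cl = cpoly_closed[OF subring_set_pvars]
    define p where "p = pp v"
    define d where "d = degree p"
    have d: "0 < d" unfolding d_def p_def by (rule pp(3)[OF True])
    have p: "p \<in> cpoly (pvars (below v))" unfolding p_def by (rule pp(1)[OF True])
    \<comment> \<open>At \<open>v\<close> this takes the value \<open>b * (init v * sep v)\<close>,
      which combines the condition on \<open>b\<close> with regularity at \<open>v\<close>.\<close>
    define g where "g = q * smult (init v) (formal_deriv p)"
    have g: "g \<in> cpoly (pvars (below v))"
      unfolding g_def using q(1) p init_below[OF True] by (intro cl)
    obtain N a r where ar: "a \<in> cpoly (pvars (below v))" "r \<in> cpoly (pvars (below v))"
        "degree r < d" "smult (init v ^ N) (g ^ d) = a * p + r"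
      using pseudo_division[OF subring_set_pvars p d[unfolded d_def] cl(8)[OF g]]
      unfolding init_def p_def[symmetric] d_def[symmetric] by metis
    show ?thesis
    \<comment> \<open>The factor \<open>init v\<close> makes every condition fail where the initial
      vanishes, as no regular extension exists there.\<close>
    proof (rule exI[of _ "(\<lambda>i. init v * coeff r i) ` {..degree r}"], rule projectsI)
      show "(\<lambda>i. init v * coeff r i) ` {..degree r} \<subseteq> pvars (below v)"
        using cpolyD[OF ar(2)] init_below[OF True] by (auto intro: pvars_mult)
      fix h :: "'a \<Rightarrow> 'e" and t assume h: "rhom h" and t: "regular_point h (below v) t"
      note hom = rhomD[OF rhom_pev[OF h]]
      note mp = map_poly_rhom[OF rhom_pev[OF h]]
      define i' p' g' r' where "i' = pev h t (init v)" and "p' = map_poly (pev h t) p"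
        and "g' = map_poly (pev h t) g" and "r' = map_poly (pev h t) r"
      have iff: "regular_point h (through v) t' \<and> pev h t' b \<noteq> 0 \<longleftrightarrow>
          i' \<noteq> 0 \<and> poly p' (t' v) = 0 \<and> poly g' (t' v) \<noteq> 0"
        if t': "\<forall>w\<in>below v. t' w = t w" for t'
      proof -
        have reg: "regular_point h (below v) t'"
          using t regular_point_cong[OF down_below, of v t' t] t' by blast
        have i: "pev h t' (init v) = i'" unfolding i'_def by (rule upd[OF t' init_below[OF True]])
        have pe: "pev h t' (poly p (pvar v)) = poly p' (t' v)"
          unfolding poly_pp_eval[OF h] upd_poly[OF h t' p] p'_def ..
        have "poly g (pvar v) = b * (init v * sep v)"
          by (simp add: g_def q sep_def p_def)
        then have ge: "poly g' (t' v) = pev h t' b * pev h t' (init v * sep v)"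
          using poly_pp_eval[OF h, of t' g v] unfolding upd_poly[OF h t' g] g'_def by (simp add: hom)
        have van: "vanish h (through v) t' \<longleftrightarrow> poly p' (t' v) = 0" if "i' \<noteq> 0"
        proof
          assume "vanish h (through v) t'"
          moreover have "poly p (pvar v) \<in> P \<inter> pvars (through v)"
            using pp(2)[OF True] poly_in_pvars[OF p, of "pvar v" "through v"]
            by (auto simp: p_def)
          ultimately show "poly p' (t' v) = 0" using pe by (auto simp: vanish_def)
        next
          assume "poly p' (t' v) = 0"
          then show "vanish h (through v) t'"
            using vanish_leader[OF h True, of t'] reg i that pe
            by (auto simp: regular_point_def p_def)
        qed
        have "regular_point h (through v) t' \<longleftrightarrow>
          i' \<noteq> 0 \<and> poly p' (t' v) = 0 \<and> pev h t' (init v * sep v) \<noteq> 0"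
        proof (cases "v \<in> Mn")
          case vM: True
          have "i' \<noteq> 0" if "pev h t' (init v * sep v) \<noteq> 0" using that i by (auto simp: hom)
          then show ?thesis using van reg vM by (auto simp: regular_point_def)
        next
          \<comment> \<open>Outside \<open>Mn\<close> the two inequations hold automatically: the
            initial is a separant of a lower element of \<open>Mn\<close>, and a linear polynomial
            has its initial as separant.\<close>
          case vM: False
          obtain u where u: "u \<in> Mn" "key u < key v" "init v = sep u"
            using derived(2) vM True by blast
          have "u \<in> below v" using u MnL LW by (auto simp: below_def)
          then have "pev h t' (init u * sep u) \<noteq> 0"
            using reg u(1) by (auto simp: regular_point_def)
          then have i0: "i' \<noteq> 0" using i u(3) by (auto simp: hom)
          have d1: "degree (pp v) = 1" using derived(1) vM True by blast
          have "formal_deriv (pp v) = [:init v:]"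
            using d1 by (auto simp: poly_eq_iff coeff_formal_deriv Polynomial.coeff_pCons coeff_eq_0
                init_def split: nat.splits)
          then have s: "sep v = init v" by (simp add: sep_def)
          show ?thesis using van reg vM i0 i s by (auto simp: regular_point_def hom)
        qed
        then show ?thesis using ge by auto
      qed
      have "lifts h t (below v) (through v) b
          \<longleftrightarrow> i' \<noteq> 0 \<and> (\<exists>t'. (\<forall>w\<in>below v. t' w = t w) \<and> poly p' (t' v) = 0 \<and> poly g' (t' v) \<noteq> 0)"
        using iff by blast
      also have "\<dots> \<longleftrightarrow> i' \<noteq> 0 \<and> (\<exists>e. poly p' e = 0 \<and> poly g' e \<noteq> 0)"
        by (simp only: ex_extension_iff[OF nb, of t "\<lambda>e. poly p' e = 0 \<and> poly g' e \<noteq> 0"])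
      also have "\<dots> \<longleftrightarrow> i' \<noteq> 0 \<and> r' \<noteq> 0"
      proof (intro conj_cong refl)
        assume i': "i' \<noteq> 0"
        have lc: "coeff p' d = i'"
          by (simp add: p'_def coeff_map_poly hom i'_def init_def d_def p_def)
        have "degree p' \<le> d"
          unfolding p'_def d_def by (rule degree_map_poly_rhom[OF rhom_pev[OF h]])
        \<comment> \<open>A non-zero initial preserves the degree of \<open>p\<close> under
          evaluation. Hence \<open>r'\<close> still has smaller degree than \<open>p'\<close> and is
          divisible by it only if it is zero.\<close>
        then have dp': "degree p' = d" using lc i' le_degree by (metis antisym)
        have dr': "degree r' < d"
          unfolding r'_def using ar(3) degree_map_poly_rhom[OF rhom_pev[OF h], of t r] by linarith
        define a' where "a' = map_poly (pev h t) a"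
        have div: "smult (i' ^ N) (g' ^ d) = a' * p' + r'"
          using arg_cong[OF ar(4), of "map_poly (pev h t)"]
          by (simp add: mp hom g'_def a'_def p'_def r'_def i'_def)
        show "(\<exists>e. poly p' e = 0 \<and> poly g' e \<noteq> 0) \<longleftrightarrow> r' \<noteq> 0"
        proof
          assume "\<exists>e. poly p' e = 0 \<and> poly g' e \<noteq> 0"
          then obtain e where "poly p' e = 0" "poly g' e \<noteq> 0" by blast
          then have "poly r' e \<noteq> 0"
            using arg_cong[OF div, of "\<lambda>p. poly p e"] i' by auto
          then show "r' \<noteq> 0" by auto
        next
          assume r': "r' \<noteq> 0"
          show "\<exists>e. poly p' e = 0 \<and> poly g' e \<noteq> 0"
          proof (rule ccontr)
            assume "\<not> ?thesis"
            then have "p' dvd g' ^ degree p'"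
              using dp' d by (intro dvd_power_degree_if_roots) auto
            then have "p' dvd smult (i' ^ N) (g' ^ d)"
              by (simp add: dp' dvd_smult)
            then have "p' dvd r'" unfolding div by (simp add: dvd_add_right_iff)
            then have "degree p' \<le> degree r'" using r' by (rule dvd_imp_degree_le)
            then show False using dr' dp' by simp
          qed
        qed
      qed
      also have "\<dots> \<longleftrightarrow> (\<exists>i. i' * pev h t (coeff r i) \<noteq> 0)"
        unfolding r'_def by (simp add: poly_eq_iff coeff_map_poly hom)
      also have "\<dots> \<longleftrightarrow> (\<exists>a\<in>(\<lambda>i. init v * coeff r i) ` {..degree r}. pev h t a \<noteq> 0)"
        using ex_coeff_iff[of "pev h t" r] by (simp add: hom i'_def)
      finally show "lifts h t (below v) (through v) b \<longleftrightarrow>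
        (\<exists>a\<in>(\<lambda>i. init v * coeff r i) ` {..degree r}. pev h t a \<noteq> 0)" .
    qed simp
  qed
qed

text \<open>Beyond the top variable \<open>v\<close> of \<open>b\<close> and
  \<open>Mn \<inter> D\<close>, every regular point extends by \<open>regular_point_extend\<close>.
  So only \<open>v\<close> is eliminated by force, and the resulting conditions live on
  \<open>below v\<close>, where \<open>IH\<close> applies.\<close>

lemma eliminate_down_step:
  assumes D: "down D" and b: "b \<in> pvars D"
    and IH: "\<And>v b. v \<in> D - Y \<Longrightarrow> b \<in> pvars (below v) \<Longrightarrow>
      \<exists>As. projects TYPE('e::{alg_closed_field, field_char_0}) Y (below v) b As"
  shows "\<exists>As. projects TYPE('e) Y D b As"
proof -
  have YD: "Y \<subseteq> D" and DW: "D \<subseteq> W" using D by (auto simp: down_def)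
  obtain A where A: "finite A" "A \<subseteq> D" "b \<in> pvars A" by (rule pvars_finite_support[OF b])
  \<comment> \<open>Adding \<open>Mn \<inter> D\<close> leaves only free variables and linear
    leaders above the top of \<open>B\<close>.\<close>
  define B where "B = A \<union> (Mn \<inter> D)"
  have B: "finite B" "B \<subseteq> D" "b \<in> pvars B"
    using A fin by (auto simp: B_def intro: pvars_mono)
  show ?thesis
  proof (cases "B \<subseteq> Y")
    case True
    have "projects TYPE('e) Y D b {b}"
    proof (rule projectsI)
      show "{b} \<subseteq> pvars Y" using B(3) True by (auto intro: pvars_mono)
      fix h :: "'a \<Rightarrow> 'e" and t assume h: "rhom h" and t: "regular_point h Y t"
      have "Mn \<inter> D \<subseteq> Y" using True by (auto simp: B_def)
      from regular_point_extend[OF h D down_Y YD this t]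
      obtain t' where t': "regular_point h D t'" "\<And>v. v \<in> Y \<Longrightarrow> t' v = t v" by blast
      have eq: "pev h t'' b = pev h t b" if "\<And>w. w \<in> Y \<Longrightarrow> t'' w = t w" for t''
        by (rule pev_cong[OF pvars_mono[OF B(3) True] that])
      show "lifts h t Y D b \<longleftrightarrow>
        (\<exists>a\<in>{b}. pev h t a \<noteq> 0)"
      proof
        assume "lifts h t Y D b"
        then obtain t2 where t2: "\<forall>w\<in>Y. t2 w = t w" "pev h t2 b \<noteq> 0" by blast
        then show "\<exists>a\<in>{b}. pev h t a \<noteq> 0" using eq[of t2] by simp
      next
        assume "\<exists>a\<in>{b}. pev h t a \<noteq> 0"
        then have "pev h t' b \<noteq> 0" using eq[OF t'(2)] by simp
        then show "lifts h t Y D b"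
          using t' by (intro exI[of _ t']) simp
      qed
    qed simp
    then show ?thesis ..
  next
    case False
    obtain v where v: "v \<in> B - Y" "B \<subseteq> through v"
      by (rule top_variable[OF B(1) _ False]) (use B(2) DW in auto)
    have vW: "v \<in> W - Y" and vD: "v \<in> D - Y" using v B(2) DW by auto
    have bD: "through v \<subseteq> D" using D vD by (auto simp: down_def)
    obtain As1 where As1: "projects TYPE('e) (below v) (through v) b As1"
      using eliminate_variable[OF vW pvars_mono[OF B(3) v(2)]] by blast
    have "\<forall>a\<in>As1. \<exists>As. projects TYPE('e) Y (below v) a As"
      using IH[OF vD] projectsD(2)[OF As1] by blast
    then obtain As where As: "\<And>a. a \<in> As1 \<Longrightarrow> projects TYPE('e) Y (below v) a (As a)" by metis
    have "projects TYPE('e) Y D b (\<Union>a\<in>As1. As a)"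
    proof (rule projectsI)
      show "finite (\<Union>a\<in>As1. As a)" using projectsD(1)[OF As1] projectsD(1)[OF As] by blast
      show "(\<Union>a\<in>As1. As a) \<subseteq> pvars Y" using projectsD(2)[OF As] by blast
      fix h :: "'a \<Rightarrow> 'e" and t assume h: "rhom h" and t: "regular_point h Y t"
      have "lifts h t Y D b \<longleftrightarrow>
        lifts h t Y (through v) b"
        (is "?l \<longleftrightarrow> ?r")
      proof
        assume ?l then show ?r using regular_point_mono[OF _ bD] by blast
      next
        assume ?r
        then obtain t' where t': "\<forall>w\<in>Y. t' w = t w" "regular_point h (through v) t'"
          "pev h t' b \<noteq> 0" by blast
        have M: "Mn \<inter> D \<subseteq> through v" using v(2) by (auto simp: B_def)
        have "down (through v)" using down_insert vW by blast
        from regular_point_extend[OF h D this bD M t'(2)]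
        obtain t2 where t2: "regular_point h D t2" "\<And>w. w \<in> through v \<Longrightarrow> t2 w = t' w"
          by blast
        have "pev h t2 b = pev h t' b" using pev_cong[OF pvars_mono[OF B(3) v(2)] t2(2)] .
        then show ?l using t2 t' Y_below[of v] by (intro exI[of _ t2]) auto
      qed
      also have "\<dots> \<longleftrightarrow> (\<exists>a\<in>As1. lifts h t Y (below v) a)"
        (is "_ \<longleftrightarrow> ?r")
      proof
        assume "lifts h t Y (through v) b"
        then obtain t' where t': "\<forall>w\<in>Y. t' w = t w" "regular_point h (through v) t'"
          "pev h t' b \<noteq> 0" by blast
        have reg: "regular_point h (below v) t'" using regular_point_mono[OF t'(2)] by blast
        have "\<exists>a\<in>As1. pev h t' a \<noteq> 0"
          unfolding projectsD(3)[OF As1 h reg, symmetric] using t' by (intro exI[of _ t']) simp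
        then show ?r using t'(1) reg by blast
      next
        assume ?r
        then obtain a t' where t': "a \<in> As1" "\<forall>w\<in>Y. t' w = t w" "regular_point h (below v) t'"
          "pev h t' a \<noteq> 0" by blast
        have "\<exists>t2. (\<forall>w\<in>below v. t2 w = t' w) \<and> regular_point h (through v) t2 \<and> pev h t2 b \<noteq> 0"
          unfolding projectsD(3)[OF As1 h t'(3)] using t' by blast
        then obtain t2 where "\<forall>w\<in>below v. t2 w = t' w" "regular_point h (through v) t2"
          "pev h t2 b \<noteq> 0" by blast
        then show "lifts h t Y (through v) b"
          using t'(2) Y_below[of v] by (intro exI[of _ t2]) auto
      qed
      also have "\<dots> \<longleftrightarrow> (\<exists>a\<in>As1. \<exists>c\<in>As a. pev h t c \<noteq> 0)"
        using projectsD(3)[OF As h t] by (intro bex_cong refl) blast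
      finally show "lifts h t Y D b \<longleftrightarrow>
        (\<exists>a\<in>\<Union>a\<in>As1. As a. pev h t a \<noteq> 0)" by simp
    qed
    then show ?thesis ..
  qed
qed

text \<open>The induction on \<open>key\<close> runs over the segments \<open>below v\<close>.
  \<open>W\<close> itself may have no highest variable, so one further step is taken from these
  segments to \<open>W\<close>.\<close>

theorem eliminate:
  assumes b: "b \<in> pvars W"
  shows "\<exists>As. projects TYPE('e::{alg_closed_field, field_char_0}) Y W b As"
proof -
  have "\<exists>As. projects TYPE('e) Y (below v) b As" if "b \<in> pvars (below v)" for v b
    using that
  proof (induction "key v" arbitrary: v b rule: less_induct)
    case (less v b)
    show ?case
    proof (rule eliminate_down_step[OF down_below less.prems])
      fix w and b :: "('v, 'a) mpol"
      assume w: "w \<in> below v - Y" and b: "b \<in> pvars (below w)"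
      have "key w < key v" using w by (auto simp: below_def)
      from less.hyps[OF this b] show "\<exists>As. projects TYPE('e) Y (below w) b As" .
    qed
  qed
  then show ?thesis by (rule eliminate_down_step[OF down_W b])
qed

end

section \<open>Prime differential ideals\<close>

definition derivation :: "('r::comm_ring_1 \<Rightarrow> 'r) \<Rightarrow> bool" where
  "derivation d \<longleftrightarrow> (\<forall>a b. d (a + b) = d a + d b) \<and> (\<forall>a b. d (a * b) = d a * b + a * d b)"

lemma derivationD:
  assumes "derivation d"
  shows "d (a + b) = d a + d b" "d (a * b) = d a * b + a * d b" "d 0 = 0" "d 1 = 0"
    "d (- a) = - d a" "d (a - b) = d a - d b" "d (sum f A) = (\<Sum>x\<in>A. d (f x))"
    "d (of_nat k * a) = of_nat k * d a"
proof -
  show a: "d (a + b) = d a + d b" and m: "d (a * b) = d a * b + a * d b" for a b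
    using assms by (auto simp: derivation_def)
  show 0: "d 0 = 0" using a[of 0 0] by simp
  show 1: "d 1 = 0" using m[of 1 1] by simp
  show u: "d (- a) = - d a" for a using a[of a "- a"] 0 by (simp add: eq_neg_iff_add_eq_0 add.commute)
  show "d (a - b) = d a - d b" using a[of a "- b"] u by simp
  show "d (sum f A) = (\<Sum>x\<in>A. d (f x))" by (induction A rule: infinite_finite_induct) (auto simp: 0 a)
  have "d (of_nat k) = 0" by (induction k) (auto simp: 0 1 a)
  then show "d (of_nat k * a) = of_nat k * d a" by (simp add: m)
qed

lemma leibniz:
  assumes d: "derivation d"
  shows "(d ^^ n) (a * b) = (\<Sum>k\<le>n. of_nat (n choose k) * ((d ^^ k) a * (d ^^ (n - k)) b))"
proof (induction n)
  case (Suc n)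
  define f where "f = (\<lambda>k l. (d ^^ k) a * (d ^^ l) b)"
  have df: "d (f k l) = f (Suc k) l + f k (Suc l)" for k l
    by (simp add: f_def derivationD(2)[OF d])
  have "(d ^^ Suc n) (a * b) = d (\<Sum>k\<le>n. of_nat (n choose k) * f k (n - k))"
    using Suc by (simp add: f_def)
  also have "\<dots> = (\<Sum>k\<le>n. of_nat (n choose k) * f (Suc k) (n - k)) +
      (\<Sum>k\<le>n. of_nat (n choose k) * f k (Suc n - k))"
    by (simp add: derivationD(7,8)[OF d] df distrib_left sum.distrib Suc_diff_le)
  also have "(\<Sum>k\<le>n. of_nat (n choose k) * f k (Suc n - k)) =
      (\<Sum>k\<le>Suc n. of_nat (n choose k) * f k (Suc n - k))"
    by (simp add: binomial_eq_0)
  also have "\<dots> = f 0 (Suc n) + (\<Sum>k\<le>n. of_nat (n choose Suc k) * f (Suc k) (n - k))"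
    by (subst sum.atMost_Suc_shift) simp
  also have "(\<Sum>k\<le>n. of_nat (n choose k) * f (Suc k) (n - k)) + \<dots> =
      f 0 (Suc n) + (\<Sum>k\<le>n. of_nat (Suc n choose Suc k) * f (Suc k) (n - k))"
    by (simp add: distrib_right sum.distrib add_ac)
  also have "\<dots> = (\<Sum>k\<le>Suc n. of_nat (Suc n choose k) * f k (Suc n - k))"
    by (subst sum.atMost_Suc_shift) simp
  finally show ?case by (simp only: f_def)
qed simp

definition prime_in :: "'r::comm_ring_1 set \<Rightarrow> 'r set \<Rightarrow> bool" where
  "prime_in C p \<longleftrightarrow> p \<subseteq> C \<and> 0 \<in> p \<and> 1 \<notin> p \<and> (\<forall>a\<in>p. \<forall>b\<in>p. a + b \<in> p) \<and>
     (\<forall>a\<in>p. \<forall>c\<in>C. c * a \<in> p) \<and> (\<forall>a\<in>C. \<forall>b\<in>C. a * b \<in> p \<longrightarrow> a \<in> p \<or> b \<in> p)"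

lemma prime_inD:
  assumes "prime_in C p"
  shows "a \<in> p \<Longrightarrow> a \<in> C" "0 \<in> p" "1 \<notin> p" "a \<in> p \<Longrightarrow> b \<in> p \<Longrightarrow> a + b \<in> p"
    "a \<in> p \<Longrightarrow> c \<in> C \<Longrightarrow> c * a \<in> p" "a * b \<in> p \<Longrightarrow> a \<in> C \<Longrightarrow> b \<in> C \<Longrightarrow> a \<in> p \<or> b \<in> p"
  using assms unfolding prime_in_def by blast+

lemma prime_in_sum:
  assumes p: "prime_in C p" and f: "\<And>x. x \<in> A \<Longrightarrow> f x \<in> p"
  shows "sum f A \<in> p"
  using f by (induction A rule: infinite_finite_induct) (auto intro: prime_inD(2,4)[OF p])

lemma prime_in_diff:
  assumes p: "prime_in C p" and C: "subring_set C" and ab: "a \<in> p" "b \<in> p"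
  shows "a - b \<in> p"
proof -
  have "-1 \<in> C" using subring_setD(1,4)[OF C] by blast
  then have "-1 * b \<in> p" using ab(2) by (rule prime_inD(5)[OF p, rotated])
  then show ?thesis using prime_inD(4)[OF p ab(1), of "- b"] by simp
qed

text \<open>Let \<open>m\<close> and \<open>n\<close> be the least orders at which the derivatives
  of \<open>a\<close> and \<open>b\<close> leave \<open>p\<close>. In the Leibniz expansion of the
  derivative of \<open>a * b\<close> of order \<open>m + n\<close>, every term except
  \<open>k = m\<close> contains a derivative of smaller order, hence lies in \<open>p\<close>; the
  remaining term must then lie in \<open>p\<close> as well.\<close>

lemma prime_in_differential_core:
  assumes C: "subring_set C" and Q: "\<And>n. 0 < n \<Longrightarrow> \<exists>c\<in>C. c * of_nat n = 1"
    and d: "derivation d" and dC: "\<And>a. a \<in> C \<Longrightarrow> d a \<in> C" and p: "prime_in C p"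
  shows "prime_in C {a \<in> C. \<forall>k. (d ^^ k) a \<in> p}"
  unfolding prime_in_def
proof (intro conjI ballI impI)
  let ?q = "{a \<in> C. \<forall>k. (d ^^ k) a \<in> p}"
  note cl = subring_setD[OF C] and D = derivationD[OF d]
  have pw0: "(d ^^ k) 0 = 0" for k by (induction k) (auto simp: D)
  have pwC: "(d ^^ k) a \<in> C" if "a \<in> C" for a k by (induction k) (auto simp: dC that)
  have pwadd: "(d ^^ k) (a + b) = (d ^^ k) a + (d ^^ k) b" for k a b by (induction k) (auto simp: D)
  show "?q \<subseteq> C" by blast
  show "0 \<in> ?q" using cl(2) prime_inD(2)[OF p] by (simp add: pw0)
  show "1 \<notin> ?q"
  proof
    assume "1 \<in> ?q"
    then have "(d ^^ 0) 1 \<in> p" by blast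
    then show False using prime_inD(3)[OF p] by simp
  qed
  show "a + b \<in> ?q" if "a \<in> ?q" "b \<in> ?q" for a b
    using that by (auto simp: pwadd intro: cl prime_inD(4)[OF p])
  show "c * a \<in> ?q" if a: "a \<in> ?q" and c: "c \<in> C" for a c
  proof -
    have "(d ^^ n) (c * a) \<in> p" for n
      unfolding leibniz[OF d]
    proof (rule prime_in_sum[OF p])
      fix k
      have "(d ^^ k) c * (d ^^ (n - k)) a \<in> p"
        using a by (intro prime_inD(5)[OF p] pwC c) blast
      then show "of_nat (n choose k) * ((d ^^ k) c * (d ^^ (n - k)) a) \<in> p"
        by (rule prime_inD(5)[OF p]) (rule cl)
    qed
    then show ?thesis using a c by (auto intro: cl)
  qed
  show "a \<in> ?q \<or> b \<in> ?q" if a: "a \<in> C" and b: "b \<in> C" and ab: "a * b \<in> ?q" for a b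
  proof (rule ccontr)
    assume "\<not> ?thesis"
    then have ex: "\<exists>k. (d ^^ k) a \<notin> p" "\<exists>k. (d ^^ k) b \<notin> p" using a b by auto
    define m n where "m = (LEAST k. (d ^^ k) a \<notin> p)" and "n = (LEAST k. (d ^^ k) b \<notin> p)"
    have m: "(d ^^ m) a \<notin> p" "\<And>k. k < m \<Longrightarrow> (d ^^ k) a \<in> p"
      unfolding m_def using LeastI_ex[OF ex(1)] not_less_Least by blast+
    have n: "(d ^^ n) b \<notin> p" "\<And>k. k < n \<Longrightarrow> (d ^^ k) b \<in> p"
      unfolding n_def using LeastI_ex[OF ex(2)] not_less_Least by blast+
    define f where "f = (\<lambda>k. of_nat (m + n choose k) * ((d ^^ k) a * (d ^^ (m + n - k)) b))"
    have f: "f k \<in> p" if "k \<le> m + n" "k \<noteq> m" for k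
    proof -
      have "(d ^^ k) a * (d ^^ (m + n - k)) b \<in> p"
      proof (cases "k < m")
        case True
        have "(d ^^ (m + n - k)) b * (d ^^ k) a \<in> p"
          by (rule prime_inD(5)[OF p m(2)[OF True] pwC[OF b]])
        then show ?thesis by (simp add: mult.commute)
      next
        case False
        then have "m + n - k < n" using that by linarith
        then show ?thesis by (intro prime_inD(5)[OF p n(2) pwC[OF a]])
      qed
      then show ?thesis unfolding f_def by (rule prime_inD(5)[OF p]) (rule cl)
    qed
    have "(\<Sum>k\<le>m + n. f k) \<in> p" using ab by (simp add: f_def leibniz[OF d, symmetric])
    moreover have "(\<Sum>k\<in>{..m + n} - {m}. f k) \<in> p" using f by (intro prime_in_sum[OF p]) auto
    moreover have "(\<Sum>k\<le>m + n. f k) = f m + (\<Sum>k\<in>{..m + n} - {m}. f k)"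
      by (rule sum.remove) auto
    ultimately have "f m \<in> p" using prime_in_diff[OF p C] by (metis add_diff_cancel_right')
    \<comment> \<open>The binomial coefficient is a unit of \<open>C\<close>, so it can be removed
      before primality is applied.\<close>
    moreover obtain c where c: "c \<in> C" "c * of_nat (m + n choose m) = 1"
      using Q[of "m + n choose m"] by auto
    ultimately have "c * f m \<in> p" by (intro prime_inD(5)[OF p])
    moreover have "c * f m = (d ^^ m) a * (d ^^ n) b"
      using arg_cong[OF c(2), of "\<lambda>x. x * ((d ^^ m) a * (d ^^ n) b)"] by (simp add: f_def mult.assoc)
    ultimately show False
      using prime_inD(6)[OF p, of "(d ^^ m) a" "(d ^^ n) b"] m(1) n(1) pwC a b by auto
  qed
qed

text \<open>The core is taken for one derivation after another. Since the derivations commute, a new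
  core remains stable under the earlier ones; \<open>J\<close> survives because it is stable under
  all of them.\<close>

lemma prime_differential_ideal_below:
  fixes D :: "'d \<Rightarrow> 'r::comm_ring_1 \<Rightarrow> 'r"
  assumes fin: "finite \<Delta>"
    and C: "subring_set C" and Q: "\<And>n. 0 < n \<Longrightarrow> \<exists>c\<in>C. c * of_nat n = 1"
    and d: "\<And>j. j \<in> \<Delta> \<Longrightarrow> derivation (D j)" and dC: "\<And>j a. j \<in> \<Delta> \<Longrightarrow> a \<in> C \<Longrightarrow> D j a \<in> C"
    and comm: "\<And>i j a. i \<in> \<Delta> \<Longrightarrow> j \<in> \<Delta> \<Longrightarrow> D i (D j a) = D j (D i a)"
    and p: "prime_in C p" and J: "J \<subseteq> p" "\<And>j a. j \<in> \<Delta> \<Longrightarrow> a \<in> J \<Longrightarrow> D j a \<in> J"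
  obtains q where "prime_in C q" "q \<subseteq> p" "J \<subseteq> q" "\<And>j a. j \<in> \<Delta> \<Longrightarrow> a \<in> q \<Longrightarrow> D j a \<in> q"
proof -
  have "\<exists>q. prime_in C q \<and> q \<subseteq> p \<and> J \<subseteq> q \<and> (\<forall>j\<in>\<Delta>'. \<forall>a\<in>q. D j a \<in> q)"
    if "finite \<Delta>'" "\<Delta>' \<subseteq> \<Delta>" for \<Delta>'
    using that
  proof (induction \<Delta>')
    case empty
    show ?case using p J by blast
  next
    case (insert i \<Delta>')
    then have i: "i \<in> \<Delta>" and sub: "\<Delta>' \<subseteq> \<Delta>" by auto
    obtain q where q: "prime_in C q" "q \<subseteq> p" "J \<subseteq> q" "\<And>j a. j \<in> \<Delta>' \<Longrightarrow> a \<in> q \<Longrightarrow> D j a \<in> q"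
      using insert.IH[OF sub] by blast
    let ?q = "{a \<in> C. \<forall>k. (D i ^^ k) a \<in> q}"
    have Jk: "a \<in> J \<Longrightarrow> (D i ^^ k) a \<in> J" for a k by (induction k) (auto intro: J(2)[OF i])
    have q0: "?q \<subseteq> q" by (auto dest: spec[of _ 0])
    show ?case
    proof (intro exI[of _ ?q] conjI ballI)
      show "prime_in C ?q" by (rule prime_in_differential_core[OF C Q d[OF i] dC[OF i] q(1)])
      show "?q \<subseteq> p" using q0 q(2) by blast
      show "J \<subseteq> ?q" using Jk q(3) prime_inD(1)[OF q(1)] by blast
      fix j a assume j: "j \<in> insert i \<Delta>'" and a: "a \<in> ?q"
      show "D j a \<in> ?q"
      proof (cases "j = i")
        case True
        then show ?thesis using a dC[OF i] by (auto simp: funpow_swap1 dest: spec[of _ "Suc _"])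
      next
        case False
        have "(D i ^^ k) (D j a) = D j ((D i ^^ k) a)" for k
          by (induction k) (use comm[of i j] i j sub in auto)
        then show ?thesis using a q(4) j False dC sub by auto
      qed
    qed
  qed
  from this[OF fin subset_refl] show ?thesis using that by blast
qed

section \<open>Differential fields of fractions\<close>

text \<open>
  The fraction field of \<open>C / q\<close>, carried by a subset of \<open>'a\<close>: the fraction \<open>a / b\<close> is the code
  \<open>pr (enc x) (enc y)\<close> of a chosen representative \<open>x / y\<close>.
\<close>

locale prime_fractions =
  fixes \<Delta> :: "'d set" and C q :: "'r::comm_ring_1 set" and D :: "'d \<Rightarrow> 'r \<Rightarrow> 'r"
    and enc :: "'r \<Rightarrow> 'a" and pr :: "'a \<Rightarrow> 'a \<Rightarrow> 'a"
  assumes C: "subring_set C" and q: "prime_in C q"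
    and d: "\<And>j. j \<in> \<Delta> \<Longrightarrow> derivation (D j)" and dC: "\<And>j a. j \<in> \<Delta> \<Longrightarrow> a \<in> C \<Longrightarrow> D j a \<in> C"
    and dq: "\<And>j a. j \<in> \<Delta> \<Longrightarrow> a \<in> q \<Longrightarrow> D j a \<in> q"
    and comm: "\<And>i j a. i \<in> \<Delta> \<Longrightarrow> j \<in> \<Delta> \<Longrightarrow> D i (D j a) = D j (D i a)"
    and enc: "inj_on enc C" and pr: "\<And>a b c d. pr a b = pr c d \<Longrightarrow> a = c \<and> b = d"
begin

abbreviation N :: "'r set" where "N \<equiv> C - q"

lemmas cl = subring_setD[OF C]

lemma one_in [simp]: "1 \<in> C" by (rule cl)

lemma one_notin [simp]: "1 \<notin> q" by (rule prime_inD(3)[OF q])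

lemma N_1 [simp]: "1 \<in> N" using cl(1) by simp

lemma N_mult: "a \<in> N \<Longrightarrow> b \<in> N \<Longrightarrow> a * b \<in> N" using cl(6) prime_inD(6)[OF q] by blast

lemma C_mult [simp]: "a \<in> C \<Longrightarrow> b \<in> C \<Longrightarrow> a * b \<in> C" by (rule cl)

lemma mult_in_iff [simp]: "a \<in> C \<Longrightarrow> b \<in> C \<Longrightarrow> a * b \<in> q \<longleftrightarrow> a \<in> q \<or> b \<in> q"
  using prime_inD(5,6)[OF q] by (metis mult.commute)

lemma NC: "a \<in> N \<Longrightarrow> a \<in> C" by blast

definition same :: "'r \<times> 'r \<Rightarrow> 'r \<times> 'r \<Rightarrow> bool" where
  "same x y \<longleftrightarrow> fst x * snd y - fst y * snd x \<in> q"

lemma same_refl: "same x x" using prime_inD(2)[OF q] by (simp add: same_def)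

lemma same_sym: assumes "same x y" shows "same y x"
  using prime_in_diff[OF q C prime_inD(2)[OF q] assms[unfolded same_def]] by (simp add: same_def)

lemma same_trans:
  assumes x: "x \<in> C \<times> N" and y: "y \<in> C \<times> N" and z: "z \<in> C \<times> N" and xy: "same x y" and yz: "same y z"
  shows "same x z"
proof -
  have C': "snd z \<in> C" "snd x \<in> C" using x z by auto
  have "snd z * (fst x * snd y - fst y * snd x) + snd x * (fst y * snd z - fst z * snd y) \<in> q"
    using xy yz C' unfolding same_def by (intro prime_inD(4,5)[OF q])
  also have "snd z * (fst x * snd y - fst y * snd x) + snd x * (fst y * snd z - fst z * snd y) =
    snd y * (fst x * snd z - fst z * snd x)" by (simp add: algebra_simps)
  finally have "snd y \<in> q \<or> fst x * snd z - fst z * snd x \<in> q"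
    using x y z by (intro prime_inD(6)[OF q]) (auto intro!: cl)
  then show ?thesis using y by (auto simp: same_def)
qed

text \<open>The choice is made among all representatives of the class, so pairs with the same
  fraction choose the same one.\<close>

definition rep :: "'r \<Rightarrow> 'r \<Rightarrow> 'r \<times> 'r" where
  "rep a b = (SOME x. x \<in> C \<times> N \<and> same (a, b) x)"

definition frac :: "'r \<Rightarrow> 'r \<Rightarrow> 'a" where
  "frac a b = pr (enc (fst (rep a b))) (enc (snd (rep a b)))"

lemma rep: "a \<in> C \<Longrightarrow> b \<in> N \<Longrightarrow> rep a b \<in> C \<times> N \<and> same (a, b) (rep a b)"
  unfolding rep_def by (rule someI[of _ "(a, b)"]) (auto simp: same_refl)

lemma frac_eq_iff:
  assumes "a \<in> C" "b \<in> N" "a' \<in> C" "b' \<in> N"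
  shows "frac a b = frac a' b' \<longleftrightarrow> a * b' - a' * b \<in> q"
proof
  note r = rep[OF assms(1,2)] rep[OF assms(3,4)]
  have v: "(a, b) \<in> C \<times> N" "(a', b') \<in> C \<times> N" using assms by auto
  assume "frac a b = frac a' b'"
  note e = pr[OF this[unfolded frac_def]]
  have "fst (rep a b) = fst (rep a' b')"
    by (rule inj_onD[OF enc conjunct1[OF e]]) (use r in \<open>auto simp: mem_Times_iff\<close>)
  moreover have "snd (rep a b) = snd (rep a' b')"
    by (rule inj_onD[OF enc conjunct2[OF e]]) (use r in \<open>auto simp: mem_Times_iff\<close>)
  ultimately have "rep a b = rep a' b'" by (rule prod_eqI)
  then have "same (rep a b) (a', b')" using same_sym[of "(a', b')"] r by simp
  then have "same (a, b) (a', b')"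
    using same_trans[OF v(1) _ v(2), of "rep a b"] r by blast
  then show "a * b' - a' * b \<in> q" by (simp add: same_def)
next
  have v: "(a, b) \<in> C \<times> N" "(a', b') \<in> C \<times> N" using assms by auto
  assume "a * b' - a' * b \<in> q"
  then have s: "same (a, b) (a', b')" by (simp add: same_def)
  have "x \<in> C \<times> N \<and> same (a, b) x \<longleftrightarrow> x \<in> C \<times> N \<and> same (a', b') x" for x
    using same_trans[OF v _ s] same_trans[OF v(2,1) _ same_sym[OF s]] by blast
  then show "frac a b = frac a' b'" by (simp add: frac_def rep_def)
qed

lemma frac_eqI:
  assumes "a \<in> C" "b \<in> N" "a' \<in> C" "b' \<in> N" "a * b' = a' * b"
  shows "frac a b = frac a' b'"
  using frac_eq_iff[OF assms(1-4)] assms(5) prime_inD(2)[OF q] by simp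

definition fracs :: "'a set" where "fracs = (\<lambda>(a, b). frac a b) ` (C \<times> N)"

definition num_den :: "'a \<Rightarrow> 'r \<times> 'r" where
  "num_den x = (SOME y. y \<in> C \<times> N \<and> x = frac (fst y) (snd y))"

lemma fracs_frac: "a \<in> C \<Longrightarrow> b \<in> N \<Longrightarrow> frac a b \<in> fracs"
  by (auto simp: fracs_def)

lemma fracsE: assumes "x \<in> fracs" obtains a b where "a \<in> C" "b \<in> N" "x = frac a b"
  using assms by (auto simp: fracs_def)

lemma num_den:
  assumes "a \<in> C" "b \<in> N"
  shows "fst (num_den (frac a b)) \<in> C" "snd (num_den (frac a b)) \<in> N"
    "a * snd (num_den (frac a b)) - fst (num_den (frac a b)) * b \<in> q"
proof -
  have *: "num_den (frac a b) \<in> C \<times> N \<and> frac a b = frac (fst (num_den (frac a b))) (snd (num_den (frac a b)))"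
    unfolding num_den_def by (rule someI[of _ "(a, b)"]) (use assms in auto)
  then show 1: "fst (num_den (frac a b)) \<in> C" "snd (num_den (frac a b)) \<in> N" by auto
  show "a * snd (num_den (frac a b)) - fst (num_den (frac a b)) * b \<in> q"
    using frac_eq_iff[OF assms 1] * by blast
qed

text \<open>The operations decode their arguments by the choice in \<open>num_den\<close>;
  \<open>frac_mult\<close> and \<open>frac_add\<close> show that any other representatives give the
  same result.\<close>

definition Frac :: "'a ring" where
  "Frac = \<lparr>carrier = fracs,
     monoid.mult = (\<lambda>x y. frac (fst (num_den x) * fst (num_den y)) (snd (num_den x) * snd (num_den y))),
     one = frac 1 1, ring.zero = frac 0 1,
     add = (\<lambda>x y. frac (fst (num_den x) * snd (num_den y) + fst (num_den y) * snd (num_den x))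
       (snd (num_den x) * snd (num_den y)))\<rparr>"

definition frac_deriv :: "'d \<Rightarrow> 'a \<Rightarrow> 'a" where
  "frac_deriv j x = frac (D j (fst (num_den x)) * snd (num_den x) - fst (num_den x) * D j (snd (num_den x)))
     (snd (num_den x) * snd (num_den x))"

lemma carrier [simp]: "carrier Frac = fracs"
  and one [simp]: "one Frac = frac 1 1" and zero [simp]: "ring.zero Frac = frac 0 1"
  by (auto simp: Frac_def)

lemma frac_mult:
  assumes "a \<in> C" "b \<in> N" "a' \<in> C" "b' \<in> N"
  shows "frac a b \<otimes>\<^bsub>Frac\<^esub> frac a' b' = frac (a * a') (b * b')"
proof -
  obtain x y where xy: "num_den (frac a b) = (x, y)" by (cases "num_den (frac a b)")
  obtain x' y' where xy': "num_den (frac a' b') = (x', y')" by (cases "num_den (frac a' b')")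
  note n = num_den[OF assms(1,2), unfolded xy fst_conv snd_conv]
    and n' = num_den[OF assms(3,4), unfolded xy' fst_conv snd_conv]
  \<comment> \<open>The multipliers make the mixed terms cancel, which leaves the cross difference
    of the two products.\<close>
  have "(a' * y') * (a * y - x * b) + (x * b) * (a' * y' - x' * b') \<in> q"
    using n n' assms by (intro prime_inD(4,5)[OF q] cl) auto
  also have "(a' * y') * (a * y - x * b) + (x * b) * (a' * y' - x' * b') =
      (a * a') * (y * y') - (x * x') * (b * b')" by (simp add: algebra_simps)
  finally have "frac (a * a') (b * b') = frac (x * x') (y * y')"
    using n(1,2) n'(1,2) assms by (subst frac_eq_iff) (auto intro!: cl)
  then show ?thesis by (simp add: Frac_def xy xy')
qed

lemma frac_add:
  assumes "a \<in> C" "b \<in> N" "a' \<in> C" "b' \<in> N"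
  shows "frac a b \<oplus>\<^bsub>Frac\<^esub> frac a' b' = frac (a * b' + a' * b) (b * b')"
proof -
  obtain x y where xy: "num_den (frac a b) = (x, y)" by (cases "num_den (frac a b)")
  obtain x' y' where xy': "num_den (frac a' b') = (x', y')" by (cases "num_den (frac a' b')")
  note n = num_den[OF assms(1,2), unfolded xy fst_conv snd_conv]
    and n' = num_den[OF assms(3,4), unfolded xy' fst_conv snd_conv]
  have "(b' * y') * (a * y - x * b) + (b * y) * (a' * y' - x' * b') \<in> q"
    using n n' assms by (intro prime_inD(4,5)[OF q] cl) auto
  also have "(b' * y') * (a * y - x * b) + (b * y) * (a' * y' - x' * b') =
      (a * b' + a' * b) * (y * y') - (x * y' + x' * y) * (b * b')" by (simp add: algebra_simps)
  finally have "frac (a * b' + a' * b) (b * b') = frac (x * y' + x' * y) (y * y')"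
    using n(1,2) n'(1,2) assms by (subst frac_eq_iff) (auto intro!: cl)
  then show ?thesis by (simp add: Frac_def xy xy')
qed

lemma frac_deriv:
  assumes j: "j \<in> \<Delta>" and ab: "a \<in> C" "b \<in> N"
  shows "frac_deriv j (frac a b) = frac (D j a * b - a * D j b) (b * b)"
proof -
  obtain x y where xy: "num_den (frac a b) = (x, y)" by (cases "num_den (frac a b)")
  note n = num_den[OF ab, unfolded xy fst_conv snd_conv]
  have D: "D j a \<in> C" "D j b \<in> C" "D j x \<in> C" "D j y \<in> C" using n ab dC[OF j] by auto
  \<comment> \<open>This is the numerator of the quotient rule for \<open>a / b - x / y\<close>. It
    lies in \<open>q\<close> because \<open>q\<close> is stable under \<open>D j\<close>.\<close>
  have "(b * y) * D j (a * y - x * b) - (y * D j b + b * D j y) * (a * y - x * b) \<in> q"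
    using n ab D
    by (intro prime_in_diff[OF q C prime_inD(5)[OF q dq[OF j n(3)]] prime_inD(5)[OF q n(3)]] cl) auto
  also have "(b * y) * D j (a * y - x * b) - (y * D j b + b * D j y) * (a * y - x * b) =
      (D j a * b - a * D j b) * (y * y) - (D j x * y - x * D j y) * (b * b)"
    by (simp add: derivationD(2,6)[OF d[OF j]] algebra_simps)
  finally have "frac (D j a * b - a * D j b) (b * b) = frac (D j x * y - x * D j y) (y * y)"
    using n(1,2) ab D by (subst frac_eq_iff) (auto intro!: cl)
  then show ?thesis by (simp add: frac_deriv_def xy)
qed

lemma field_Frac: "field Frac"
proof -
  have "cring Frac"
  proof (rule cringI)
    show "abelian_group Frac"
    proof (rule abelian_groupI)
      fix x assume "x \<in> carrier Frac"
      then obtain a b where ab: "a \<in> C" "b \<in> N" "x = frac a b" by (auto elim: fracsE)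
      then have "frac (- a) b \<oplus>\<^bsub>Frac\<^esub> x = frac 0 1"
        by (simp add: frac_add cl) (rule frac_eqI, use ab in \<open>auto simp: cl algebra_simps\<close>)
      then show "\<exists>y\<in>carrier Frac. y \<oplus>\<^bsub>Frac\<^esub> x = \<zero>\<^bsub>Frac\<^esub>"
        using ab fracs_frac[of "- a" b] cl(4) by auto
    next
      fix x y z assume "x \<in> carrier Frac" "y \<in> carrier Frac" "z \<in> carrier Frac"
      then obtain a b a' b' a'' b'' where ab: "a \<in> C" "b \<in> N" "a' \<in> C" "b' \<in> N" "a'' \<in> C" "b'' \<in> N"
        "x = frac a b" "y = frac a' b'" "z = frac a'' b''" by (auto elim!: fracsE)
      have m: "b * b' \<in> N" "b' * b'' \<in> N" "a * b' + a' * b \<in> C" "a' * b'' + a'' * b' \<in> C"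
        using ab(1-6) by (auto intro!: N_mult cl)
      show "x \<oplus>\<^bsub>Frac\<^esub> y \<oplus>\<^bsub>Frac\<^esub> z = x \<oplus>\<^bsub>Frac\<^esub> (y \<oplus>\<^bsub>Frac\<^esub> z)"
        using ab m by (simp only: frac_add) (simp add: algebra_simps)
    next
      fix x y assume "x \<in> carrier Frac" "y \<in> carrier Frac"
      then obtain a b a' b' where ab: "a \<in> C" "b \<in> N" "a' \<in> C" "b' \<in> N"
        "x = frac a b" "y = frac a' b'" by (auto elim!: fracsE)
      show "x \<oplus>\<^bsub>Frac\<^esub> y \<in> carrier Frac"
        using ab by (simp only: frac_add carrier, intro fracs_frac) (auto intro: cl)
      show "x \<oplus>\<^bsub>Frac\<^esub> y = y \<oplus>\<^bsub>Frac\<^esub> x"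
        using ab by (simp only: frac_add) (simp add: algebra_simps)
    next
      fix x assume "x \<in> carrier Frac"
      then obtain a b where ab: "a \<in> C" "b \<in> N" "x = frac a b" by (auto elim: fracsE)
      show "\<zero>\<^bsub>Frac\<^esub> \<oplus>\<^bsub>Frac\<^esub> x = x" using ab by (simp only: zero frac_add cl N_1) simp
    qed (simp add: fracs_frac cl)
    show "comm_monoid Frac"
    proof (rule comm_monoidI)
      fix x y z assume "x \<in> carrier Frac" "y \<in> carrier Frac" "z \<in> carrier Frac"
      then obtain a b a' b' a'' b'' where ab: "a \<in> C" "b \<in> N" "a' \<in> C" "b' \<in> N" "a'' \<in> C" "b'' \<in> N"
        "x = frac a b" "y = frac a' b'" "z = frac a'' b''" by (auto elim!: fracsE)
      have m: "b * b' \<in> N" "b' * b'' \<in> N" "a * a' \<in> C" "a' * a'' \<in> C"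
        using ab(1-6) by (auto intro!: N_mult cl)
      show "x \<otimes>\<^bsub>Frac\<^esub> y \<otimes>\<^bsub>Frac\<^esub> z = x \<otimes>\<^bsub>Frac\<^esub> (y \<otimes>\<^bsub>Frac\<^esub> z)"
        using ab m by (simp only: frac_mult) (simp add: algebra_simps)
    next
      fix x y assume "x \<in> carrier Frac" "y \<in> carrier Frac"
      then obtain a b a' b' where ab: "a \<in> C" "b \<in> N" "a' \<in> C" "b' \<in> N"
        "x = frac a b" "y = frac a' b'" by (auto elim!: fracsE)
      show "x \<otimes>\<^bsub>Frac\<^esub> y \<in> carrier Frac"
        using ab by (simp only: frac_mult carrier, intro fracs_frac) auto
      show "x \<otimes>\<^bsub>Frac\<^esub> y = y \<otimes>\<^bsub>Frac\<^esub> x"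
        using ab by (simp only: frac_mult) (simp add: algebra_simps)
    next
      fix x assume "x \<in> carrier Frac"
      then obtain a b where ab: "a \<in> C" "b \<in> N" "x = frac a b" by (auto elim: fracsE)
      show "\<one>\<^bsub>Frac\<^esub> \<otimes>\<^bsub>Frac\<^esub> x = x" using ab by (simp only: one frac_mult cl N_1) simp
    qed (simp add: fracs_frac cl)
    fix x y z assume "x \<in> carrier Frac" "y \<in> carrier Frac" "z \<in> carrier Frac"
    then obtain a b a' b' a'' b'' where ab: "a \<in> C" "b \<in> N" "a' \<in> C" "b' \<in> N" "a'' \<in> C" "b'' \<in> N"
      "x = frac a b" "y = frac a' b'" "z = frac a'' b''" by (auto elim!: fracsE)
    have m: "b * b' \<in> N" "b * b'' \<in> N" "b' * b'' \<in> N" "a * b' + a' * b \<in> C" "a * a'' \<in> C" "a' * a'' \<in> C"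
      using ab(1-6) by (auto intro!: N_mult cl)
    show "(x \<oplus>\<^bsub>Frac\<^esub> y) \<otimes>\<^bsub>Frac\<^esub> z = x \<otimes>\<^bsub>Frac\<^esub> z \<oplus>\<^bsub>Frac\<^esub> y \<otimes>\<^bsub>Frac\<^esub> z"
      unfolding ab(7-9) using ab(1-6) m
      by (simp only: frac_mult frac_add)
        (rule frac_eqI, auto simp: algebra_simps intro!: cl)
  qed
  then interpret cring Frac .
  show ?thesis
  proof (rule cring_fieldI2)
    show "\<zero>\<^bsub>Frac\<^esub> \<noteq> \<one>\<^bsub>Frac\<^esub>"
      using frac_eq_iff[of 0 1 1 1] cl(1,2) N_1 prime_in_diff[OF q C, of 0 "-1"] prime_inD(2,3)[OF q]
      by auto
    fix x assume "x \<in> carrier Frac" "x \<noteq> \<zero>\<^bsub>Frac\<^esub>"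
    then obtain a b where ab: "a \<in> C" "b \<in> N" "x = frac a b" "x \<noteq> frac 0 1" by (auto elim: fracsE)
    then have "a \<in> N" using frac_eq_iff[of a b 0 1] cl(2) N_1 by auto
    then have "x \<otimes>\<^bsub>Frac\<^esub> frac b a = \<one>\<^bsub>Frac\<^esub>"
      unfolding ab(3) using ab(1,2)
      by (simp only: frac_mult NC one) (rule frac_eqI, auto simp: algebra_simps)
    then show "\<exists>y\<in>carrier Frac. x \<otimes>\<^bsub>Frac\<^esub> y = \<one>\<^bsub>Frac\<^esub>"
      using fracs_frac[of b a] \<open>a \<in> N\<close> ab(2) by auto
  qed
qed

lemma frac_deriv_derivation:
  assumes j: "j \<in> \<Delta>" and x: "x \<in> fracs" and y: "y \<in> fracs"
  shows "frac_deriv j x \<in> fracs"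
    "frac_deriv j (x \<oplus>\<^bsub>Frac\<^esub> y) = frac_deriv j x \<oplus>\<^bsub>Frac\<^esub> frac_deriv j y"
    "frac_deriv j (x \<otimes>\<^bsub>Frac\<^esub> y) =
      (frac_deriv j x \<otimes>\<^bsub>Frac\<^esub> y) \<oplus>\<^bsub>Frac\<^esub> (x \<otimes>\<^bsub>Frac\<^esub> frac_deriv j y)"
proof -
  obtain a b a' b' where ab: "a \<in> C" "b \<in> N" "a' \<in> C" "b' \<in> N" and eq: "x = frac a b" "y = frac a' b'"
    using x y by (auto elim!: fracsE)
  define a1 b1 a1' b1' where D: "a1 = D j a" "b1 = D j b" "a1' = D j a'" "b1' = D j b'"
  have C': "a1 \<in> C" "b1 \<in> C" "a1' \<in> C" "b1' \<in> C" unfolding D using ab dC[OF j] by auto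
  note dd = derivationD[OF d[OF j]]
  have m: "b * b' \<in> N" "b * b \<in> N" "b' * b' \<in> N" "a * b' + a' * b \<in> C" "a * a' \<in> C"
      "a1 * b - a * b1 \<in> C" "a1' * b' - a' * b1' \<in> C"
    using ab C' by (auto intro!: N_mult cl)
  have e: "frac_deriv j x = frac (a1 * b - a * b1) (b * b)" "frac_deriv j y = frac (a1' * b' - a' * b1') (b' * b')"
    unfolding eq D using ab j by (simp_all only: frac_deriv)
  show "frac_deriv j x \<in> fracs" unfolding e using m by (intro fracs_frac)
  have "frac_deriv j (x \<oplus>\<^bsub>Frac\<^esub> y) = frac
      ((a1 * b' + a * b1' + (a1' * b + a' * b1)) * (b * b') - (a * b' + a' * b) * (b1 * b' + b * b1'))
      ((b * b') * (b * b'))"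
    unfolding eq using ab m j by (simp only: frac_add frac_deriv dd D)
  also have "\<dots> = frac ((a1 * b - a * b1) * (b' * b') + (a1' * b' - a' * b1') * (b * b)) ((b * b) * (b' * b'))"
    by (simp add: algebra_simps)
  also have "\<dots> = frac_deriv j x \<oplus>\<^bsub>Frac\<^esub> frac_deriv j y"
    unfolding e using m by (simp only: frac_add)
  finally show "frac_deriv j (x \<oplus>\<^bsub>Frac\<^esub> y) = frac_deriv j x \<oplus>\<^bsub>Frac\<^esub> frac_deriv j y" .
  have "frac_deriv j (x \<otimes>\<^bsub>Frac\<^esub> y) = frac
      ((a1 * a' + a * a1') * (b * b') - (a * a') * (b1 * b' + b * b1')) ((b * b') * (b * b'))"
    unfolding eq using ab m j by (simp only: frac_mult frac_deriv dd D)
  also have "\<dots> = frac (((a1 * b - a * b1) * a') * (b * (b' * b')) + (a * (a1' * b' - a' * b1')) * ((b * b) * b'))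
      (((b * b) * b') * (b * (b' * b')))"
    by (rule frac_eqI) (use ab C' m in \<open>auto intro!: cl simp: algebra_simps\<close>)
  also have "\<dots> = (frac_deriv j x \<otimes>\<^bsub>Frac\<^esub> y) \<oplus>\<^bsub>Frac\<^esub> (x \<otimes>\<^bsub>Frac\<^esub> frac_deriv j y)"
  proof -
    have m': "(a1 * b - a * b1) * a' \<in> C" "(b * b) * b' \<in> N" "a * (a1' * b' - a' * b1') \<in> C" "b * (b' * b') \<in> N"
      using ab m by (auto intro!: cl)
    show ?thesis unfolding e unfolding eq using ab m m' by (simp only: frac_add frac_mult)
  qed
  finally show "frac_deriv j (x \<otimes>\<^bsub>Frac\<^esub> y) =
      (frac_deriv j x \<otimes>\<^bsub>Frac\<^esub> y) \<oplus>\<^bsub>Frac\<^esub> (x \<otimes>\<^bsub>Frac\<^esub> frac_deriv j y)" .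
qed

lemma frac_deriv_commute:
  assumes i: "i \<in> \<Delta>" and j: "j \<in> \<Delta>" and x: "x \<in> fracs"
  shows "frac_deriv i (frac_deriv j x) = frac_deriv j (frac_deriv i x)"
proof -
  obtain a b where ab: "a \<in> C" "b \<in> N" and eq: "x = frac a b" using x by (auto elim!: fracsE)
  have m: "b * b \<in> N" "D j a * b - a * D j b \<in> C" "D i a * b - a * D i b \<in> C"
    using ab dC[OF i] dC[OF j] by (auto intro!: cl)
  have "frac_deriv i (frac_deriv j x) = frac (D i (D j a * b - a * D j b) * (b * b) -
      (D j a * b - a * D j b) * D i (b * b)) ((b * b) * (b * b))"
    unfolding eq using ab m i j by (simp only: frac_deriv)
  also have "D i (D j a * b - a * D j b) * (b * b) - (D j a * b - a * D j b) * D i (b * b) =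
      D j (D i a * b - a * D i b) * (b * b) - (D i a * b - a * D i b) * D j (b * b)"
    by (simp add: derivationD(2,6)[OF d[OF i]] derivationD(2,6)[OF d[OF j]] comm[OF i j] algebra_simps)
  also have "frac \<dots> ((b * b) * (b * b)) = frac_deriv j (frac_deriv i x)"
    unfolding eq using ab m i j by (simp only: frac_deriv)
  finally show ?thesis .
qed

section \<open>The residue map as a differential homomorphism\<close>

definition proj :: "'r \<Rightarrow> 'a" where "proj a = frac a 1"

lemma proj_add: "a \<in> C \<Longrightarrow> b \<in> C \<Longrightarrow> proj (a + b) = proj a \<oplus>\<^bsub>Frac\<^esub> proj b"
  by (simp only: proj_def frac_add N_1 mult_1_right)

lemma proj_mult: "a \<in> C \<Longrightarrow> b \<in> C \<Longrightarrow> proj (a * b) = proj a \<otimes>\<^bsub>Frac\<^esub> proj b"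
  by (simp only: proj_def frac_mult N_1 mult_1_right)

lemma proj_closed: "a \<in> C \<Longrightarrow> proj a \<in> carrier Frac"
  by (simp add: proj_def fracs_frac cl prime_inD(3)[OF q])

lemma proj_deriv: "j \<in> \<Delta> \<Longrightarrow> a \<in> C \<Longrightarrow> proj (D j a) = frac_deriv j (proj a)"
  by (simp only: proj_def frac_deriv N_1 derivationD(4)[OF d] mult_1_right mult_zero_right diff_0_right)

text \<open>Turns membership in \<open>q\<close> into an equation over the extension field, and
  non-membership into an inequation.\<close>

lemma proj_eq_zero_iff: "a \<in> C \<Longrightarrow> proj a = \<zero>\<^bsub>Frac\<^esub> \<longleftrightarrow> a \<in> q"
  unfolding proj_def zero by (subst frac_eq_iff) (auto simp: cl prime_inD(3)[OF q])

lemma proj_sum: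
  assumes "finite A" "\<And>x. x \<in> A \<Longrightarrow> f x \<in> C"
  shows "proj (sum f A) = (\<Oplus>\<^bsub>Frac\<^esub>x\<in>A. proj (f x))"
proof -
  interpret field Frac by (rule field_Frac)
  show ?thesis using assms
  proof (induction A)
    case empty
    then show ?case by (simp add: proj_def)
  next
    case (insert x A)
    then show ?case
      by (subst finsum_insert) (auto simp: proj_add cl Pi_iff simp del: carrier intro!: proj_closed)
  qed
qed

lemma proj_prod:
  assumes "finite A" "\<And>x. x \<in> A \<Longrightarrow> f x \<in> C"
  shows "proj (prod f A) = (\<Otimes>\<^bsub>Frac\<^esub>x\<in>A. proj (f x)) \<and> prod f A \<in> C"
proof -
  interpret field Frac by (rule field_Frac)
  show ?thesis using assms
  proof (induction A)
    case empty
    then show ?case by (simp add: proj_def cl)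
  next
    case (insert x A)
    then show ?case
      by (subst finprod_insert) (auto simp: proj_mult cl Pi_iff simp del: carrier intro!: proj_closed)
  qed
qed

lemma proj_power: "a \<in> C \<Longrightarrow> proj (a ^ k) = proj a [^]\<^bsub>Frac\<^esub> k"
proof (induction k)
  case 0
  interpret field Frac by (rule field_Frac)
  show ?case by (simp add: proj_def)
next
  case (Suc k)
  interpret field Frac by (rule field_Frac)
  have "proj (a ^ Suc k) = proj (a ^ k * a)" by (simp add: mult.commute)
  also have "\<dots> = proj (a ^ k) \<otimes>\<^bsub>Frac\<^esub> proj a" using Suc.prems by (intro proj_mult cl)
  finally show ?case using Suc by simp
qed

end

section \<open>An encoding of differential polynomials by field elements\<close>

lemma infinite_pairing:
  assumes "infinite (UNIV :: 'a set)"
  obtains pr :: "'a \<Rightarrow> 'a \<Rightarrow> 'a" where "\<And>a b c d. pr a b = pr c d \<Longrightarrow> a = c \<and> b = d"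
proof -
  obtain f :: "'a \<times> 'a \<Rightarrow> 'a" where "bij_betw f (UNIV \<times> UNIV) UNIV"
    using card_of_Times_same_infinite[OF assms] card_of_ordIso[of "UNIV \<times> UNIV" UNIV] by blast
  then have "inj f" by (simp add: bij_betw_def)
  then show ?thesis using that[of "\<lambda>a b. f (a, b)"] by (auto dest: injD)
qed

text \<open>Lists are coded by nested pairs, with distinct tags \<open>a\<close> and
  \<open>b\<close> for the two constructors; a finite set receives the code of one chosen
  enumeration.\<close>

lemma infinite_finite_sets_encoding:
  assumes inf: "infinite (UNIV :: 'a set)"
  obtains F :: "'a set \<Rightarrow> 'a" where "inj_on F {S. finite S}"
proof -
  obtain pr :: "'a \<Rightarrow> 'a \<Rightarrow> 'a" where pr: "\<And>a b c d. pr a b = pr c d \<Longrightarrow> a = c \<and> b = d"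
    by (rule infinite_pairing[OF inf]) blast
  obtain a b :: 'a where ab: "a \<noteq> b"
    using inf by (metis (full_types) UNIV_eq_I finite.simps singletonI)
  define enc where "enc = rec_list (pr a a) (\<lambda>x xs r. pr b (pr x r))"
  have enc_Nil: "enc [] = pr a a" and enc_Cons: "enc (x # xs) = pr b (pr x (enc xs))" for x xs
    by (simp_all add: enc_def)
  have ne: "pr a a \<noteq> pr b z" for z using pr[of a a b z] ab by blast
  have enc: "enc xs = enc ys \<Longrightarrow> xs = ys" for xs ys
  proof (induction xs arbitrary: ys)
    case Nil
    then show ?case using ne by (cases ys) (simp_all add: enc_Nil enc_Cons)
  next
    case (Cons x xs)
    show ?case
    proof (cases ys)
      case Nil
      then show ?thesis using Cons.prems ne by (metis enc_Nil enc_Cons)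
    next
      case (Cons y ys')
      then have "pr b (pr x (enc xs)) = pr b (pr y (enc ys'))"
        using Cons.prems by (simp add: enc_Cons)
      then have "x = y" "enc xs = enc ys'" using pr by blast+
      then show ?thesis using Cons.IH Cons by blast
    qed
  qed
  define F where "F = (\<lambda>S. enc (SOME xs. set xs = S))"
  have "inj_on F {S. finite S}"
  proof (rule inj_onI)
    fix S T :: "'a set" assume S: "S \<in> {S. finite S}" and T: "T \<in> {S. finite S}" and eq: "F S = F T"
    have some: "set (SOME xs. set xs = A) = A" if "finite A" for A :: "'a set"
      by (rule someI_ex) (rule finite_list[OF that])
    have "(SOME xs. set xs = S) = (SOME xs. set xs = T)" using eq unfolding F_def by (rule enc)
    then have "set (SOME xs. set xs = S) = set (SOME xs. set xs = T)" by (rule arg_cong)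
    moreover have "set (SOME xs. set xs = S) = S" "set (SOME xs. set xs = T) = T"
      using S T by (auto intro!: some)
    ultimately show "S = T" by argo
  qed
  then show ?thesis by (rule that)
qed

text \<open>An object determined by finitely many keys and their values is coded as the finite set
  of coded key-value pairs. Multisets, monomials and polynomials are all of this kind.\<close>

lemma finite_support_encoding:
  fixes supp :: "'x \<Rightarrow> 'k set" and vl :: "'x \<Rightarrow> 'k \<Rightarrow> 'l"
  assumes inf: "infinite (UNIV :: 'a set)"
    and k: "inj_on (ek :: 'k \<Rightarrow> 'a) K" and l: "inj (el :: 'l \<Rightarrow> 'a)"
    and fin: "\<And>x. x \<in> Z \<Longrightarrow> finite (supp x) \<and> supp x \<subseteq> K"
    and ext: "\<And>x y. x \<in> Z \<Longrightarrow> y \<in> Z \<Longrightarrow> supp x = supp y \<Longrightarrow>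
      (\<And>k. k \<in> supp x \<Longrightarrow> vl x k = vl y k) \<Longrightarrow> x = y"
  shows "\<exists>e :: 'x \<Rightarrow> 'a. inj_on e Z"
proof -
  obtain pr :: "'a \<Rightarrow> 'a \<Rightarrow> 'a" where pr: "\<And>a b c d. pr a b = pr c d \<Longrightarrow> a = c \<and> b = d"
    by (rule infinite_pairing[OF inf]) blast
  obtain F :: "'a set \<Rightarrow> 'a" where F: "inj_on F {S. finite S}"
    by (rule infinite_finite_sets_encoding[OF inf])
  define G where "G = (\<lambda>x. (\<lambda>k. pr (ek k) (el (vl x k))) ` supp x)"
  have "inj_on (\<lambda>x. F (G x)) Z"
  proof (rule inj_onI)
    fix x y assume x: "x \<in> Z" and y: "y \<in> Z" and "F (G x) = F (G y)"
    then have G: "G x = G y" using fin by (intro inj_onD[OF F]) (auto simp: G_def)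
    have *: "k \<in> supp y \<and> vl x k = vl y k"
      if x: "x \<in> Z" and y: "y \<in> Z" and G: "G x = G y" and k': "k \<in> supp x" for x y k
    proof -
      have "pr (ek k) (el (vl x k)) \<in> G y" using k' unfolding G[symmetric] by (auto simp: G_def)
      then obtain k2 where k2: "k2 \<in> supp y" "pr (ek k) (el (vl x k)) = pr (ek k2) (el (vl y k2))"
        by (auto simp: G_def)
      then have "ek k = ek k2" "el (vl x k) = el (vl y k2)" using pr by blast+
      then have "k = k2" "vl x k = vl y k2"
        using inj_onD[OF k, of k k2] injD[OF l] k2(1) k' fin[OF x] fin[OF y] by auto
      then show ?thesis using k2(1) by simp
    qed
    show "x = y"
    proof (rule ext[OF x y])
      show "supp x = supp y" using *[OF x y G] *[OF y x G[symmetric]] by blast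
      show "vl x k = vl y k" if "k \<in> supp x" for k using *[OF x y G that] by simp
    qed
  qed
  from exI[of "\<lambda>e. inj_on e Z" "\<lambda>x. F (G x)", OF this] show ?thesis .
qed

section \<open>Differential polynomials as polynomials in the variables \<open>dvars\<close>\<close>

definition dvars :: "'d set \<Rightarrow> nat \<Rightarrow> 'd dvar set" where
  "dvars \<Delta> n = {(i, \<theta>). i < n \<and> set_mset \<theta> \<subseteq> \<Delta>}"

lemma dpolys_eq_pvars: "(dpolys \<Delta> n :: ('d, 'a::zero) dpoly set) = pvars (dvars \<Delta> n)"
proof (intro Set.set_eqI)
  fix P :: "('d, 'a) dpoly"
  have "(\<forall>(i, \<theta>) \<in> keys M. i < n \<and> set_mset \<theta> \<subseteq> \<Delta>) \<longleftrightarrow> keys M \<subseteq> dvars \<Delta> n"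
    for M :: "'d dvar \<Rightarrow>\<^sub>0 nat"
    by (simp only: dvars_def Ball_Collect)
  then show "P \<in> dpolys \<Delta> n \<longleftrightarrow> P \<in> pvars (dvars \<Delta> n)"
    unfolding dpolys_def pvars_def by simp
qed

text \<open>Finiteness of \<Delta> starts the chain by numbering the derivations; derivative
  operators, variables, monomials and polynomials follow. In characteristic zero the natural numbers
  embed into \<open>K\<close>, which codes multiplicities and exponents.\<close>

lemma dpolys_encoding:
  assumes "finite \<Delta>"
  obtains e :: "('d, 'a::field_char_0) dpoly \<Rightarrow> 'a" where "inj_on e (dpolys \<Delta> n)"
proof -
  have inf: "infinite (UNIV :: 'a set)" by (rule infinite_UNIV_char_0)
  have nat: "inj (of_nat :: nat \<Rightarrow> 'a)" by (rule inj_of_nat)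
  obtain e0 :: "'d \<Rightarrow> nat" where "inj_on e0 \<Delta>"
    using finite_imp_inj_to_nat_seg[OF assms] by blast
  then have e0: "inj_on (\<lambda>j. of_nat (e0 j) :: 'a) \<Delta>" using nat by (auto simp: inj_on_def)
  have "\<exists>e1 :: 'd multiset \<Rightarrow> 'a. inj_on e1 {\<theta>. set_mset \<theta> \<subseteq> \<Delta>}"
  proof (rule finite_support_encoding[OF inf e0 nat])
    fix x y :: "'d multiset"
    assume "set_mset x = set_mset y" "\<And>k. k \<in> set_mset x \<Longrightarrow> count x k = count y k"
    then show "x = y" by (metis multiset_eqI not_in_iff)
  qed simp
  then obtain e1 :: "'d multiset \<Rightarrow> 'a" where e1: "inj_on e1 {\<theta>. set_mset \<theta> \<subseteq> \<Delta>}" ..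
  obtain pr :: "'a \<Rightarrow> 'a \<Rightarrow> 'a" where pr: "\<And>a b c d. pr a b = pr c d \<Longrightarrow> a = c \<and> b = d"
    by (rule infinite_pairing[OF inf]) blast
  have e2: "inj_on (\<lambda>(i, \<theta>). pr (of_nat i) (e1 \<theta>)) {(i :: nat, \<theta>). set_mset \<theta> \<subseteq> \<Delta>}"
  proof (rule inj_onI, clarify)
    fix i j :: nat and \<theta> \<eta> :: "'d multiset"
    assume *: "set_mset \<theta> \<subseteq> \<Delta>" "set_mset \<eta> \<subseteq> \<Delta>" "pr (of_nat i) (e1 \<theta>) = pr (of_nat j) (e1 \<eta>)"
    have "(of_nat i :: 'a) = of_nat j" "e1 \<theta> = e1 \<eta>" using pr[OF *(3)] by auto
    then show "i = j \<and> \<theta> = \<eta>" using inj_onD[OF e1, of \<theta> \<eta>] * by auto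
  qed
  have "\<exists>e3 :: ('d dvar \<Rightarrow>\<^sub>0 nat) \<Rightarrow> 'a. inj_on e3 {M. keys M \<subseteq> {(i, \<theta>). set_mset \<theta> \<subseteq> \<Delta>}}"
  proof (rule finite_support_encoding[OF inf e2 nat])
    fix x y :: "'d dvar \<Rightarrow>\<^sub>0 nat"
    assume "keys x = keys y"
      "\<And>k. k \<in> keys x \<Longrightarrow> lookup x k = lookup y k"
    then show "x = y" by (intro poly_mapping_eqI) (metis in_keys_iff)
  qed simp
  then obtain e3 :: "('d dvar \<Rightarrow>\<^sub>0 nat) \<Rightarrow> 'a"
    where e3: "inj_on e3 {M. keys M \<subseteq> {(i, \<theta>). set_mset \<theta> \<subseteq> \<Delta>}}" ..
  have id: "inj (\<lambda>x :: 'a. x)" by simp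
  have "\<exists>e4 :: ('d, 'a) dpoly \<Rightarrow> 'a. inj_on e4 (dpolys \<Delta> n)"
  proof (rule finite_support_encoding[OF inf e3 id])
    fix x :: "('d, 'a) dpoly" assume x: "x \<in> dpolys \<Delta> n"
    have "keys M \<subseteq> {(i, \<theta>). set_mset \<theta> \<subseteq> \<Delta>}" if "M \<in> keys x" for M
    proof
      fix v assume "v \<in> keys M"
      then show "v \<in> {(i, \<theta>). set_mset \<theta> \<subseteq> \<Delta>}"
        using dpolysD(2)[OF x that, of "fst v" "snd v"] by (simp add: case_prod_unfold)
    qed
    then show "finite (keys x) \<and>
        keys x \<subseteq> {M. keys M \<subseteq> {(i, \<theta>). set_mset \<theta> \<subseteq> \<Delta>}}"
      by (simp add: subsetI)
  next
    fix x y :: "('d, 'a) dpoly"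
    assume "keys x = keys y"
      "\<And>k. k \<in> keys x \<Longrightarrow> lookup x k = lookup y k"
    then show "x = y" by (intro poly_mapping_eqI) (metis in_keys_iff)
  qed
  then show ?thesis using that by blast
qed

section \<open>The derivations of the ring of differential polynomials\<close>

lemma differential_fieldD:
  assumes "differential_field \<Delta> \<delta>" "j \<in> \<Delta>"
  shows "\<delta> j (a + b) = \<delta> j a + \<delta> j b" "\<delta> j (a * b) = \<delta> j a * b + a * \<delta> j b"
    "i \<in> \<Delta> \<Longrightarrow> \<delta> i (\<delta> j a) = \<delta> j (\<delta> i a)" "\<delta> j 0 = 0" "\<delta> j 1 = 0"
proof -
  show a: "\<delta> j (a + b) = \<delta> j a + \<delta> j b" and m: "\<delta> j (a * b) = \<delta> j a * b + a * \<delta> j b" for a b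
    using assms unfolding differential_field_def by blast+
  show "i \<in> \<Delta> \<Longrightarrow> \<delta> i (\<delta> j a) = \<delta> j (\<delta> i a)"
    using assms unfolding differential_field_def by blast
  show "\<delta> j 0 = 0" using a[of 0 0] unfolding add_0_right add_cancel_right_right .
  show "\<delta> j 1 = 0" using m[of 1 1] unfolding mult_1_left mult_1_right add_cancel_right_right .
qed

context
  fixes \<Delta> :: "'d set" and \<delta> :: "'d \<Rightarrow> 'a::field \<Rightarrow> 'a" and j :: 'd
  assumes K: "differential_field \<Delta> \<delta>" and j: "j \<in> \<Delta>"
begin

private abbreviation "shift \<equiv> \<lambda>M v. M - single v 1 + single (fst v, add_mset j (snd v)) (1 :: nat)"

private definition "mderiv M c = single M (\<delta> j c) +
  (\<Sum>v \<in> keys M. single (shift M v) (of_nat (lookup M v) * c))"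

private lemma mderiv_0: "mderiv M 0 = 0"
  by (simp add: mderiv_def differential_fieldD(4)[OF K j])

private lemma mderiv_add: "mderiv M (a + b) = mderiv M a + mderiv M b"
  by (simp add: mderiv_def differential_fieldD(1)[OF K j] single_add distrib_left sum.distrib add_ac)

private lemma dpoly_deriv_superset:
  assumes "finite V" "keys P \<subseteq> V"
  shows "dpoly_deriv \<delta> j P = (\<Sum>M\<in>V. mderiv M (lookup P M))"
proof -
  have "dpoly_deriv \<delta> j P = (\<Sum>M\<in>keys P. mderiv M (lookup P M))"
    unfolding dpoly_deriv_def mderiv_def case_prod_unfold by simp
  also have "\<dots> = (\<Sum>M\<in>V. mderiv M (lookup P M))"
    by (rule sum.mono_neutral_left) (use assms in \<open>auto simp: in_keys_iff mderiv_0\<close>)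
  finally show ?thesis .
qed

lemma dpoly_deriv_add: "dpoly_deriv \<delta> j (P + Q) = dpoly_deriv \<delta> j P + dpoly_deriv \<delta> j Q"
proof -
  let ?V = "keys P \<union> keys Q"
  have "keys (P + Q) \<subseteq> ?V" by (rule Poly_Mapping.keys_add)
  then show ?thesis
    using dpoly_deriv_superset[of ?V "P + Q"] dpoly_deriv_superset[of ?V P] dpoly_deriv_superset[of ?V Q]
    by (simp add: lookup_add mderiv_add sum.distrib)
qed

private lemma dpoly_deriv_single: "dpoly_deriv \<delta> j (single M c) = mderiv M c"
  by (subst dpoly_deriv_superset[of "{M}"]) auto

private lemma dpoly_deriv_sum: "dpoly_deriv \<delta> j (sum f A) = (\<Sum>a\<in>A. dpoly_deriv \<delta> j (f a))"
proof -
  have "dpoly_deriv \<delta> j 0 = 0" by (simp add: dpoly_deriv_def)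
  then show ?thesis by (induction A rule: infinite_finite_induct) (simp_all add: dpoly_deriv_add)
qed

private lemma mderiv_mult:
  "mderiv (M + N) (a * b) = mderiv M a * single N b + single M a * mderiv N b"
proof -
  let ?V = "keys M \<union> keys N"
  have sup: "(\<Sum>v\<in>keys L. single (shift L v) (of_nat (lookup L v) * c)) =
      (\<Sum>v\<in>?V. single (shift L v) (of_nat (lookup L v) * c))"
    if "keys L \<subseteq> ?V" for L c
    by (rule sum.mono_neutral_left) (use that in \<open>auto simp: in_keys_iff\<close>)
  have sub: "keys (M + N) \<subseteq> ?V" by (rule Poly_Mapping.keys_add)
  \<comment> \<open>Subtraction of exponents is truncated, so the identity needs \<open>v\<close> to
    occur in \<open>A\<close>. Where it does not, the coefficient \<open>lookup A v\<close> makes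
    the term zero.\<close>
  have comm1: "shift (A + B) v = shift A v + B" if "lookup A v \<noteq> 0" for A B v
  proof (rule poly_mapping_eqI)
    fix w show "lookup (shift (A + B) v) w = lookup (shift A v + B) w"
      using that by (cases "w = v") (auto simp: lookup_add lookup_minus lookup_single when_def)
  qed
  have tm: "single (shift (M + N) v) (of_nat (lookup (M + N) v) * (a * b)) =
      single (shift M v) (of_nat (lookup M v) * a) * single N b +
      single M a * single (shift N v) (of_nat (lookup N v) * b)" for v
  proof -
    have "single (shift M v) (of_nat (lookup M v) * a) * single N b =
      single (shift (M + N) v) (of_nat (lookup M v) * (a * b))"
      using comm1[of M v N] by (cases "lookup M v = 0") (simp_all add: mult_single mult.assoc)
    moreover have "single M a * single (shift N v) (of_nat (lookup N v) * b) =
      single (shift (M + N) v) (of_nat (lookup N v) * (a * b))"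
      using comm1[of N v M] by (cases "lookup N v = 0") (simp_all add: mult_single mult_ac add_ac)
    ultimately show ?thesis by (simp add: lookup_add distrib_right single_add)
  qed
  have "mderiv (M + N) (a * b) = single (M + N) (\<delta> j a * b + a * \<delta> j b) +
      (\<Sum>v\<in>?V. single (shift (M + N) v) (of_nat (lookup (M + N) v) * (a * b)))"
    unfolding mderiv_def sup[OF sub] differential_fieldD(2)[OF K j] ..
  also have "\<dots> = mderiv M a * single N b + single M a * mderiv N b"
    unfolding mderiv_def sup[OF Un_upper1] sup[OF Un_upper2] tm sum.distrib
    by (simp add: distrib_left distrib_right sum_distrib_left sum_distrib_right single_add mult_single add_ac)
  finally show ?thesis .
qed

lemma dpoly_deriv_mult:
  "dpoly_deriv \<delta> j (P * Q) = dpoly_deriv \<delta> j P * Q + P * dpoly_deriv \<delta> j Q"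
proof -
  let ?P = "\<lambda>M. single M (lookup P M)"
    and ?Q = "\<lambda>M. single M (lookup Q M)"
  have "dpoly_deriv \<delta> j (sum ?P (keys P) * sum ?Q (keys Q)) =
      dpoly_deriv \<delta> j (sum ?P (keys P)) * sum ?Q (keys Q) +
      sum ?P (keys P) * dpoly_deriv \<delta> j (sum ?Q (keys Q))"
    unfolding sum_product dpoly_deriv_sum mult_single dpoly_deriv_single mderiv_mult sum.distrib ..
  then show ?thesis by (simp only: poly_mapping_eq_sum_single)
qed

lemma dpoly_deriv_const: "dpoly_deriv \<delta> j (pconst c) = pconst (\<delta> j c)"
  unfolding pconst_def dpoly_deriv_single mderiv_def by simp

lemma dpoly_deriv_var: "dpoly_deriv \<delta> j (pvar (i, \<theta>)) = pvar (i, add_mset j \<theta>)"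
  unfolding pvar_def dpoly_deriv_single mderiv_def by (simp add: differential_fieldD(5)[OF K j])

text \<open>Two sets of variables, because a derivation raises orders: in the ranking argument
  \<open>D'\<close> is the segment below the derivative of a variable and \<open>D\<close> the one
  below the variable itself.\<close>

lemma dpoly_deriv_pvars:
  assumes P: "P \<in> pvars D" and D: "D \<subseteq> D'" "\<And>i \<theta>. (i, \<theta>) \<in> D \<Longrightarrow> (i, add_mset j \<theta>) \<in> D'"
  shows "dpoly_deriv \<delta> j P \<in> pvars D'"
  using P
proof (induction rule: pvars_induct)
  case (const c)
  then show ?case by (simp add: dpoly_deriv_const)
next
  case (var v)
  then show ?case using D(2)[of "fst v" "snd v"] dpoly_deriv_var[of "fst v" "snd v"] by simp
next
  case (add P Q)
  then show ?case by (simp add: dpoly_deriv_add pvars_add)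
next
  case (mult P Q)
  then show ?case using pvars_mono[OF mult.hyps(1) D(1)] pvars_mono[OF mult.hyps(2) D(1)]
    by (simp add: dpoly_deriv_mult pvars_add pvars_mult)
qed

end

lemma dpoly_deriv_commute:
  fixes P :: "('d, 'a::field) dpoly"
  assumes K: "differential_field \<Delta> \<delta>" and i: "i \<in> \<Delta>" and j: "j \<in> \<Delta>"
  shows "dpoly_deriv \<delta> i (dpoly_deriv \<delta> j P) = dpoly_deriv \<delta> j (dpoly_deriv \<delta> i P)"
proof -
  note s = dpoly_deriv_const[OF K i] dpoly_deriv_const[OF K j] dpoly_deriv_add[OF K i] dpoly_deriv_add[OF K j]
    dpoly_deriv_mult[OF K i] dpoly_deriv_mult[OF K j] dpoly_deriv_var[OF K i] dpoly_deriv_var[OF K j]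
  have "P \<in> pvars UNIV" by (simp add: pvars_def)
  then show ?thesis
  proof (induction rule: pvars_induct)
    case (const c)
    then show ?case by (simp add: s differential_fieldD(3)[OF K j i])
  next
    case (var v)
    then show ?case using s(7,8) by (cases v) (simp add: s add_mset_commute)
  next
    case (add P Q)
    then show ?case by (simp add: s)
  next
    case (mult P Q)
    then show ?case by (simp add: s algebra_simps)
  qed
qed

lemma dpoly_eval_eq_pev: "dpoly_eval \<delta> x P = pev (\<lambda>a. a) (\<lambda>(i, \<theta>). ders \<delta> \<theta> (x i)) P"
  unfolding dpoly_eval_def pev_def monom_eval_def case_prod_unfold by simp

lemma derivation_dpoly_deriv:
  "differential_field \<Delta> \<delta> \<Longrightarrow> j \<in> \<Delta> \<Longrightarrow> derivation (dpoly_deriv \<delta> j)"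
  by (simp add: derivation_def dpoly_deriv_add dpoly_deriv_mult)

lemma dpoly_deriv_dpolys:
  assumes "differential_field \<Delta> \<delta>" "j \<in> \<Delta>" "P \<in> dpolys \<Delta> n"
  shows "dpoly_deriv \<delta> j P \<in> dpolys \<Delta> n"
  unfolding dpolys_eq_pvars
  by (rule dpoly_deriv_pvars[OF assms(1,2) assms(3)[unfolded dpolys_eq_pvars]])
    (use assms(2) in \<open>auto simp: dvars_def\<close>)

lemma subring_set_dpolys: "subring_set (dpolys \<Delta> n :: ('d, 'a::comm_ring_1) dpoly set)"
  unfolding dpolys_eq_pvars by (rule subring_set_pvars)

text \<open>The residue field of \<open>q\<close> is a differential extension of \<open>K\<close> in
  which the classes of the indeterminates solve \<open>F\<close> and satisfy the inequations
  \<open>G\<close>; differential closedness brings such a solution down to \<open>K\<close>.\<close>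

lemma differentially_closed_solution:
  fixes q :: "('d, 'a::field_char_0) dpoly set"
  assumes dc: "differentially_closed \<Delta> \<delta>" and q: "prime_in (dpolys \<Delta> n) q"
    and dq: "\<And>j P. j \<in> \<Delta> \<Longrightarrow> P \<in> q \<Longrightarrow> dpoly_deriv \<delta> j P \<in> q"
    and F: "finite F" "F \<subseteq> q" and G: "finite G" "G \<subseteq> dpolys \<Delta> n - q"
  obtains x where "x \<in> points n UNIV" "\<And>P. P \<in> F \<Longrightarrow> dpoly_eval \<delta> x P = 0"
    "\<And>Q. Q \<in> G \<Longrightarrow> dpoly_eval \<delta> x Q \<noteq> 0"
proof -
  have K: "differential_field \<Delta> \<delta>" using dc by (simp add: differentially_closed_def)
  have fin: "finite \<Delta>" using K by (simp add: differential_field_def)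
  obtain en :: "('d, 'a) dpoly \<Rightarrow> 'a" where en: "inj_on en (dpolys \<Delta> n)"
    by (rule dpolys_encoding[OF fin])
  obtain pr :: "'a \<Rightarrow> 'a \<Rightarrow> 'a" where pr: "\<And>a b c d. pr a b = pr c d \<Longrightarrow> a = c \<and> b = d"
    by (rule infinite_pairing[OF infinite_UNIV_char_0]) blast
  interpret F: prime_fractions \<Delta> "dpolys \<Delta> n" q "dpoly_deriv \<delta>" en pr
    by unfold_locales
      (fact subring_set_dpolys q derivation_dpoly_deriv[OF K] dpoly_deriv_dpolys[OF K] dq
        dpoly_deriv_commute[OF K] en pr)+
  define h where "h = (\<lambda>c. F.proj (pconst c))"
  \<comment> \<open>The generic zero of \<open>q\<close>.\<close>
  define x where "x = (\<lambda>i\<in>{..<n}. F.proj (pvar (i, {#})))"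
  have const: "pconst c \<in> dpolys \<Delta> n" for c by (simp add: dpolys_eq_pvars)
  have var: "pvar v \<in> dpolys \<Delta> n" if "v \<in> dvars \<Delta> n" for v using that by (simp add: dpolys_eq_pvars)
  have ext: "differential_extension \<Delta> \<delta> F.Frac F.frac_deriv h"
    unfolding differential_extension_def
  proof (intro conjI ballI allI)
    show "field F.Frac" by (rule F.field_Frac)
    show "F.frac_deriv j \<in> carrier F.Frac \<rightarrow> carrier F.Frac" if "j \<in> \<Delta>" for j
      using F.frac_deriv_derivation(1)[OF that] by auto
    show "range h \<subseteq> carrier F.Frac" unfolding h_def using F.proj_closed[OF const] by blast
    show "h 1 = \<one>\<^bsub>F.Frac\<^esub>" by (simp add: h_def F.proj_def)
    show "h (a + b) = h a \<oplus>\<^bsub>F.Frac\<^esub> h b" "h (a * b) = h a \<otimes>\<^bsub>F.Frac\<^esub> h b" for a b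
      unfolding h_def pconst_add pconst_mult by (intro F.proj_add F.proj_mult const)+
    show "h (\<delta> j a) = F.frac_deriv j (h a)" if "j \<in> \<Delta>" for j a
      unfolding h_def using F.proj_deriv[OF that const[of a]] dpoly_deriv_const[OF K that] by simp
  qed (simp_all add: F.frac_deriv_derivation F.frac_deriv_commute)
  interpret L: field F.Frac by (rule F.field_Frac)
  \<comment> \<open>The derivations of the residue field act on the generic zero by raising the
    order of the variables, so evaluating a polynomial there gives its class, as \<open>eval\<close>
    shows.\<close>
  have ders: "ders F.frac_deriv \<theta> (x i) = F.proj (pvar (i, \<theta>))" if i: "i < n" and \<theta>: "set_mset \<theta> \<subseteq> \<Delta>" for i \<theta>
    using \<theta>
  proof (induction \<theta>)
    case empty
    then show ?case using i by (simp add: x_def)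
  next
    case (add j \<theta>)
    then have j: "j \<in> \<Delta>" and \<theta>: "set_mset \<theta> \<subseteq> \<Delta>" by auto
    have v: "(i, \<theta>) \<in> dvars \<Delta> n" "(i, {#}) \<in> dvars \<Delta> n" using i \<theta> by (auto simp: dvars_def)
    have "x i \<in> carrier F.Frac" using F.proj_closed[OF var[OF v(2)]] i by (simp add: x_def)
    then have "ders F.frac_deriv (add_mset j \<theta>) (x i) = F.frac_deriv j (ders F.frac_deriv \<theta> (x i))"
      by (rule ders_add_mset_ext[OF ext _ \<theta> j])
    also have "\<dots> = F.proj (pvar (i, add_mset j \<theta>))"
      using add.IH[OF \<theta>] F.proj_deriv[OF j var[OF v(1)]] dpoly_deriv_var[OF K j, of i \<theta>] by simp
    finally show ?case .
  qed
  let ?mon = "\<lambda>M. (\<Otimes>\<^bsub>F.Frac\<^esub>v \<in> keys M.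
    ders F.frac_deriv (snd v) (x (fst v)) [^]\<^bsub>F.Frac\<^esub> lookup M v)"
  have eval: "dpoly_eval_ext F.Frac F.frac_deriv h x P = F.proj P" if P: "P \<in> dpolys \<Delta> n" for P
  proof -
    have mon: "single M c \<in> dpolys \<Delta> n \<and> F.proj (single M c) = h c \<otimes>\<^bsub>F.Frac\<^esub>
        ?mon M"
      if M: "M \<in> keys P" for M c
    proof -
      have v: "v \<in> dvars \<Delta> n" if "v \<in> keys M" for v
        using P M that unfolding dpolys_eq_pvars pvars_def by blast
      have vp: "(pvar v :: ('d, 'a) dpoly) ^ k \<in> dpolys \<Delta> n" if "v \<in> keys M" for v k
        by (rule subring_setD(7)[OF subring_set_dpolys var[OF v[OF that]]])
      have ve: "F.proj (pvar v ^ k) = ders F.frac_deriv (snd v) (x (fst v)) [^]\<^bsub>F.Frac\<^esub> k"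
        if "v \<in> keys M" for v k
      proof -
        have "ders F.frac_deriv (snd v) (x (fst v)) = F.proj (pvar (fst v, snd v))"
          by (rule ders) (use v[OF that] in \<open>auto simp: dvars_def\<close>)
        then show ?thesis by (simp add: F.proj_power[OF var[OF v[OF that]]])
      qed
      let ?pm = "\<Prod>v \<in> keys M. pvar v ^ lookup M v :: ('d, 'a) dpoly"
      have pm: "F.proj ?pm =
          (\<Otimes>\<^bsub>F.Frac\<^esub>v \<in> keys M. F.proj (pvar v ^ lookup M v)) \<and>
          ?pm \<in> dpolys \<Delta> n"
        by (rule F.proj_prod) (auto intro: vp)
      have pm2: "(\<Otimes>\<^bsub>F.Frac\<^esub>v \<in> keys M. F.proj (pvar v ^ lookup M v)) =
          ?mon M"
      proof (rule L.finprod_cong'[OF refl])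
        show "(\<lambda>v. ders F.frac_deriv (snd v) (x (fst v)) [^]\<^bsub>F.Frac\<^esub> lookup M v)
            \<in> keys M \<rightarrow> carrier F.Frac"
        proof
          fix v assume v: "v \<in> keys M"
          show "ders F.frac_deriv (snd v) (x (fst v)) [^]\<^bsub>F.Frac\<^esub> lookup M v \<in> carrier F.Frac"
            unfolding ve[OF v, symmetric] by (rule F.proj_closed[OF vp[OF v]])
        qed
      qed (rule ve)
      have 1: "F.proj ?pm =
          ?mon M"
        using pm pm2 by simp
      have 2: "?pm \<in> dpolys \<Delta> n" using pm ..
      show ?thesis unfolding single_eq_prod_pvar[of M c] h_def 1[symmetric]
        using F.proj_mult[OF const 2] F.cl(6)[OF const 2] by blast
    qed
    have "F.proj P = F.proj (\<Sum>M \<in> keys P. single M (lookup P M))"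
      by (simp only: poly_mapping_eq_sum_single)
    also have "\<dots> = (\<Oplus>\<^bsub>F.Frac\<^esub>M \<in> keys P. F.proj (single M (lookup P M)))"
      by (rule F.proj_sum) (use mon in auto)
    also have "\<dots> = dpoly_eval_ext F.Frac F.frac_deriv h x P"
      unfolding dpoly_eval_ext_def
    proof (rule L.finsum_cong'[OF refl])
      show "(\<lambda>M. h (lookup P M) \<otimes>\<^bsub>F.Frac\<^esub> ?mon M)
           \<in> keys P \<rightarrow> carrier F.Frac"
      proof
        fix M assume M: "M \<in> keys P"
        note m = mon[OF M, of "lookup P M"]
        show "h (lookup P M) \<otimes>\<^bsub>F.Frac\<^esub> ?mon M \<in> carrier F.Frac"
          unfolding conjunct2[OF m, symmetric] by (rule F.proj_closed[OF conjunct1[OF m]])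
      qed
      fix M assume M: "M \<in> keys P"
      show "F.proj (single M (lookup P M)) = h (lookup P M) \<otimes>\<^bsub>F.Frac\<^esub>
        ?mon M"
        by (rule conjunct2[OF mon[OF M]])
    qed
    finally show ?thesis by (rule sym)
  qed
  have xp: "x \<in> points n (carrier F.Frac)"
    unfolding points_def x_def using F.proj_closed[OF var] by (auto simp: dvars_def)
  have "\<forall>P\<in>F. dpoly_eval_ext F.Frac F.frac_deriv h x P = \<zero>\<^bsub>F.Frac\<^esub>"
  proof
    fix P assume "P \<in> F"
    then have "P \<in> q" using F(2) by blast
    then show "dpoly_eval_ext F.Frac F.frac_deriv h x P = \<zero>\<^bsub>F.Frac\<^esub>"
      using F.proj_eq_zero_iff[of P] eval[of P] prime_inD(1)[OF q] by simp
  qed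
  moreover have "\<forall>Q\<in>G. dpoly_eval_ext F.Frac F.frac_deriv h x Q \<noteq> \<zero>\<^bsub>F.Frac\<^esub>"
  proof
    fix Q assume "Q \<in> G"
    then have "Q \<in> dpolys \<Delta> n" "Q \<notin> q" using G(2) by blast+
    then show "dpoly_eval_ext F.Frac F.frac_deriv h x Q \<noteq> \<zero>\<^bsub>F.Frac\<^esub>"
      using F.proj_eq_zero_iff[of Q] eval[of Q] by simp
  qed
  moreover have "F \<subseteq> dpolys \<Delta> n" "G \<subseteq> dpolys \<Delta> n"
    using F(2) G(2) prime_inD(1)[OF q] by blast+
  ultimately have "\<exists>x \<in> points n UNIV. (\<forall>P\<in>F. dpoly_eval \<delta> x P = 0) \<and> (\<forall>Q\<in>G. dpoly_eval \<delta> x Q \<noteq> 0)"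
  proof -
    assume FP: "\<forall>P\<in>F. dpoly_eval_ext F.Frac F.frac_deriv h x P = \<zero>\<^bsub>F.Frac\<^esub>"
      and GQ: "\<forall>Q\<in>G. dpoly_eval_ext F.Frac F.frac_deriv h x Q \<noteq> \<zero>\<^bsub>F.Frac\<^esub>"
      and sub: "F \<subseteq> dpolys \<Delta> n" "G \<subseteq> dpolys \<Delta> n"
    note dc' = conjunct2[OF dc[unfolded differentially_closed_def], rule_format, of F G n]
    show ?thesis
      by (rule dc') (intro conjI F(1) G(1) sub exI[of _ F.Frac] exI[of _ F.frac_deriv] exI[of _ h]
        ext bexI[OF _ xp] FP GQ)
  qed
  then show ?thesis using that by blast
qed

section \<open>Ranking and leaders\<close>

lemma nat_seq_mono_subseq:
  fixes s :: "nat \<Rightarrow> nat"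
  obtains g :: "nat \<Rightarrow> nat" where "strict_mono g" "\<And>a b. a \<le> b \<Longrightarrow> s (g a) \<le> s (g b)"
proof -
  obtain f where f: "strict_mono f" "monoseq (\<lambda>n. s (f n))" using seq_monosub[of s] by blast
  show thesis
  proof (cases "\<forall>m. \<forall>n\<ge>m. s (f m) \<le> s (f n)")
    case True
    then show ?thesis using that[OF f(1)] by blast
  next
    case False
    \<comment> \<open>A weakly decreasing sequence of natural numbers is constant from the position
      of its minimum on.\<close>
    then have dec: "\<And>m n. m \<le> n \<Longrightarrow> s (f n) \<le> s (f m)" using f(2) unfolding monoseq_def by blast
    obtain N where N: "\<And>k. s (f N) \<le> s (f k)"
      using ex_has_least_nat[of "\<lambda>_. True" undefined "\<lambda>k. s (f k)"] by blast
    have "s (f (k + N)) = s (f N)" for k using dec[of N "k + N"] N[of "k + N"] by simp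
    moreover have "strict_mono (\<lambda>n. f (n + N))" using f(1) by (simp add: strict_mono_def)
    ultimately show ?thesis using that[of "\<lambda>n. f (n + N)"] by simp
  qed
qed

text \<open>\<open>B\<close> consists of the minimal elements. An infinite sequence of distinct ones
  has, by refining once for each symbol of \<Delta>, a subsequence with weakly increasing counts;
  two of its terms are then comparable, against minimality.\<close>

lemma dickson:
  assumes fin: "finite \<Delta>" and A: "A \<subseteq> {\<theta>. set_mset \<theta> \<subseteq> \<Delta>}"
  obtains B where "B \<subseteq> A" "finite B" "\<And>\<theta>. \<theta> \<in> A \<Longrightarrow> \<exists>\<eta>\<in>B. \<eta> \<subseteq># \<theta>"
proof -
  define B where "B = {\<theta> \<in> A. \<forall>\<eta>\<in>A. \<eta> \<subseteq># \<theta> \<longrightarrow> \<eta> = \<theta>}"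
  have dom: "\<exists>\<eta>\<in>B. \<eta> \<subseteq># \<theta>" if "\<theta> \<in> A" for \<theta>
    using that
  proof (induction "size \<theta>" arbitrary: \<theta> rule: less_induct)
    case less
    show ?case
    proof (cases "\<theta> \<in> B")
      case False
      then obtain \<eta> where \<eta>: "\<eta> \<in> A" "\<eta> \<subset># \<theta>" using less.prems by (auto simp: B_def subset_mset_def)
      then obtain \<zeta> where "\<zeta> \<in> B" "\<zeta> \<subseteq># \<eta>" using less.hyps mset_subset_size by blast
      then show ?thesis using \<eta>(2) by (meson subset_mset.less_imp_le subset_mset.order_trans)
    qed auto
  qed
  have "finite B"
  proof (rule ccontr)
    assume "infinite B"
    then obtain f :: "nat \<Rightarrow> _" where f: "inj f" "range f \<subseteq> B" using infinite_countable_subset by blast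
    have "\<exists>r :: nat \<Rightarrow> nat. strict_mono r \<and> (\<forall>j\<in>\<Delta>'. \<forall>a b. a \<le> b \<longrightarrow> count (f (r a)) j \<le> count (f (r b)) j)"
      if "finite \<Delta>'" for \<Delta>'
      using that
    proof induction
      case empty
      show ?case by (intro exI[of _ "\<lambda>n. n"]) (auto simp: strict_mono_def)
    next
      case (insert i \<Delta>')
      from insert.IH obtain r :: "nat \<Rightarrow> nat" where r: "strict_mono r"
        "\<forall>j\<in>\<Delta>'. \<forall>a b. a \<le> b \<longrightarrow> count (f (r a)) j \<le> count (f (r b)) j" by (elim exE conjE)
      obtain g :: "nat \<Rightarrow> nat" where g: "strict_mono g" "\<And>a b. a \<le> b \<Longrightarrow> count (f (r (g a))) i \<le> count (f (r (g b))) i"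
        by (rule nat_seq_mono_subseq[of "\<lambda>n. count (f (r n)) i"]) blast
      have "g a \<le> g b" if "a \<le> b" for a b using g(1) that by (simp add: strict_mono_less_eq)
      moreover have "strict_mono (r \<circ> g)" using r(1) g(1) by (rule strict_mono_o)
      ultimately show ?case using r(2) g(2) by (intro exI[of _ "r \<circ> g"]) (simp add: comp_def)
    qed
    from this[OF fin] obtain r :: "nat \<Rightarrow> nat" where r: "strict_mono r"
      "\<forall>j\<in>\<Delta>. \<forall>a b. a \<le> b \<longrightarrow> count (f (r a)) j \<le> count (f (r b)) j" by (elim exE conjE)
    have B: "f (r 0) \<in> B" "f (r 1) \<in> B" using f(2) by auto
    have "count (f (r 0)) j \<le> count (f (r 1)) j" for j
    proof (cases "j \<in> \<Delta>")
      case False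
      then have "j \<notin># f (r 0)" using B A by (auto simp: B_def)
      then show ?thesis by (simp add: not_in_iff)
    qed (use r(2) in simp)
    then have "f (r 0) \<subseteq># f (r 1)" by (simp add: subseteq_mset_def)
    then have "f (r 0) = f (r 1)" using B by (auto simp: B_def)
    then have "r 0 = r 1" using f(1) by (simp add: inj_eq)
    then show False using r(1) strict_monoD[of r 0 1] by simp
  qed
  then show ?thesis using that[of B] dom by (auto simp: B_def)
qed

text \<open>The multiset order on natural numbers is a well-order and is preserved by adding a
  common element, which is exactly compatibility with derivations.\<close>

lemma ex_ranking:
  fixes \<Delta> :: "'d set"
  assumes fin: "finite \<Delta>"
  obtains key :: "'d dvar \<Rightarrow> nat multiset" where "inj_on key (dvars \<Delta> N)"
    "\<And>i \<theta> j. key (i, \<theta>) < key (i, add_mset j \<theta>)"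
    "\<And>i \<theta> i' \<theta>' j. key (i, \<theta>) < key (i', \<theta>') \<Longrightarrow> key (i, add_mset j \<theta>) < key (i', add_mset j \<theta>')"
proof -
  obtain e :: "'d \<Rightarrow> nat" and k where e: "e ` \<Delta> = {i. i < k}" "inj_on e \<Delta>"
    using finite_imp_inj_to_nat_seg[OF fin] by blast
  \<comment> \<open>The index is stored as the letter \<open>k + i\<close>. The symbols of \<Delta>
    are coded below \<open>k\<close>, so it cannot be confused with them and the key determines the
    variable.\<close>
  define key :: "'d dvar \<Rightarrow> nat multiset" where "key = (\<lambda>(i, \<theta>). add_mset (k + i) (image_mset e \<theta>))"
  have "inj_on key (dvars \<Delta> N)"
  proof (rule inj_onI, clarify)
    fix i j \<theta> \<eta> assume v: "(i, \<theta>) \<in> dvars \<Delta> N" "(j, \<eta>) \<in> dvars \<Delta> N" and eq: "key (i, \<theta>) = key (j, \<eta>)"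
    have s: "set_mset \<theta> \<subseteq> \<Delta>" "set_mset \<eta> \<subseteq> \<Delta>" using v by (auto simp: dvars_def)
    have "e a < k" if "a \<in> \<Delta>" for a using e(1) that by auto
    then have ni: "k + a \<notin># image_mset e \<theta>" "k + a \<notin># image_mset e \<eta>" for a
      using s by fastforce+
    have eq': "add_mset (k + i) (image_mset e \<theta>) = add_mset (k + j) (image_mset e \<eta>)"
      using eq by (simp add: key_def)
    then have "k + i \<in># add_mset (k + j) (image_mset e \<eta>)" by (metis union_single_eq_member)
    then have ij: "i = j" using ni by auto
    then have "image_mset e \<theta> = image_mset e \<eta>" using eq' by simp
    then have "image_mset (inv_into \<Delta> e) (image_mset e \<theta>) = image_mset (inv_into \<Delta> e) (image_mset e \<eta>)" by simp
    moreover have "image_mset (inv_into \<Delta> e) (image_mset e \<zeta>) = \<zeta>" if "set_mset \<zeta> \<subseteq> \<Delta>" for \<zeta>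
    proof -
      have "image_mset (inv_into \<Delta> e \<circ> e) \<zeta> = image_mset (\<lambda>x. x) \<zeta>"
        by (rule image_mset_cong) (use that e(2) in \<open>auto simp: inv_into_f_f\<close>)
      then show ?thesis by (simp add: multiset.map_comp)
    qed
    ultimately show "i = j \<and> \<theta> = \<eta>" using ij s by metis
  qed
  moreover have "key (i, add_mset j \<theta>) = add_mset (e j) (key (i, \<theta>))" for i j \<theta>
    by (simp add: key_def)
  ultimately show ?thesis
    using that[of key] by (simp add: le_multiset_right_total add_mset_lt_right_lt)
qed

lemma ders_dpoly_deriv:
  assumes K: "differential_field \<Delta> \<delta>" and "set_mset \<theta> \<subseteq> \<Delta>" "j \<in> \<Delta>"
  shows "ders (dpoly_deriv \<delta>) (add_mset j \<theta>) (P :: ('d, 'a::field) dpoly) =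
    dpoly_deriv \<delta> j (ders (dpoly_deriv \<delta>) \<theta> P)"
  by (rule ders_add_mset_on[of \<Delta> UNIV]) (use assms dpoly_deriv_commute[OF K] in auto)

text \<open>The source of separants: for the equation of a leader, the last summand is its separant
  times the derivative of the leader, the new highest variable.\<close>

lemma derivation_poly:
  assumes d: "derivation d"
  shows "d (poly q x) = poly (map_poly d q) x + poly (formal_deriv q) x * d x"
proof (induction q)
  case 0
  show ?case by (simp add: derivationD(3)[OF d] formal_deriv_def)
next
  case (pCons a q)
  then show ?case
    by (simp add: formal_deriv_pCons map_poly_pCons derivationD(1-3)[OF d] algebra_simps)
qed

lemma degree_formal_deriv:
  "0 < degree p \<Longrightarrow> degree (formal_deriv p) < degree p"
proof -
  assume p: "0 < degree p"
  have "degree (formal_deriv p) \<le> degree p - 1"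
    by (rule degree_le) (use p in \<open>auto simp: coeff_formal_deriv coeff_eq_0 simp del: of_nat_Suc\<close>)
  then show ?thesis using p by simp
qed

text \<open>
  Leaders are the variables that are algebraic, modulo \<open>P\<close>, over the lower ones. The derivatives
  of a leader \<open>u\<close> are leaders of degree one whose initial is the separant of \<open>u\<close>, so that by
  Dickson's lemma finitely many leaders \<open>Mn\<close> carry all the polynomial conditions.
\<close>

lemma prime_differential_ideal_ranked:
  fixes P :: "('d, 'a::field_char_0) dpoly set"
  assumes K: "differential_field \<Delta> \<delta>" and P: "prime_in (dpolys \<Delta> N) P"
    and dP: "\<And>j Q. j \<in> \<Delta> \<Longrightarrow> Q \<in> P \<Longrightarrow> dpoly_deriv \<delta> j Q \<in> P" and mN: "m \<le> N"
  obtains key :: "'d dvar \<Rightarrow> nat multiset" and L Mn pp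
  where "ranked_ideal (dvars \<Delta> N) (dvars \<Delta> m) key P L Mn pp"
    "\<And>u. u \<in> Mn \<Longrightarrow> lead_coeff (pp u) * poly (formal_deriv (pp u)) (pvar u) \<notin> P"
    "\<And>v. v \<in> L - Mn \<Longrightarrow> \<exists>u\<in>Mn. \<exists>\<theta>. set_mset \<theta> \<subseteq> \<Delta> \<and>
      poly (pp v) (pvar v) = ders (dpoly_deriv \<delta>) \<theta> (poly (pp u) (pvar u))"
proof -
  define W where "W = dvars \<Delta> N"
  define Y where "Y = dvars \<Delta> m"
  have fin: "finite \<Delta>" using K by (simp add: differential_field_def)
  have W: "dpolys \<Delta> N = pvars W" by (simp add: W_def dpolys_eq_pvars)
  note P = P[unfolded W]
  have YW: "Y \<subseteq> W" using mN by (auto simp: Y_def W_def dvars_def)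
  note PD = prime_inD[OF P]
  obtain key :: "'d dvar \<Rightarrow> nat multiset" where key: "inj_on key W"
    "\<And>i \<theta> j. key (i, \<theta>) < key (i, add_mset j \<theta>)"
    "\<And>i \<theta> i' \<theta>' j. key (i, \<theta>) < key (i', \<theta>') \<Longrightarrow> key (i, add_mset j \<theta>) < key (i', add_mset j \<theta>')"
    unfolding W_def by (rule ex_ranking[OF fin]) blast
  define below where "below = (\<lambda>v. Y \<union> {w \<in> W. key w < key v})"
  have bW: "below v \<subseteq> W" for v using YW by (auto simp: below_def)
  have b_mono: "key v < key w \<Longrightarrow> below v \<subseteq> below w" for v w by (auto simp: below_def)
  have b_in: "key v < key w \<Longrightarrow> v \<in> W \<Longrightarrow> v \<in> below w" for v w by (auto simp: below_def)
  have b_shift: "(i, add_mset j \<theta>) \<in> below (i', add_mset j \<theta>')"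
    if "(i, \<theta>) \<in> below (i', \<theta>')" "j \<in> \<Delta>" for i \<theta> i' \<theta>' j
    using that key(3)[of i \<theta> i' \<theta>' j] by (auto simp: below_def Y_def W_def dvars_def)
  have P_poly: "poly (monom c k) x \<in> P" if "c \<in> P" "x \<in> pvars W" for c x k
    using PD(5)[OF that(1) pvars_power[OF that(2), of k]] by (simp add: poly_monom mult.commute)
  \<comment> \<open>A relation all of whose coefficients lie in \<open>P\<close> holds for every
    value of \<open>v\<close>; only the others make \<open>v\<close> algebraic.\<close>
  define witness where "witness = (\<lambda>v q. q \<in> cpoly (pvars (below v)) \<and> poly q (pvar v) \<in> P \<and>
    (\<exists>i. coeff q i \<notin> P))"
  define L where "L = {v \<in> W - Y. \<exists>q. witness v q}"
  define deg where "deg = (\<lambda>v. LEAST d. \<exists>q. witness v q \<and> degree q = d)"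
  define mp where "mp = (\<lambda>v. SOME q. witness v q \<and> degree q = deg v)"
  define sep where "sep = (\<lambda>v. poly (formal_deriv (mp v)) (pvar v))"
  have mp: "witness v (mp v) \<and> degree (mp v) = deg v" if "v \<in> L" for v
  proof -
    have "\<exists>d q. witness v q \<and> degree q = d" using that by (auto simp: L_def)
    then have "\<exists>q. witness v q \<and> degree q = deg v" unfolding deg_def by (rule LeastI_ex)
    then show ?thesis unfolding mp_def by (rule someI_ex)
  qed
  have mp_c: "mp v \<in> cpoly (pvars (below v))" and mp_P: "poly (mp v) (pvar v) \<in> P"
    and mp_n: "\<exists>i. coeff (mp v) i \<notin> P" if "v \<in> L" for v
    using mp[OF that] by (auto simp: witness_def)
  have mp_min: "coeff q i \<in> P"
    if "v \<in> L" "q \<in> cpoly (pvars (below v))" "poly q (pvar v) \<in> P" "degree q < degree (mp v)" for v q i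
  proof (rule ccontr)
    assume "coeff q i \<notin> P"
    then have "witness v q" using that by (auto simp: witness_def)
    then have "deg v \<le> degree q" unfolding deg_def by (intro Least_le) blast
    then show False using that(4) mp[OF that(1)] by simp
  qed
  have const_P: "coeff q i \<in> P" if q: "poly q (pvar v) \<in> P" "degree q = 0" for q i and v :: "'d dvar"
  proof -
    obtain c where "q = [:c:]" using degree_eq_zeroE[OF q(2)] by blast
    then show ?thesis using q(1) PD(2) by (cases i) auto
  qed
  have mp_deg: "0 < degree (mp v)" if v: "v \<in> L" for v
    using const_P[OF mp_P[OF v]] mp_n[OF v] by blast
  have LW: "v \<in> L \<Longrightarrow> v \<in> W" for v by (simp add: L_def)
  \<comment> \<open>Otherwise the leading term could be dropped: the rest is in \<open>P\<close>
    with smaller degree, so by minimality all coefficients of \<open>mp v\<close> would lie in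
    \<open>P\<close>.\<close>
  have lc: "lead_coeff (mp v) \<notin> P" if v: "v \<in> L" for v
  proof
    assume l: "lead_coeff (mp v) \<in> P"
    define q where "q = mp v - monom (lead_coeff (mp v)) (degree (mp v))"
    have q: "q \<in> cpoly (pvars (below v))"
      unfolding q_def using mp_c[OF v] by (intro cpoly_closed[OF subring_set_pvars]) (auto dest: cpolyD)
    have "poly q (pvar v) \<in> P"
      unfolding q_def poly_diff
      by (intro prime_in_diff[OF P subring_set_pvars] mp_P[OF v] P_poly l) (simp add: LW[OF v])
    moreover have "degree q < degree (mp v)"
    proof -
      have "degree q \<le> degree (mp v)"
        unfolding q_def by (intro Polynomial.degree_diff_le degree_monom_le order_refl)
      moreover have "coeff q (degree (mp v)) = 0" by (simp add: q_def)
      ultimately show ?thesis using mp_deg[OF v]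
        by (metis bot_nat_0.not_eq_extremum degree_0 leading_coeff_0_iff le_neq_implies_less)
    qed
    ultimately have qP: "coeff q i \<in> P" for i using mp_min[OF v q] by blast
    have "coeff (mp v) i \<in> P" for i
      using qP[of i] l by (cases "i = degree (mp v)") (auto simp: q_def)
    then show False using mp_n[OF v] by blast
  qed
  \<comment> \<open>The separant has smaller degree than \<open>mp v\<close>, so if it were in
    \<open>P\<close>, then so would its top coefficient, \<open>degree (mp v)\<close> times the
    initial. In characteristic zero the factor can be cancelled, contradicting
    \<open>lc\<close>.\<close>
  have sep: "sep v \<notin> P" if v: "v \<in> L" for v
  proof
    assume s: "sep v \<in> P"
    define d where "d = degree (mp v)"
    have d: "0 < d" unfolding d_def by (rule mp_deg[OF v])
    have "coeff (formal_deriv (mp v)) (d - 1) \<in> P"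
      using mp_min[OF v cpoly_closed(7)[OF subring_set_pvars mp_c[OF v]] s[unfolded sep_def]
          degree_formal_deriv[OF mp_deg[OF v]]] .
    then have "of_nat d * lead_coeff (mp v) \<in> P" using d by (simp add: coeff_formal_deriv d_def)
    then have "pconst (1 / of_nat d) * (of_nat d * lead_coeff (mp v)) \<in> P" by (rule PD(5)) simp
    moreover have "pconst (1 / of_nat d) * (of_nat d * lead_coeff (mp v)) = lead_coeff (mp v)"
      using d by (simp add: mult.assoc[symmetric] pconst_of_nat[symmetric] pconst_mult[symmetric])
    ultimately show False using lc[OF v] by simp
  qed
  have mp_pvars: "poly (mp v) (pvar v) \<in> pvars W" if "v \<in> L" for v
    by (rule poly_in_pvars[OF mp_c[OF that] _ bW]) (simp add: LW[OF that])
  have sep_pvars: "sep v \<in> pvars (insert v (below v))" if v: "v \<in> L" for v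
    unfolding sep_def
    by (rule poly_in_pvars[OF cpoly_closed(7)[OF subring_set_pvars mp_c[OF v]]]) auto
  \<comment> \<open>The first derivation acts by the chain rule and produces the separant. Later
    ones only move the highest variable up; by the Leibniz rule, the derivative of the separant
    falls into the lower part \<open>T\<close>.\<close>
  have linear: "\<exists>T \<in> pvars (below (i, \<eta> + \<theta>)). ders (dpoly_deriv \<delta>) \<theta> (poly (mp (i, \<eta>)) (pvar (i, \<eta>))) =
        sep (i, \<eta>) * pvar (i, \<eta> + \<theta>) + T \<and> key (i, \<eta>) < key (i, \<eta> + \<theta>)"
    if u: "(i, \<eta>) \<in> L" and "\<theta> \<noteq> {#}" "set_mset \<theta> \<subseteq> \<Delta>" for i \<eta> \<theta>
    using that(2,3)
  proof (induction \<theta>)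
    case (add j \<theta>)
    have j: "j \<in> \<Delta>" and \<theta>: "set_mset \<theta> \<subseteq> \<Delta>" using add.prems by auto
    note dd = derivationD[OF derivation_dpoly_deriv[OF K j]]
    have uW: "(i, \<eta>) \<in> W" using u by (simp add: L_def)
    have vW: "(i, \<eta> + \<theta>) \<in> W" using uW \<theta> by (auto simp: W_def dvars_def)
    note less = key(2)[of i "\<eta> + \<theta>" j]
    \<comment> \<open>Compatibility of the ranking with derivations, extended from variables to
      polynomials.\<close>
    have D_below: "dpoly_deriv \<delta> j Q \<in> pvars (below (i', add_mset j \<zeta>))"
      if "Q \<in> pvars (below (i', \<zeta>))" for Q i' \<zeta>
      by (rule dpoly_deriv_pvars[OF K j that]) (use b_mono[OF key(2)] b_shift[OF _ j] in auto)
    show ?case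
    proof (cases "\<theta> = {#}")
      case True
      define T where "T = poly (map_poly (dpoly_deriv \<delta> j) (mp (i, \<eta>))) (pvar (i, \<eta>))"
      have "map_poly (dpoly_deriv \<delta> j) (mp (i, \<eta>)) \<in> cpoly (pvars (below (i, add_mset j \<eta>)))"
        unfolding cpoly_def using D_below cpolyD[OF mp_c[OF u]] by (simp add: coeff_map_poly dd)
      then have T: "T \<in> pvars (below (i, add_mset j \<eta>))"
        unfolding T_def by (rule poly_in_pvars) (use b_in[OF key(2) uW] in auto)
      have "ders (dpoly_deriv \<delta>) {#j#} (poly (mp (i, \<eta>)) (pvar (i, \<eta>))) =
          sep (i, \<eta>) * pvar (i, add_mset j \<eta>) + T"
        using ders_dpoly_deriv[OF K, of "{#}" j] j
          derivation_poly[OF derivation_dpoly_deriv[OF K j], of "mp (i, \<eta>)" "pvar (i, \<eta>)"]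
        by (simp add: T_def sep_def dpoly_deriv_var[OF K j])
      then show ?thesis using T key(2)[of i \<eta> j] True by auto
    next
      case False
      then obtain T where T: "T \<in> pvars (below (i, \<eta> + \<theta>))" "key (i, \<eta>) < key (i, \<eta> + \<theta>)"
        "ders (dpoly_deriv \<delta>) \<theta> (poly (mp (i, \<eta>)) (pvar (i, \<eta>))) = sep (i, \<eta>) * pvar (i, \<eta> + \<theta>) + T"
        using add.IH \<theta> by blast
      define T' where "T' = dpoly_deriv \<delta> j (sep (i, \<eta>)) * pvar (i, \<eta> + \<theta>) + dpoly_deriv \<delta> j T"
      have "sep (i, \<eta>) \<in> pvars (below (i, \<eta> + \<theta>))"
        by (rule pvars_mono[OF sep_pvars[OF u]]) (use b_mono[OF T(2)] b_in[OF T(2) uW] in auto)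
      then have "T' \<in> pvars (below (i, add_mset j (\<eta> + \<theta>)))"
        unfolding T'_def using D_below T(1) b_in[OF less vW] by (intro pvars_add pvars_mult) auto
      moreover have "ders (dpoly_deriv \<delta>) (add_mset j \<theta>) (poly (mp (i, \<eta>)) (pvar (i, \<eta>))) =
          sep (i, \<eta>) * pvar (i, add_mset j (\<eta> + \<theta>)) + T'"
        unfolding ders_dpoly_deriv[OF K \<theta> j] T(3) T'_def dd dpoly_deriv_var[OF K j]
        by (simp add: add_ac)
      ultimately show ?thesis using less T(2) by auto
    qed
  qed simp
  have ders_P: "ders (dpoly_deriv \<delta>) \<theta> Q \<in> P" if "Q \<in> P" "set_mset \<theta> \<subseteq> \<Delta>" for Q \<theta>
    using that(2)
  proof (induction \<theta>)
    case (add j \<theta>)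
    then show ?case using ders_dpoly_deriv[OF K, of \<theta> j Q] dP by simp
  qed (simp add: that)
  \<comment> \<open>Divisibility of derivative operators makes sense for one indeterminate at a
    time, so Dickson's lemma is applied to each index.\<close>
  have "\<exists>B. \<forall>i. B i \<subseteq> {\<theta>. (i, \<theta>) \<in> L} \<and> finite (B i) \<and> (\<forall>\<theta>. (i, \<theta>) \<in> L \<longrightarrow> (\<exists>\<eta>\<in>B i. \<eta> \<subseteq># \<theta>))"
  proof (rule choice, rule allI)
    fix i
    have "{\<theta>. (i, \<theta>) \<in> L} \<subseteq> {\<theta>. set_mset \<theta> \<subseteq> \<Delta>}" by (auto simp: L_def W_def dvars_def)
    from dickson[OF fin this]
    show "\<exists>B. B \<subseteq> {\<theta>. (i, \<theta>) \<in> L} \<and> finite B \<and> (\<forall>\<theta>. (i, \<theta>) \<in> L \<longrightarrow> (\<exists>\<eta>\<in>B. \<eta> \<subseteq># \<theta>))"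
      by (metis (mono_tags, lifting) mem_Collect_eq)
  qed
  then obtain B where B: "\<And>i. B i \<subseteq> {\<theta>. (i, \<theta>) \<in> L}" "\<And>i. finite (B i)"
    "\<And>i \<theta>. (i, \<theta>) \<in> L \<Longrightarrow> \<exists>\<eta>\<in>B i. \<eta> \<subseteq># \<theta>" by blast
  define Mn where "Mn = (SIGMA i:{..<N}. B i)"
  have MnL: "Mn \<subseteq> L" and Mnfin: "finite Mn" using B(1,2) by (auto simp: Mn_def)
  define lin where "lin = (\<lambda>v p. p \<in> cpoly (pvars (below v)) \<and> degree p = 1 \<and>
      poly p (pvar v) \<in> P \<and> (\<exists>u\<in>Mn. key u < key v \<and> lead_coeff p = sep u \<and>
      (\<exists>\<theta>. set_mset \<theta> \<subseteq> \<Delta> \<and> poly p (pvar v) = ders (dpoly_deriv \<delta>) \<theta> (poly (mp u) (pvar u)))))"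
  have "\<forall>v\<in>L - Mn. \<exists>p. lin v p"
  proof (rule ballI)
    fix v assume v: "v \<in> L - Mn"
    obtain i \<zeta> where i: "v = (i, \<zeta>)" by (cases v)
    obtain \<eta> where \<eta>: "\<eta> \<in> B i" "\<eta> \<subseteq># \<zeta>" using B(3) v i by blast
    have vW: "v \<in> W" using v by (simp add: L_def)
    have u: "(i, \<eta>) \<in> Mn" using \<eta>(1) vW i by (auto simp: Mn_def W_def dvars_def)
    have uL: "(i, \<eta>) \<in> L" using u MnL by blast
    define \<theta> where "\<theta> = \<zeta> - \<eta>"
    have z: "\<zeta> = \<eta> + \<theta>" using \<eta>(2) by (simp add: \<theta>_def)
    have \<theta>: "set_mset \<theta> \<subseteq> \<Delta>" using vW i z by (auto simp: W_def dvars_def)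
    have "\<theta> \<noteq> {#}" using v i u z by auto
    from linear[OF uL this \<theta>] obtain T where T: "T \<in> pvars (below v)" "key (i, \<eta>) < key v"
      "ders (dpoly_deriv \<delta>) \<theta> (poly (mp (i, \<eta>)) (pvar (i, \<eta>))) = sep (i, \<eta>) * pvar v + T"
      unfolding z[symmetric] i[symmetric] by blast
    have s: "sep (i, \<eta>) \<in> pvars (below v)"
      by (rule pvars_mono[OF sep_pvars[OF uL]]) (use b_mono[OF T(2)] b_in[OF T(2) LW[OF uL]] in auto)
    have s0: "sep (i, \<eta>) \<noteq> 0" using sep[OF uL] PD(2) by auto
    have eq: "poly [:T, sep (i, \<eta>):] (pvar v) = ders (dpoly_deriv \<delta>) \<theta> (poly (mp (i, \<eta>)) (pvar (i, \<eta>)))"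
      unfolding T(3) by (simp add: mult.commute)
    show "\<exists>p. lin v p"
      unfolding lin_def
    proof (intro exI[of _ "[:T, sep (i, \<eta>):]"] conjI bexI[OF _ u] exI[of _ \<theta>] eq T(2) \<theta>)
      show "[:T, sep (i, \<eta>):] \<in> cpoly (pvars (below v))"
        unfolding cpoly_def using T(1) s by (auto simp: Polynomial.coeff_pCons split: nat.splits)
      show "poly [:T, sep (i, \<eta>):] (pvar v) \<in> P"
        unfolding eq by (rule ders_P[OF mp_P[OF uL] \<theta>])
    qed (use s0 in auto)
  qed
  from bchoice[OF this] obtain lp where lp0: "\<And>v. v \<in> L - Mn \<Longrightarrow> lin v (lp v)"
    by blast
  note lp = lp0[unfolded lin_def]
  \<comment> \<open>The linear equations also have least degree: a relation of degree 0 in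
    \<open>P\<close> has its coefficient in \<open>P\<close>, by \<open>const_P\<close>.\<close>
  define pp where "pp = (\<lambda>v. if v \<in> Mn then mp v else lp v)"
  have pp_Mn: "v \<in> Mn \<Longrightarrow> pp v = mp v" and pp_lp: "v \<in> L - Mn \<Longrightarrow> pp v = lp v" for v
    by (auto simp: pp_def)
  have ri: "ranked_ideal W Y key P L Mn pp"
  proof unfold_locales
    show "Y \<subseteq> W" "inj_on key (W - Y)" using YW key(1) by (auto intro: inj_on_subset)
    show "f \<in> P \<Longrightarrow> g \<in> P \<Longrightarrow> f + g \<in> P" for f g by (rule PD(4))
    show "f \<in> P \<Longrightarrow> g \<in> pvars W \<Longrightarrow> g * f \<in> P" for f g by (rule PD(5))
    show "L \<subseteq> W - Y" by (auto simp: L_def)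
    show "Mn \<subseteq> L" "finite Mn" by (fact MnL Mnfin)+
    fix v q i
    show "coeff q i \<in> P" if "v \<in> W - Y" "v \<notin> L" "q \<in> cpoly (pvars (Y \<union> {w \<in> W. key w < key v}))"
      "poly q (pvar v) \<in> P"
      using that by (auto simp: L_def witness_def below_def)
    show "pp v \<in> cpoly (pvars (Y \<union> {w \<in> W. key w < key v}))" if "v \<in> L"
      using that mp_c[of v] lp[of v] by (cases "v \<in> Mn") (auto simp: pp_def below_def)
    show "poly (pp v) (pvar v) \<in> P" if "v \<in> L"
      using that mp_P[of v] lp[of v] by (cases "v \<in> Mn") (auto simp: pp_def)
    show "0 < degree (pp v)" if "v \<in> L"
      using that mp_deg[of v] lp[of v] by (cases "v \<in> Mn") (auto simp: pp_def)
    show "coeff q i \<in> P" if "v \<in> L" "q \<in> cpoly (pvars (Y \<union> {w \<in> W. key w < key v}))"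
      "poly q (pvar v) \<in> P" "degree q < degree (pp v)"
    proof (cases "v \<in> Mn")
      case True
      then show ?thesis using mp_min[of v q i] that by (simp add: pp_Mn below_def)
    next
      case False
      then have "degree q = 0" using that(1,4) lp[of v] by (simp add: pp_def)
      then show ?thesis using const_P[OF that(3)] by blast
    qed
    show "degree (pp v) = 1" if "v \<in> L - Mn"
      using lp[OF that] pp_lp[OF that] by simp
    show "\<exists>u\<in>Mn. key u < key v \<and> lead_coeff (pp v) = poly (formal_deriv (pp u)) (pvar u)" if "v \<in> L - Mn"
      using lp[OF that] pp_lp[OF that] pp_Mn unfolding sep_def by metis
  qed
  show thesis
  proof (rule that[OF ri[unfolded W_def Y_def]])
    show "lead_coeff (pp u) * poly (formal_deriv (pp u)) (pvar u) \<notin> P" if "u \<in> Mn" for u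
    proof
      assume *: "lead_coeff (pp u) * poly (formal_deriv (pp u)) (pvar u) \<in> P"
      have u: "u \<in> L" using that MnL by blast
      have "lead_coeff (mp u) \<in> pvars W" using cpolyD[OF mp_c[OF u]] bW pvars_mono by blast
      moreover have "sep u \<in> pvars W" using pvars_mono[OF sep_pvars[OF u]] bW LW[OF u] by blast
      ultimately show False
        using PD(6)[OF *[unfolded pp_Mn[OF that]]] lc[OF u] sep[OF u] unfolding sep_def by blast
    qed
    show "\<exists>u\<in>Mn. \<exists>\<theta>. set_mset \<theta> \<subseteq> \<Delta> \<and> poly (pp v) (pvar v) = ders (dpoly_deriv \<delta>) \<theta> (poly (pp u) (pvar u))"
      if "v \<in> L - Mn" for v
      using lp[OF that] pp_lp[OF that] pp_Mn by metis
  qed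
qed

section \<open>Regular functions\<close>

lemma dpoly_eval_const [simp]: "dpoly_eval \<delta> x (pconst c) = c"
  by (simp add: dpoly_eval_eq_pev rhom_id)

lemma dpoly_eval_var [simp]: "dpoly_eval \<delta> x (pvar (i, \<theta>)) = ders \<delta> \<theta> (x i)"
  by (simp add: dpoly_eval_eq_pev rhom_id)

lemma dpoly_eval_diff: "dpoly_eval \<delta> x (P - Q) = dpoly_eval \<delta> x P - dpoly_eval \<delta> x Q"
  by (simp add: dpoly_eval_eq_pev rhomD(6)[OF rhom_pev[OF rhom_id]])

lemma dpoly_eval_prod: "dpoly_eval \<delta> x (prod f A) = (\<Prod>a\<in>A. dpoly_eval \<delta> x (f a))"
  by (simp add: dpoly_eval_eq_pev rhomD(10)[OF rhom_pev[OF rhom_id]])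

lemma dpoly_eval_cong:
  assumes "P \<in> dpolys \<Delta> n" "\<And>i. i < n \<Longrightarrow> x i = y i"
  shows "dpoly_eval \<delta> x P = dpoly_eval \<delta> y P"
  unfolding dpoly_eval_eq_pev
  by (rule pev_cong[OF assms(1)[unfolded dpolys_eq_pvars]]) (auto simp: dvars_def assms(2))

lemma pev_comp:
  assumes "rhom h"
  shows "pev h (\<lambda>v. h (s v)) P = h (pev (\<lambda>a. a) s P)"
  by (simp add: pev_def rhomD[OF assms])

lemma dpolys_induct [consumes 1, case_names const var add mult]:
  assumes "P \<in> dpolys \<Delta> n" "\<And>c. \<Phi> (pconst c)"
    "\<And>i \<theta>. i < n \<Longrightarrow> set_mset \<theta> \<subseteq> \<Delta> \<Longrightarrow> \<Phi> (pvar (i, \<theta>))"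
    "\<And>P Q. P \<in> dpolys \<Delta> n \<Longrightarrow> Q \<in> dpolys \<Delta> n \<Longrightarrow> \<Phi> P \<Longrightarrow> \<Phi> Q \<Longrightarrow> \<Phi> (P + Q)"
    "\<And>P Q. P \<in> dpolys \<Delta> n \<Longrightarrow> Q \<in> dpolys \<Delta> n \<Longrightarrow> \<Phi> P \<Longrightarrow> \<Phi> Q \<Longrightarrow> \<Phi> (P * Q)"
  shows "\<Phi> (P :: ('d, 'a::comm_ring_1) dpoly)"
  using assms(1)[unfolded dpolys_eq_pvars]
proof (induction rule: pvars_induct)
  case (var v)
  then show ?case using assms(3)[of "fst v" "snd v"] by (simp add: dvars_def case_prod_unfold)
qed (use assms(2,4,5) in \<open>simp_all add: dpolys_eq_pvars\<close>)

lemma dpolys_const [simp]: "pconst c \<in> dpolys \<Delta> n"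
  by (simp add: dpolys_eq_pvars)

lemma dpolys_var: "i < n \<Longrightarrow> set_mset \<theta> \<subseteq> \<Delta> \<Longrightarrow> pvar (i, \<theta>) \<in> dpolys \<Delta> n"
  by (simp add: dpolys_eq_pvars dvars_def)

lemmas dpolys_closed = subring_setD[OF subring_set_dpolys]

text \<open>Carries equations in \<open>x\<close> to the product space, where the coordinates of
  \<open>x\<close> follow the \<open>m\<close> coordinates of \<open>y\<close>.\<close>

lemma dpoly_shift:
  fixes P :: "('d, 'a::comm_ring_1) dpoly"
  assumes "P \<in> dpolys \<Delta> n"
  shows "\<exists>P' \<in> dpolys \<Delta> (m + n). \<forall>w. dpoly_eval \<delta> w P' = dpoly_eval \<delta> (\<lambda>i. w (m + i)) P"
  using assms
proof (induction rule: dpolys_induct)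
  case (const c)
  show ?case by (intro bexI[of _ "pconst c"]) auto
next
  case (var i \<theta>)
  then show ?case by (intro bexI[of _ "pvar (m + i, \<theta>)"]) (auto intro: dpolys_var)
next
  case (add P Q)
  from add.IH(1) obtain P' where P': "P' \<in> dpolys \<Delta> (m + n)"
    "\<forall>w. dpoly_eval \<delta> w P' = dpoly_eval \<delta> (\<lambda>i. w (m + i)) P" by (rule bexE)
  from add.IH(2) obtain Q' where Q': "Q' \<in> dpolys \<Delta> (m + n)"
    "\<forall>w. dpoly_eval \<delta> w Q' = dpoly_eval \<delta> (\<lambda>i. w (m + i)) Q" by (rule bexE)
  show ?case
  proof (rule bexI[of _ "P' + Q'"])
    show "P' + Q' \<in> dpolys \<Delta> (m + n)" using P'(1) Q'(1) by (rule dpolys_closed)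
    show "\<forall>w. dpoly_eval \<delta> w (P' + Q') = dpoly_eval \<delta> (\<lambda>i. w (m + i)) (P + Q)"
      unfolding dpoly_eval_add using P'(2) Q'(2) by simp
  qed
next
  case (mult P Q)
  from mult.IH(1) obtain P' where P': "P' \<in> dpolys \<Delta> (m + n)"
    "\<forall>w. dpoly_eval \<delta> w P' = dpoly_eval \<delta> (\<lambda>i. w (m + i)) P" by (rule bexE)
  from mult.IH(2) obtain Q' where Q': "Q' \<in> dpolys \<Delta> (m + n)"
    "\<forall>w. dpoly_eval \<delta> w Q' = dpoly_eval \<delta> (\<lambda>i. w (m + i)) Q" by (rule bexE)
  show ?case
  proof (rule bexI[of _ "P' * Q'"])
    show "P' * Q' \<in> dpolys \<Delta> (m + n)" using P'(1) Q'(1) by (rule dpolys_closed)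
    show "\<forall>w. dpoly_eval \<delta> w (P' * Q') = dpoly_eval \<delta> (\<lambda>i. w (m + i)) (P * Q)"
      unfolding dpoly_eval_mult using P'(2) Q'(2) by simp
  qed
qed

section \<open>Regular functions as local quotients\<close>

abbreviation (input) "kolchin_on \<Delta> \<delta> n X \<equiv> subtopology (kolchin \<Delta> \<delta> n) X"

lemma regular_functionI:
  assumes "\<And>x. x \<in> X \<Longrightarrow> \<exists>W. openin (kolchin_on \<Delta> \<delta> n X) W \<and> x \<in> W \<and>
    (\<exists>P \<in> dpolys \<Delta> n. \<exists>Q \<in> dpolys \<Delta> n.
      \<forall>w\<in>W. dpoly_eval \<delta> w Q \<noteq> 0 \<and> f w = dpoly_eval \<delta> w P / dpoly_eval \<delta> w Q)"
  shows "regular_function \<Delta> \<delta> n X f"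
  unfolding regular_function_def by (rule ballI) (rule assms)

lemma regular_functionE:
  assumes "regular_function \<Delta> \<delta> n X f" "x \<in> X"
  obtains W P Q where "openin (kolchin_on \<Delta> \<delta> n X) W" "x \<in> W"
    "P \<in> dpolys \<Delta> n" "Q \<in> dpolys \<Delta> n"
    "\<forall>w\<in>W. dpoly_eval \<delta> w Q \<noteq> 0 \<and> f w = dpoly_eval \<delta> w P / dpoly_eval \<delta> w Q"
  using bspec[OF assms(1)[unfolded regular_function_def] assms(2)]
  by (elim exE conjE bexE) (rule that)

lemma regular_function_dpoly:
  assumes X: "X \<subseteq> points n UNIV" and P: "P \<in> dpolys \<Delta> n" "\<And>x. x \<in> X \<Longrightarrow> f x = dpoly_eval \<delta> x P"
  shows "regular_function \<Delta> \<delta> n X f"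
proof (rule regular_functionI, rule exI[of _ X], rule conjI[rotated], rule conjI[rotated],
    rule bexI[OF bexI[OF _ dpolys_1] P(1)])
  show "openin (kolchin_on \<Delta> \<delta> n X) X"
    unfolding openin_subtopology_refl topspace_kolchin by (rule X)
  show "\<forall>w\<in>X. dpoly_eval \<delta> w 1 \<noteq> 0 \<and> f w = dpoly_eval \<delta> w P / dpoly_eval \<delta> w 1" using P(2) by simp
qed

lemma regular_function_binary:
  assumes f: "regular_function \<Delta> \<delta> n X f" and g: "regular_function \<Delta> \<delta> n X g"
    and F: "\<And>P Q P' Q'. P \<in> dpolys \<Delta> n \<Longrightarrow> Q \<in> dpolys \<Delta> n \<Longrightarrow> P' \<in> dpolys \<Delta> n \<Longrightarrow> Q' \<in> dpolys \<Delta> n \<Longrightarrow>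
      N P Q P' Q' \<in> dpolys \<Delta> n \<and> (\<forall>w. dpoly_eval \<delta> w Q \<noteq> 0 \<longrightarrow> dpoly_eval \<delta> w Q' \<noteq> 0 \<longrightarrow>
        F (dpoly_eval \<delta> w P / dpoly_eval \<delta> w Q) (dpoly_eval \<delta> w P' / dpoly_eval \<delta> w Q') =
        dpoly_eval \<delta> w (N P Q P' Q') / (dpoly_eval \<delta> w Q * dpoly_eval \<delta> w Q'))"
  shows "regular_function \<Delta> \<delta> n X (\<lambda>x. F (f x) (g x))"
proof (rule regular_functionI)
  fix x assume x: "x \<in> X"
  obtain W P Q where f: "openin (kolchin_on \<Delta> \<delta> n X) W" "x \<in> W" "P \<in> dpolys \<Delta> n" "Q \<in> dpolys \<Delta> n"
    "\<forall>w\<in>W. dpoly_eval \<delta> w Q \<noteq> 0 \<and> f w = dpoly_eval \<delta> w P / dpoly_eval \<delta> w Q"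
    by (rule regular_functionE[OF f x])
  obtain W' P' Q' where g: "openin (kolchin_on \<Delta> \<delta> n X) W'" "x \<in> W'" "P' \<in> dpolys \<Delta> n" "Q' \<in> dpolys \<Delta> n"
    "\<forall>w\<in>W'. dpoly_eval \<delta> w Q' \<noteq> 0 \<and> g w = dpoly_eval \<delta> w P' / dpoly_eval \<delta> w Q'"
    by (rule regular_functionE[OF g x])
  note N = F[OF f(3,4) g(3,4)]
  show "\<exists>W. openin (kolchin_on \<Delta> \<delta> n X) W \<and> x \<in> W \<and>
    (\<exists>P \<in> dpolys \<Delta> n. \<exists>Q \<in> dpolys \<Delta> n.
      \<forall>w\<in>W. dpoly_eval \<delta> w Q \<noteq> 0 \<and> F (f w) (g w) = dpoly_eval \<delta> w P / dpoly_eval \<delta> w Q)"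
  proof (rule exI[of _ "W \<inter> W'"], rule conjI[rotated], rule conjI[rotated],
      rule bexI[OF bexI[OF _ dpolys_mult[OF f(4) g(4)]] conjunct1[OF N]])
    show "openin (kolchin_on \<Delta> \<delta> n X) (W \<inter> W')" "x \<in> W \<inter> W'"
      using openin_Int[OF f(1) g(1)] f(2) g(2) by simp_all
    show "\<forall>w\<in>W \<inter> W'. dpoly_eval \<delta> w (Q * Q') \<noteq> 0 \<and>
        F (f w) (g w) = dpoly_eval \<delta> w (N P Q P' Q') / dpoly_eval \<delta> w (Q * Q')"
    proof
      fix w assume "w \<in> W \<inter> W'"
      then have "w \<in> W" "w \<in> W'" by auto
      note fw = bspec[OF f(5) this(1)] and gw = bspec[OF g(5) this(2)]
      show "dpoly_eval \<delta> w (Q * Q') \<noteq> 0 \<and>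
          F (f w) (g w) = dpoly_eval \<delta> w (N P Q P' Q') / dpoly_eval \<delta> w (Q * Q')"
        unfolding dpoly_eval_mult conjunct2[OF fw] conjunct2[OF gw]
        using conjunct2[OF N] fw gw by simp
    qed
  qed
qed

lemma regular_function_add:
  assumes "regular_function \<Delta> \<delta> n X f" "regular_function \<Delta> \<delta> n X g"
  shows "regular_function \<Delta> \<delta> n X (\<lambda>x. f x + g x)"
  by (rule regular_function_binary[OF assms, where N = "\<lambda>P Q P' Q'. P * Q' + P' * Q"])
    (simp add: dpoly_eval_add dpoly_eval_mult add_frac_eq dpolys_closed(5,6))

lemma regular_function_mult:
  assumes "regular_function \<Delta> \<delta> n X f" "regular_function \<Delta> \<delta> n X g"
  shows "regular_function \<Delta> \<delta> n X (\<lambda>x. f x * g x)"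
  by (rule regular_function_binary[OF assms, where N = "\<lambda>P Q P' Q'. P * P'"])
    (simp add: dpoly_eval_mult dpolys_mult)

lemma regular_function_deriv:
  assumes K: "differential_field \<Delta> \<delta>" and j: "j \<in> \<Delta>" and f: "regular_function \<Delta> \<delta> n X f"
  shows "regular_function \<Delta> \<delta> n X (\<lambda>x. \<delta> j (f x))"
proof (rule regular_functionI)
  fix x assume x: "x \<in> X"
  obtain W P Q where f: "openin (kolchin_on \<Delta> \<delta> n X) W" "x \<in> W" "P \<in> dpolys \<Delta> n" "Q \<in> dpolys \<Delta> n"
    "\<forall>w\<in>W. dpoly_eval \<delta> w Q \<noteq> 0 \<and> f w = dpoly_eval \<delta> w P / dpoly_eval \<delta> w Q"
    by (rule regular_functionE[OF f x])
  have quot: "\<delta> j (p / q) = (\<delta> j p * q - p * \<delta> j q) / (q * q)" if "q \<noteq> 0" for p q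
  proof -
    have "\<delta> j p = \<delta> j (p / q * q)" using that by simp
    also have "\<dots> = \<delta> j (p / q) * q + p / q * \<delta> j q" by (rule differential_fieldD(2)[OF K j])
    finally show ?thesis using that by (simp add: field_simps)
  qed
  show "\<exists>W. openin (kolchin_on \<Delta> \<delta> n X) W \<and> x \<in> W \<and>
    (\<exists>P \<in> dpolys \<Delta> n. \<exists>Q \<in> dpolys \<Delta> n.
      \<forall>w\<in>W. dpoly_eval \<delta> w Q \<noteq> 0 \<and> \<delta> j (f w) = dpoly_eval \<delta> w P / dpoly_eval \<delta> w Q)"
  proof (rule exI[of _ "W"], rule conjI[rotated], rule conjI[rotated],
      rule bexI[of _ "dpoly_deriv \<delta> j P * Q - P * dpoly_deriv \<delta> j Q"], rule bexI[of _ "Q * Q"])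
    show "openin (kolchin_on \<Delta> \<delta> n X) (W)" "x \<in> W" by (rule f)+
    show "dpoly_deriv \<delta> j P * Q - P * dpoly_deriv \<delta> j Q \<in> dpolys \<Delta> n" 
      using f(3,4) dpoly_deriv_dpolys[OF K j f(3)] dpoly_deriv_dpolys[OF K j f(4)]
      by (intro dpolys_closed(3,6))
    show "Q * Q \<in> dpolys \<Delta> n" 
      using f(4) by (intro dpolys_closed(6))
    show "\<forall>w\<in>W. dpoly_eval \<delta> w (Q * Q) \<noteq> 0 \<and> \<delta> j (f w) = dpoly_eval \<delta> w (dpoly_deriv \<delta> j P * Q - P * dpoly_deriv \<delta> j Q) / dpoly_eval \<delta> w (Q * Q)"
    proof
      fix w assume w: "w \<in> W"
      note fw = bspec[OF f(5) w]
      show "dpoly_eval \<delta> w (Q * Q) \<noteq> 0 \<and> \<delta> j (f w) =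
          dpoly_eval \<delta> w (dpoly_deriv \<delta> j P * Q - P * dpoly_deriv \<delta> j Q) / dpoly_eval \<delta> w (Q * Q)"
        unfolding dpoly_eval_mult dpoly_eval_diff dpoly_eval_deriv[OF K j f(3)]
          dpoly_eval_deriv[OF K j f(4)] conjunct2[OF fw] quot[OF conjunct1[OF fw]]
        using fw by simp
    qed
  qed
qed

lemma regular_function_ders:
  assumes K: "differential_field \<Delta> \<delta>" and f: "regular_function \<Delta> \<delta> n X f" and \<theta>: "set_mset \<theta> \<subseteq> \<Delta>"
  shows "regular_function \<Delta> \<delta> n X (\<lambda>x. ders \<delta> \<theta> (f x))"
  using \<theta>
proof (induction \<theta>)
  case (add j \<theta>)
  then have "regular_function \<Delta> \<delta> n X (\<lambda>x. \<delta> j (ders \<delta> \<theta> (f x)))"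
    using regular_function_deriv[OF K] by simp
  then show ?case using add.prems by (simp add: ders_add_mset[OF K])
qed (simp add: f)

lemma regular_function_compose:
  assumes K: "differential_field \<Delta> \<delta>" and X: "X \<subseteq> points n UNIV" and G: "G \<in> dpolys \<Delta> N"
    and z: "\<And>i. i < N \<Longrightarrow> regular_function \<Delta> \<delta> n X (\<lambda>x. z x i)"
  shows "regular_function \<Delta> \<delta> n X (\<lambda>x. dpoly_eval \<delta> (z x) G)"
  using G
proof (induction rule: dpolys_induct)
  case (const c)
  show ?case by (rule regular_function_dpoly[OF X, of "pconst c"]) auto
next
  case (var i \<theta>)
  then show ?case using regular_function_ders[OF K z] by simp
qed (simp_all add: dpoly_eval_add dpoly_eval_mult regular_function_add regular_function_mult)

section \<open>Open sets and irreducibility in terms of regular functions\<close>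

lemma openin_kolchin_nonzero:
  "P \<in> dpolys \<Delta> n \<Longrightarrow> openin (kolchin \<Delta> \<delta> n) (points n UNIV - zeros \<delta> n {P})"
  unfolding openin_kolchin by (intro exI[of _ "{P}"]) auto

lemma openin_regular_nonzero:
  assumes X: "X \<subseteq> points n UNIV" and f: "regular_function \<Delta> \<delta> n X f"
  shows "openin (kolchin_on \<Delta> \<delta> n X) {x \<in> X. f x \<noteq> 0}"
proof (subst openin_subopen, intro ballI)
  fix x assume x: "x \<in> {x \<in> X. f x \<noteq> 0}"
  obtain W P Q where f: "openin (kolchin_on \<Delta> \<delta> n X) W" "x \<in> W" "P \<in> dpolys \<Delta> n" "Q \<in> dpolys \<Delta> n"
    "\<forall>w\<in>W. dpoly_eval \<delta> w Q \<noteq> 0 \<and> f w = dpoly_eval \<delta> w P / dpoly_eval \<delta> w Q"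
    by (rule regular_functionE[OF f CollectD[OF x, THEN conjunct1]])
  have WX: "W \<subseteq> X" using openin_subset[OF f(1)] by simp
  let ?V = "W \<inter> (X \<inter> (points n UNIV - zeros \<delta> n {P}))"
  have "openin (kolchin_on \<Delta> \<delta> n X) ?V"
    by (intro openin_Int f(1) openin_subtopology_Int2 openin_kolchin_nonzero f(3))
  moreover have "x \<in> ?V" using x f X by (auto simp: zeros_def)
  moreover have "?V \<subseteq> {x \<in> X. f x \<noteq> 0}" using f X by (auto simp: zeros_def)
  ultimately show "\<exists>T. openin (kolchin_on \<Delta> \<delta> n X) T \<and> x \<in> T \<and> T \<subseteq> {x \<in> X. f x \<noteq> 0}" by blast
qed

text \<open>The two zero sets are closed and cover \<open>X\<close>, so one of them is all of
  \<open>X\<close>.\<close>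

lemma irreducible_regular_mult:
  assumes X: "X \<subseteq> points n UNIV" "irreducible_space (kolchin_on \<Delta> \<delta> n X)"
    and f: "regular_function \<Delta> \<delta> n X f" and g: "regular_function \<Delta> \<delta> n X g"
    and fg: "\<And>x. x \<in> X \<Longrightarrow> f x * g x = 0"
  shows "(\<forall>x\<in>X. f x = 0) \<or> (\<forall>x\<in>X. g x = 0)"
proof -
  have top: "topspace (kolchin_on \<Delta> \<delta> n X) = X" using X(1) by auto
  have cl: "closedin (kolchin_on \<Delta> \<delta> n X) {x \<in> X. f x = 0}"
    if "regular_function \<Delta> \<delta> n X f" for f
  proof -
    have "X - {x \<in> X. f x = 0} = {x \<in> X. f x \<noteq> 0}" by blast
    then show ?thesis using openin_regular_nonzero[OF X(1) that] unfolding closedin_def top by simp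
  qed
  have "{x \<in> X. f x = 0} \<union> {x \<in> X. g x = 0} = X" using fg by auto
  then have "{x \<in> X. f x = 0} = X \<or> {x \<in> X. g x = 0} = X"
    using X(2) cl[OF f] cl[OF g] unfolding irreducible_space_def top by blast
  then show ?thesis by blast
qed

lemma dpoly_eval_ders:
  fixes P :: "('d, 'a::field) dpoly"
  assumes K: "differential_field \<Delta> \<delta>" and P: "P \<in> dpolys \<Delta> n" and \<theta>: "set_mset \<theta> \<subseteq> \<Delta>"
  shows "ders (dpoly_deriv \<delta>) \<theta> P \<in> dpolys \<Delta> n \<and>
    dpoly_eval \<delta> x (ders (dpoly_deriv \<delta>) \<theta> P) = ders \<delta> \<theta> (dpoly_eval \<delta> x P)"
  using \<theta>
proof (induction \<theta>)
  case (add j \<theta>)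
  then show ?case
    using dpoly_deriv_dpolys[OF K] dpoly_eval_deriv[OF K, of j _ n x]
    by (simp add: ders_dpoly_deriv[OF K] ders_add_mset[OF K])
qed (simp add: P)

lemma ders_0: "differential_field \<Delta> \<delta> \<Longrightarrow> set_mset \<theta> \<subseteq> \<Delta> \<Longrightarrow> ders \<delta> \<theta> 0 = (0 :: 'a::field)"
  by (induction \<theta>) (auto simp: ders_add_mset differential_fieldD(4))

section \<open>The graph of a dominant morphism\<close>

locale dominant_morphism =
  fixes \<Delta> :: "'d set" and \<delta> :: "'d \<Rightarrow> 'a::field_char_0 \<Rightarrow> 'a"
    and n m :: nat and X Y :: "(nat \<Rightarrow> 'a) set" and \<phi> :: "(nat \<Rightarrow> 'a) \<Rightarrow> (nat \<Rightarrow> 'a)"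
  assumes dc: "differentially_closed \<Delta> \<delta>"
    and X: "differential_variety \<Delta> \<delta> n X" and irr: "irreducible_space (kolchin_on \<Delta> \<delta> n X)"
    and Y: "differential_variety \<Delta> \<delta> m Y"
    and mor: "morphism \<Delta> \<delta> n X m Y \<phi>" and dom: "dominant \<Delta> \<delta> X m Y \<phi>"
begin

lemma K: "differential_field \<Delta> \<delta>"
  using dc by (simp add: differentially_closed_def)

lemma X_points: "X \<subseteq> points n UNIV" and Y_points: "Y \<subseteq> points m UNIV"
  using X Y by (auto simp: differential_variety_def zeros_def)

lemma X_ne: "X \<noteq> {}"
  using irr X_points by (auto simp: irreducible_space_def)

abbreviation ev :: "(nat \<Rightarrow> 'a) \<Rightarrow> ('d, 'a) dpoly \<Rightarrow> 'a" where "ev \<equiv> dpoly_eval \<delta>"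

text \<open>The coordinates of \<open>y\<close> come first, so \<open>dpolys \<Delta> m\<close> is
  the ring of the parameters of the elimination.\<close>

definition graph :: "(nat \<Rightarrow> 'a) \<Rightarrow> nat \<Rightarrow> 'a" where
  "graph x i = (if i < m then \<phi> x i else x (i - m))"

abbreviation (input) "graph_polys \<equiv> dpolys \<Delta> (m + n)"

definition graph_ideal :: "('d, 'a) dpoly set" where
  "graph_ideal = {G \<in> graph_polys. \<forall>x\<in>X. ev (graph x) G = 0}"

lemma regular_graph:
  assumes "G \<in> graph_polys"
  shows "regular_function \<Delta> \<delta> n X (\<lambda>x. ev (graph x) G)"
proof (rule regular_function_compose[OF K X_points assms])
  fix i assume i: "i < m + n"
  show "regular_function \<Delta> \<delta> n X (\<lambda>x. graph x i)"
  proof (cases "i < m")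
    case True
    then show ?thesis using mor by (simp add: morphism_def graph_def)
  next
    case False
    then show ?thesis
      by (intro regular_function_dpoly[OF X_points, of "pvar (i - m, {#})"])
        (use i in \<open>auto simp: graph_def intro: dpolys_var\<close>)
  qed
qed

text \<open>Along the graph, differential polynomials become regular functions on \<open>X\<close>,
  and irreducibility forbids zero divisors among these.\<close>

lemma prime_graph_ideal: "prime_in (graph_polys) graph_ideal"
  unfolding prime_in_def
proof (intro conjI ballI impI)
  show "1 \<notin> graph_ideal" using X_ne by (auto simp: graph_ideal_def)
  fix f g assume fg: "f \<in> graph_polys" "g \<in> graph_polys" "f * g \<in> graph_ideal"
  have "(\<forall>x\<in>X. ev (graph x) f = 0) \<or> (\<forall>x\<in>X. ev (graph x) g = 0)"
    by (rule irreducible_regular_mult[OF X_points irr regular_graph[OF fg(1)] regular_graph[OF fg(2)]])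
      (use fg(3) in \<open>auto simp: graph_ideal_def dpoly_eval_mult\<close>)
  then show "f \<in> graph_ideal \<or> g \<in> graph_ideal" using fg by (auto simp: graph_ideal_def)
qed (auto simp: graph_ideal_def dpoly_eval_add dpoly_eval_mult intro: dpolys_closed)

lemma graph_ideal_deriv: "j \<in> \<Delta> \<Longrightarrow> G \<in> graph_ideal \<Longrightarrow> dpoly_deriv \<delta> j G \<in> graph_ideal"
  using dpoly_deriv_dpolys[OF K] dpoly_eval_deriv[OF K] differential_fieldD(4)[OF K]
  by (auto simp: graph_ideal_def)

lemma graph_ideal_vanishes_Y:
  assumes G: "G \<in> graph_ideal" "G \<in> dpolys \<Delta> m" and y: "y \<in> Y"
  shows "ev y G = 0"
proof -
  have "ev (\<phi> x) G = 0" if "x \<in> X" for x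
  proof -
    have "ev (\<phi> x) G = ev (graph x) G"
      by (rule dpoly_eval_cong[OF G(2)]) (simp add: graph_def)
    then show ?thesis using G(1) that by (simp add: graph_ideal_def)
  qed
  moreover have "\<phi> ` X \<subseteq> Y" using mor by (auto simp: morphism_def)
  ultimately have "\<phi> ` X \<subseteq> zeros \<delta> m {G} \<inter> Y" using Y_points by (auto simp: zeros_def)
  moreover have "closedin (kolchin_on \<Delta> \<delta> m Y) (zeros \<delta> m {G} \<inter> Y)"
    unfolding closedin_subtopology closedin_kolchin using G(2)
    by (intro exI[of _ "zeros \<delta> m {G}"] conjI refl exI[of _ "{G}"]) auto
  ultimately have "kolchin_on \<Delta> \<delta> m Y closure_of (\<phi> ` X) \<subseteq> zeros \<delta> m {G} \<inter> Y"
    by (rule closure_of_minimal)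
  then have "y \<in> zeros \<delta> m {G}" using dom y by (auto simp: dominant_def)
  then show ?thesis by (simp add: zeros_def)
qed

text \<open>The equations of \<open>X\<close> belong to the ideal, which places \<open>x\<close> in
  \<open>X\<close>. For the values of \<open>\<phi>\<close>, a local quotient near \<open>x\<close>
  is turned into an equation valid on the whole graph.\<close>

lemma graph_ideal_point:
  assumes w: "\<And>G. G \<in> graph_ideal \<Longrightarrow> ev w G = 0"
  defines "x \<equiv> \<lambda>i\<in>{..<n}. w (m + i)"
  shows "x \<in> X" "i < m \<Longrightarrow> \<phi> x i = w i"
proof -
  have shift: "ev (\<lambda>i. w (m + i)) Q = ev x Q" if "Q \<in> dpolys \<Delta> n" for Q
    by (rule dpoly_eval_cong[OF that]) (simp add: x_def)
  have graph: "ev (\<lambda>i. graph y (m + i)) Q = ev y Q" if "Q \<in> dpolys \<Delta> n" for Q y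
    by (simp add: graph_def)
  obtain I where I: "I \<subseteq> dpolys \<Delta> n" "X = zeros \<delta> n I"
    using X by (auto simp: differential_variety_def differential_ideal_def)
  have "ev x Q = 0" if Q: "Q \<in> I" for Q
  proof -
    have Qn: "Q \<in> dpolys \<Delta> n" using Q I(1) by blast
    obtain Q' where Q': "Q' \<in> graph_polys"
      "\<forall>w. ev w Q' = ev (\<lambda>i. w (m + i)) Q"
      by (rule bexE[OF dpoly_shift[OF Qn]])
    have "ev (graph y) Q' = 0" if "y \<in> X" for y
      using that Q unfolding Q'(2)[rule_format] graph[OF Qn] I(2) zeros_def by blast
    then have "Q' \<in> graph_ideal" using Q'(1) by (simp add: graph_ideal_def)
    from w[OF this] show ?thesis unfolding Q'(2)[rule_format] shift[OF Qn] .
  qed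
  moreover have "x \<in> points n UNIV" by (simp add: points_def x_def)
  ultimately show xX: "x \<in> X" unfolding I(2) zeros_def by blast
  assume i: "i < m"
  have "regular_function \<Delta> \<delta> n X (\<lambda>x. \<phi> x i)" using mor i by (simp add: morphism_def)
  from regular_functionE[OF this xX] obtain W P Q where
    f: "openin (kolchin_on \<Delta> \<delta> n X) W" "x \<in> W" "P \<in> dpolys \<Delta> n" "Q \<in> dpolys \<Delta> n"
    "\<forall>w\<in>W. ev w Q \<noteq> 0 \<and> \<phi> w i = ev w P / ev w Q" .
  obtain S where S: "S \<subseteq> dpolys \<Delta> n" "W = (points n UNIV - zeros \<delta> n S) \<inter> X"
    using f(1) unfolding openin_subtopology openin_kolchin by blast
  obtain s where s: "s \<in> S" "ev x s \<noteq> 0"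
    using f(2) unfolding S(2) zeros_def by blast
  have sn: "s \<in> dpolys \<Delta> n" using s S by blast
  obtain s' where s': "s' \<in> graph_polys"
    "\<forall>w. ev w s' = ev (\<lambda>i. w (m + i)) s"
      by (rule bexE[OF dpoly_shift[OF sn]])
  obtain P' where P': "P' \<in> graph_polys"
    "\<forall>w. ev w P' = ev (\<lambda>i. w (m + i)) P"
      by (rule bexE[OF dpoly_shift[OF f(3)]])
  obtain Q' where Q': "Q' \<in> graph_polys"
    "\<forall>w. ev w Q' = ev (\<lambda>i. w (m + i)) Q"
      by (rule bexE[OF dpoly_shift[OF f(4)]])
  \<comment> \<open>The cleared equation \<open>Q * y_i = P\<close> holds only over
    \<open>W\<close>; the factor \<open>s\<close> vanishes on the rest of \<open>X\<close> but not
    at \<open>x\<close>.\<close>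
  define H where "H = s' * (Q' * pvar (i, {#}) - P')"
  have H: "ev u H = ev (\<lambda>i. u (m + i)) s *
      (ev (\<lambda>i. u (m + i)) Q * u i - ev (\<lambda>i. u (m + i)) P)" for u
    by (simp add: H_def dpoly_eval_mult dpoly_eval_diff s'(2)[rule_format] P'(2)[rule_format] Q'(2)[rule_format])
  have "pvar (i, {#}) \<in> graph_polys" using i by (intro dpolys_var) auto
  then have Hn: "H \<in> graph_polys" unfolding H_def using s'(1) P'(1) Q'(1) by (intro dpolys_closed)
  have "ev (graph y) H = 0" if y: "y \<in> X" for y
  proof (cases "ev y s = 0")
    case True
    then show ?thesis unfolding H graph[OF sn] by simp
  next
    case False
    then have yW: "y \<in> W" using y s(1) X_points unfolding S(2) zeros_def by blast
    have "graph y i = \<phi> y i" using i by (simp add: graph_def)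
    then show ?thesis unfolding H graph[OF f(3)] graph[OF f(4)] using f(5) yW by simp
  qed
  then have "H \<in> graph_ideal" using Hn by (simp add: graph_ideal_def)
  from w[OF this] have "ev x s * (ev x Q * w i - ev x P) = 0"
    unfolding H shift[OF sn] shift[OF f(3)] shift[OF f(4)] .
  then show "\<phi> x i = w i" using s(2) f(2,5) by (simp add: field_simps)
qed

text \<open>
  A point over the algebraic closure only yields a prime ideal. The largest differential ideal inside
  it is prime too, and its residue field gives a differential solution, hence one over \<open>K\<close>.
\<close>

lemma lift_ring_point:
  fixes t :: "'d dvar \<Rightarrow> 'a alg_closure"
  assumes P: "\<And>G. G \<in> graph_ideal \<Longrightarrow> pev to_ac t G = 0"
    and y: "\<And>i \<theta>. i < m \<Longrightarrow> set_mset \<theta> \<subseteq> \<Delta> \<Longrightarrow> t (i, \<theta>) = to_ac (ders \<delta> \<theta> (y i))"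
    and F: "finite F" "F \<subseteq> graph_ideal" and G: "finite G" "G \<subseteq> graph_polys"
      "\<And>Q. Q \<in> G \<Longrightarrow> pev to_ac t Q \<noteq> 0"
  obtains w where "\<And>i. i < m \<Longrightarrow> w i = y i" "\<And>Q. Q \<in> F \<Longrightarrow> ev w Q = 0"
    "\<And>Q. Q \<in> G \<Longrightarrow> ev w Q \<noteq> 0"
proof -
  have h: "rhom (to_ac :: 'a \<Rightarrow> 'a alg_closure)" by (simp add: rhom_def)
  note hom = rhomD[OF rhom_pev[OF h, of t]]
  define p where "p = {Q \<in> graph_polys. pev to_ac t Q = 0}"
  have p: "prime_in graph_polys p"
    unfolding prime_in_def p_def by (auto simp: hom intro: dpolys_closed)
  \<comment> \<open>Prescribes all derivatives of \<open>y\<close>. These are genuine derivatives,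
    so \<open>A\<close> is stable under the derivations and, like the graph ideal, survives in the
    prime differential ideal \<open>q\<close>.\<close>
  define A where "A = (\<lambda>(i, \<theta>). pvar (i, \<theta>) - pconst (ders \<delta> \<theta> (y i))) ` dvars \<Delta> m"
  have Ap: "A \<subseteq> p"
    unfolding A_def p_def by (auto simp: hom h y dvars_def intro!: dpolys_closed dpolys_var)
  have AD: "dpoly_deriv \<delta> j a \<in> A" if j: "j \<in> \<Delta>" and a: "a \<in> A" for j a
  proof -
    obtain i \<theta> where i: "(i, \<theta>) \<in> dvars \<Delta> m" "a = pvar (i, \<theta>) - pconst (ders \<delta> \<theta> (y i))"
      using a by (auto simp: A_def)
    have "dpoly_deriv \<delta> j a = pvar (i, add_mset j \<theta>) - pconst (ders \<delta> (add_mset j \<theta>) (y i))"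
      using i j by (simp add: derivationD(6)[OF derivation_dpoly_deriv[OF K j]] dpoly_deriv_var[OF K j]
        dpoly_deriv_const[OF K j] ders_add_mset[OF K] dvars_def)
    moreover have "(i, add_mset j \<theta>) \<in> dvars \<Delta> m" using i(1) j by (simp add: dvars_def)
    ultimately show ?thesis unfolding A_def by (intro image_eqI[of _ _ "(i, add_mset j \<theta>)"]) auto
  qed
  have Gp: "graph_ideal \<subseteq> p" using P by (auto simp: p_def graph_ideal_def)
  have "\<exists>q. prime_in graph_polys q \<and> q \<subseteq> p \<and> graph_ideal \<union> A \<subseteq> q \<and> (\<forall>j\<in>\<Delta>. \<forall>a\<in>q. dpoly_deriv \<delta> j a \<in> q)"
  proof (rule prime_differential_ideal_below[where \<Delta> = \<Delta> and D = "dpoly_deriv \<delta>"])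
    show "finite \<Delta>" using K by (simp add: differential_field_def)
    show "subring_set graph_polys" by (rule subring_set_dpolys)
    show "\<exists>c\<in>graph_polys. c * of_nat k = (1 :: ('d, 'a) dpoly)" if "0 < k" for k
      using that by (intro bexI[of _ "pconst (1 / of_nat k)"])
        (simp_all add: pconst_of_nat[symmetric] pconst_mult[symmetric])
    show "derivation (dpoly_deriv \<delta> j)" if "j \<in> \<Delta>" for j by (rule derivation_dpoly_deriv[OF K that])
    show "dpoly_deriv \<delta> j a \<in> graph_polys" if "j \<in> \<Delta>" "a \<in> graph_polys" for j a by (rule dpoly_deriv_dpolys[OF K that])
    show "dpoly_deriv \<delta> i (dpoly_deriv \<delta> j a) = dpoly_deriv \<delta> j (dpoly_deriv \<delta> i a)"
      if "i \<in> \<Delta>" "j \<in> \<Delta>" for i j a by (rule dpoly_deriv_commute[OF K that])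
    show "prime_in graph_polys p" by (rule p)
    show "graph_ideal \<union> A \<subseteq> p" using Gp Ap by blast
    show "dpoly_deriv \<delta> j a \<in> graph_ideal \<union> A" if "j \<in> \<Delta>" "a \<in> graph_ideal \<union> A" for j a
      using AD graph_ideal_deriv that by blast
    fix q assume "prime_in graph_polys q" "q \<subseteq> p" "graph_ideal \<union> A \<subseteq> q"
      "\<And>j a. j \<in> \<Delta> \<Longrightarrow> a \<in> q \<Longrightarrow> dpoly_deriv \<delta> j a \<in> q"
    then show "\<exists>q. prime_in graph_polys q \<and> q \<subseteq> p \<and> graph_ideal \<union> A \<subseteq> q \<and> (\<forall>j\<in>\<Delta>. \<forall>a\<in>q. dpoly_deriv \<delta> j a \<in> q)"
      by (intro exI[of _ q] conjI ballI)
  qed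
  then obtain q where q: "prime_in graph_polys q" "q \<subseteq> p" "graph_ideal \<union> A \<subseteq> q"
    "\<And>j a. j \<in> \<Delta> \<Longrightarrow> a \<in> q \<Longrightarrow> dpoly_deriv \<delta> j a \<in> q"
    by (elim exE conjE) simp
  \<comment> \<open>Finitely many equations suffice: once \<open>w\<close> agrees with
    \<open>y\<close> in order zero, the derivatives agree as well.\<close>
  define F' where "F' = F \<union> (\<lambda>i. pvar (i, {#}) - pconst (y i)) ` {..<m}"
  have "(\<lambda>i. pvar (i, {#}) - pconst (y i)) ` {..<m} \<subseteq> A"
    unfolding A_def by (auto intro!: image_eqI[of _ _ "(_, {#})"] simp: dvars_def)
  then have F': "finite F'" "F' \<subseteq> q" using F q(3) by (auto simp: F'_def)
  have G': "G \<subseteq> graph_polys - q" using G(2,3) q(2) by (auto simp: p_def)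
  have "\<exists>w. (\<forall>Q\<in>F'. ev w Q = 0) \<and> (\<forall>Q\<in>G. ev w Q \<noteq> 0)"
  proof (rule differentially_closed_solution[OF dc q(1,4) F' G(1) G'])
    fix w assume "\<And>Q. Q \<in> F' \<Longrightarrow> ev w Q = 0" "\<And>Q. Q \<in> G \<Longrightarrow> ev w Q \<noteq> 0"
    then show "\<exists>w. (\<forall>Q\<in>F'. ev w Q = 0) \<and> (\<forall>Q\<in>G. ev w Q \<noteq> 0)"
      by (intro exI[of _ w] conjI ballI)
  qed
  then obtain w where w: "\<forall>Q\<in>F'. ev w Q = 0" "\<forall>Q\<in>G. ev w Q \<noteq> 0"
    by (elim exE conjE)
  show thesis
  proof (rule that)
    show "w i = y i" if "i < m" for i
    proof -
      have "pvar (i, {#}) - pconst (y i) \<in> F'" using that by (auto simp: F'_def)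
      from bspec[OF w(1) this] show ?thesis by (simp add: dpoly_eval_diff)
    qed
    show "ev w Q = 0" if "Q \<in> F" for Q using w(1) that by (simp add: F'_def)
    show "ev w Q \<noteq> 0" if "Q \<in> G" for Q using w(2) that by simp
  qed
qed

abbreviation (input) "attained f b y \<equiv> \<exists>x\<in>X. ev (graph x) f \<noteq> 0 \<and> ev x b \<noteq> 0 \<and> \<phi> x = y"

text \<open>\<open>f\<close> is the product of the initials and separants of \<open>Mn\<close>, so
  it depends on neither \<open>b\<close> nor \<open>y\<close>. Membership of \<open>y\<close> in the
  image is translated into the existence of a regular point over the algebraic closure, to which
  \<open>eliminate\<close> applies.\<close>

lemma generic_openness:
  obtains f where "f \<in> graph_polys" "f \<notin> graph_ideal"
    "\<And>b. b \<in> dpolys \<Delta> n \<Longrightarrow> \<exists>As \<subseteq> dpolys \<Delta> m. \<forall>y\<in>Y.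
      attained f b y \<longleftrightarrow>
      (\<exists>a\<in>As. ev y a \<noteq> 0)"
proof -
  obtain key :: "'d dvar \<Rightarrow> nat multiset" and L Mn pp where
    ri: "ranked_ideal (dvars \<Delta> (m + n)) (dvars \<Delta> m) key graph_ideal L Mn pp" and
    nz: "\<And>u. u \<in> Mn \<Longrightarrow> lead_coeff (pp u) * poly (formal_deriv (pp u)) (pvar u) \<notin> graph_ideal" and
    derived: "\<And>v. v \<in> L - Mn \<Longrightarrow> \<exists>u\<in>Mn. \<exists>\<theta>. set_mset \<theta> \<subseteq> \<Delta> \<and>
      poly (pp v) (pvar v) = ders (dpoly_deriv \<delta>) \<theta> (poly (pp u) (pvar u))"
    by (rule prime_differential_ideal_ranked[OF K prime_graph_ideal graph_ideal_deriv, of m]) auto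
  interpret R: ranked_ideal "dvars \<Delta> (m + n)" "dvars \<Delta> m" key graph_ideal L Mn pp
    "\<lambda>v. dvars \<Delta> m \<union> {w \<in> dvars \<Delta> (m + n). key w < key v}" "\<lambda>v. lead_coeff (pp v)"
    "\<lambda>v. poly (formal_deriv (pp v)) (pvar v)"
    by (rule ri | rule reflexive)+
  define sp where "sp = (\<lambda>u. lead_coeff (pp u) * poly (formal_deriv (pp u)) (pvar u))"
  have sp_in: "sp u \<in> graph_polys" if u: "u \<in> Mn" for u
  proof -
    have uL: "u \<in> L" using u R.MnL by blast
    then have "u \<in> dvars \<Delta> (m + n)" using R.LW by blast
    then have "insert u (dvars \<Delta> m \<union> {w \<in> dvars \<Delta> (m + n). key w < key u}) \<subseteq> dvars \<Delta> (m + n)"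
      using R.YW by auto
    then show ?thesis unfolding sp_def dpolys_eq_pvars
      using pvars_mono[OF R.init_below[OF uL]] pvars_mono[OF R.sep_in[OF uL]] by (intro pvars_mult) auto
  qed
  define f where "f = (\<Prod>u\<in>Mn. sp u)"
  have f_eval: "ev z f \<noteq> 0 \<longleftrightarrow> (\<forall>u\<in>Mn. ev z (sp u) \<noteq> 0)" for z
    using R.fin by (simp add: f_def dpoly_eval_prod)
  have sp_notin: "sp u \<notin> graph_ideal" if "u \<in> Mn" for u
    using nz[OF that] by (simp add: sp_def)
  have f: "f \<in> graph_polys \<and> f \<notin> graph_ideal"
    unfolding f_def using R.fin sp_notin sp_in
  proof (induction Mn rule: finite_induct)
    case empty
    then show ?case using prime_inD(3)[OF prime_graph_ideal] by simp
  next
    case (insert u A)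
    have u: "sp u \<in> graph_polys" "sp u \<notin> graph_ideal" using insert.prems by blast+
    have A: "prod sp A \<in> graph_polys" "prod sp A \<notin> graph_ideal"
      using insert.IH insert.prems by blast+
    show ?case
      unfolding prod.insert[OF insert.hyps]
      using u A prime_inD(6)[OF prime_graph_ideal _ u(1) A(1)] dpolys_closed(6)[OF u(1) A(1)] by blast
  qed
  have main: "\<exists>As \<subseteq> dpolys \<Delta> m. \<forall>y\<in>Y.
      attained f b y \<longleftrightarrow>
      (\<exists>a\<in>As. ev y a \<noteq> 0)" if b: "b \<in> dpolys \<Delta> n" for b
  proof -
    obtain b' where b': "b' \<in> graph_polys"
      "\<forall>w. ev w b' = ev (\<lambda>i. w (m + i)) b"
      by (rule bexE[OF dpoly_shift[OF b]])
    have b'_graph: "ev (graph x) b' = ev x b" for x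
      unfolding b'(2)[rule_format] by (simp add: graph_def)
    have h: "rhom (to_ac :: 'a \<Rightarrow> 'a alg_closure)" by (simp add: rhom_def)
    obtain As where As: "R.projects TYPE('a alg_closure) (dvars \<Delta> m) (dvars \<Delta> (m + n)) b' As"
      using R.eliminate[OF b'(1)[unfolded dpolys_eq_pvars]] by blast
    define T where "T = (\<lambda>(z :: nat \<Rightarrow> 'a) (i, \<theta>). to_ac (ders \<delta> \<theta> (z i)))"
    have T: "pev to_ac (T z) Q = to_ac (ev z Q)" for z Q
      unfolding dpoly_eval_eq_pev pev_comp[OF h, symmetric] T_def case_prod_unfold by simp
    show ?thesis
    proof (intro exI[of _ As] conjI ballI)
      show "As \<subseteq> dpolys \<Delta> m" using R.projectsD(2)[OF As] by (simp add: dpolys_eq_pvars)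
      fix y assume y: "y \<in> Y"
      \<comment> \<open>No element of \<open>Mn\<close> is a parameter, so over the parameters
        regularity is only the vanishing of the graph ideal on \<open>Y\<close>.\<close>
      have reg: "R.regular_point to_ac (dvars \<Delta> m) (T y)"
        unfolding R.regular_point_def R.vanish_def
        using graph_ideal_vanishes_Y[OF _ _ y] R.MnL R.LW by (auto simp: T dpolys_eq_pvars)
      have "attained f b y \<longleftrightarrow>
        (\<exists>t. (\<forall>w\<in>dvars \<Delta> m. t w = T y w) \<and> R.regular_point to_ac (dvars \<Delta> (m + n)) t \<and> pev to_ac t b' \<noteq> 0)"
        (is "?l \<longleftrightarrow> ?r")
      proof
        assume ?l
        then obtain x where x: "x \<in> X" "ev (graph x) f \<noteq> 0" "ev x b \<noteq> 0" "\<phi> x = y" by blast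
        show ?r
        proof (intro exI[of _ "T (graph x)"] conjI ballI)
          show "T (graph x) w = T y w" if "w \<in> dvars \<Delta> m" for w
            using that x(4) by (auto simp: T_def dvars_def graph_def)
          show "pev to_ac (T (graph x)) b' \<noteq> 0" using x(3) by (simp add: T b'_graph)
          show "R.regular_point to_ac (dvars \<Delta> (m + n)) (T (graph x))"
            unfolding R.regular_point_def R.vanish_def
            using x(1) x(2)[unfolded f_eval sp_def] by (simp add: T graph_ideal_def)
        qed
      next
        assume ?r
        then obtain t where t: "\<And>w. w \<in> dvars \<Delta> m \<Longrightarrow> t w = T y w"
          "R.regular_point to_ac (dvars \<Delta> (m + n)) t" "pev to_ac t b' \<noteq> 0" by blast
        have "Mn \<subseteq> dvars \<Delta> (m + n)" using R.MnL R.LW by blast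
        then have t_sp: "pev to_ac t (sp u) \<noteq> 0" if "u \<in> Mn" for u
          using t(2) that unfolding R.regular_point_def sp_def by blast
        have t_P: "pev to_ac t Q = 0" if "Q \<in> graph_ideal" for Q
        proof -
          have "Q \<in> pvars (dvars \<Delta> (m + n))"
            using prime_inD(1)[OF prime_graph_ideal that] by (simp add: dpolys_eq_pvars)
          then show ?thesis using t(2) that unfolding R.regular_point_def R.vanish_def by blast
        qed
        \<comment> \<open>Only finitely many conditions can pass through differential closedness:
          the equations of \<open>Mn\<close>, their initials and separants, and
          \<open>b'\<close>.\<close>
        obtain w where w: "\<And>i. i < m \<Longrightarrow> w i = y i"
          "\<And>Q. Q \<in> (\<lambda>u. poly (pp u) (pvar u)) ` Mn \<Longrightarrow> ev w Q = 0"
          "\<And>Q. Q \<in> insert b' (sp ` Mn) \<Longrightarrow> ev w Q \<noteq> 0"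
        proof (rule lift_ring_point[OF t_P])
          show "t (i, \<theta>) = to_ac (ders \<delta> \<theta> (y i))" if "i < m" "set_mset \<theta> \<subseteq> \<Delta>" for i \<theta>
            using t(1)[of "(i, \<theta>)"] that by (simp add: dvars_def T_def)
          show "(\<lambda>u. poly (pp u) (pvar u)) ` Mn \<subseteq> graph_ideal" using R.pp(2) R.MnL by blast
          show "insert b' (sp ` Mn) \<subseteq> graph_polys" using b'(1) sp_in by blast
          show "pev to_ac t Q \<noteq> 0" if "Q \<in> insert b' (sp ` Mn)" for Q using that t(3) t_sp by blast
        qed (use R.fin in auto)
        define s where "s = (\<lambda>(i, \<theta>). ders \<delta> \<theta> (w i))"
        have s: "pev (\<lambda>a. a) s Q = ev w Q" for Q by (simp add: s_def dpoly_eval_eq_pev)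
        have w_sp: "ev w (sp u) \<noteq> 0" if "u \<in> Mn" for u using w(3) that by blast
        \<comment> \<open>The remaining elements of the graph ideal are recovered from these
          conditions, now over \<open>K\<close> and at a differential point.\<close>
        have "R.vanish (\<lambda>a. a) (dvars \<Delta> (m + n)) s"
        proof (rule R.vanish_down[OF rhom_id R.down_W R.down_Y R.YW])
          show "R.vanish (\<lambda>a. a) (dvars \<Delta> m) s"
            unfolding R.vanish_def
          proof
            fix Q assume Q: "Q \<in> graph_ideal \<inter> pvars (dvars \<Delta> m)"
            then have Qm: "Q \<in> dpolys \<Delta> m" by (simp add: dpolys_eq_pvars)
            have "ev w Q = ev y Q" by (rule dpoly_eval_cong[OF Qm w(1)])
            then show "pev (\<lambda>a. a) s Q = 0"
              unfolding s using graph_ideal_vanishes_Y[OF _ Qm y] Q by simp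
          qed
          fix v assume v: "v \<in> L \<inter> dvars \<Delta> (m + n) - dvars \<Delta> m"
          show "pev (\<lambda>a. a) s (lead_coeff (pp v)) \<noteq> 0 \<and> pev (\<lambda>a. a) s (poly (pp v) (pvar v)) = 0"
          proof (cases "v \<in> Mn")
            case True
            then show ?thesis using w(2) w_sp[OF True] by (simp add: s sp_def dpoly_eval_mult)
          next
            case False
            then have v': "v \<in> L - Mn" using v by blast
            obtain u where u: "u \<in> Mn" "lead_coeff (pp v) = poly (formal_deriv (pp u)) (pvar u)"
              using R.derived(2)[OF v'] by blast
            have "ev w (lead_coeff (pp v)) \<noteq> 0"
              using w_sp[OF u(1)] by (simp add: sp_def u(2) dpoly_eval_mult)
            \<comment> \<open>The equation is a derivative of one in \<open>Mn\<close>, so its value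
              at a differential point is a derivative of 0.\<close>
            moreover obtain u' \<theta> where u': "u' \<in> Mn" "set_mset \<theta> \<subseteq> \<Delta>"
              "poly (pp v) (pvar v) = ders (dpoly_deriv \<delta>) \<theta> (poly (pp u') (pvar u'))"
              using derived[OF v'] by blast
            have "poly (pp u') (pvar u') \<in> graph_polys"
              using prime_inD(1)[OF prime_graph_ideal R.pp(2)] u'(1) R.MnL by blast
            then have "ev w (poly (pp v) (pvar v)) = 0"
              using dpoly_eval_ders[OF K _ u'(2)] w(2) u'(1) ders_0[OF K u'(2)] unfolding u'(3) by simp
            ultimately show ?thesis by (simp add: s)
          qed
        qed
        then have wP: "ev w G = 0" if "G \<in> graph_ideal" for G
          using that prime_inD(1)[OF prime_graph_ideal that] unfolding R.vanish_def s dpolys_eq_pvars by blast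
        define x where "x = (\<lambda>i\<in>{..<n}. w (m + i))"
        have xX: "x \<in> X" and \<phi>x: "\<And>i. i < m \<Longrightarrow> \<phi> x i = w i"
          unfolding x_def using graph_ideal_point[OF wP] by blast+
        have "\<phi> x \<in> Y" using mor xX by (auto simp: morphism_def)
        then have "\<phi> x \<in> points m UNIV" "y \<in> points m UNIV" using y Y_points by auto
        then have "\<phi> x = y"
          unfolding points_def by (rule PiE_ext) (simp add: \<phi>x w(1))
        have gw: "ev (graph x) Q = ev w Q" if "Q \<in> graph_polys" for Q
        proof (rule dpoly_eval_cong[OF that])
          fix i assume i: "i < m + n"
          show "graph x i = w i"
          proof (cases "i < m")
            case True
            then show ?thesis unfolding graph_def by (simp add: \<phi>x)
          next
            case False
            then have "i - m < n" using i by linarith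
            then show ?thesis using False by (simp add: graph_def x_def)
          qed
        qed
        have "ev (graph x) f \<noteq> 0"
          unfolding f_eval using gw[OF sp_in] w_sp by simp
        moreover have "ev x b \<noteq> 0"
          using gw[OF b'(1)] w(3)[of b'] by (simp add: b'_graph)
        ultimately show ?l using xX \<open>\<phi> x = y\<close> by blast
      qed
      also have "\<dots> \<longleftrightarrow> (\<exists>a\<in>As. ev y a \<noteq> 0)"
        using R.projectsD(3)[OF As h reg] by (simp add: T)
      finally show "attained f b y \<longleftrightarrow>
        (\<exists>a\<in>As. ev y a \<noteq> 0)" .
    qed
  qed
  show thesis by (rule that[OF conjunct1[OF f] conjunct2[OF f] main])
qed

text \<open>An open subset of \<open>U\<close> is a union of sets \<open>b \<noteq> 0\<close>, and
  images commute with unions. Since \<open>f\<close> is fixed before \<open>b\<close>, the same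
  \<open>U\<close> serves for all of them.\<close>

theorem generically_open:
  "\<exists>U. openin (kolchin_on \<Delta> \<delta> n X) U \<and> U \<noteq> {} \<and>
    open_map (kolchin_on \<Delta> \<delta> n U) (kolchin_on \<Delta> \<delta> m Y) \<phi>"
proof -
  obtain f where f: "f \<in> graph_polys" "f \<notin> graph_ideal"
    "\<And>b. b \<in> dpolys \<Delta> n \<Longrightarrow> \<exists>As \<subseteq> dpolys \<Delta> m. \<forall>y\<in>Y.
      attained f b y \<longleftrightarrow>
      (\<exists>a\<in>As. ev y a \<noteq> 0)" by (rule generic_openness) blast
  define U where "U = {x \<in> X. ev (graph x) f \<noteq> 0}"
  show ?thesis
  proof (intro exI[of _ U] conjI)
    show "openin (kolchin_on \<Delta> \<delta> n X) U"
      unfolding U_def by (rule openin_regular_nonzero[OF X_points regular_graph[OF f(1)]])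
    show "U \<noteq> {}" using f(1,2) by (auto simp: U_def graph_ideal_def)
    show "open_map (kolchin_on \<Delta> \<delta> n U) (kolchin_on \<Delta> \<delta> m Y) \<phi>"
      unfolding open_map_def
    proof (intro allI impI)
      fix V assume "openin (kolchin_on \<Delta> \<delta> n U) V"
      then obtain S where S: "S \<subseteq> dpolys \<Delta> n" "V = (points n UNIV - zeros \<delta> n S) \<inter> U"
        unfolding openin_subtopology openin_kolchin by blast
      have "\<forall>b\<in>S. \<exists>As. As \<subseteq> dpolys \<Delta> m \<and> (\<forall>y\<in>Y.
        attained f b y \<longleftrightarrow>
        (\<exists>a\<in>As. ev y a \<noteq> 0))" using f(3) S(1) by blast
      from bchoice[OF this] obtain As where As0: "\<forall>b\<in>S. As b \<subseteq> dpolys \<Delta> m \<and> (\<forall>y\<in>Y.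
          attained f b y \<longleftrightarrow>
          (\<exists>a\<in>As b. ev y a \<noteq> 0))" by (rule exE)
      have As: "As b \<subseteq> dpolys \<Delta> m"
        "y \<in> Y \<Longrightarrow> attained f b y \<longleftrightarrow>
          (\<exists>a\<in>As b. ev y a \<noteq> 0)" if "b \<in> S" for b y
        using bspec[OF As0 that] by simp_all
      have V: "x \<in> V \<longleftrightarrow> x \<in> X \<and> ev (graph x) f \<noteq> 0 \<and> (\<exists>b\<in>S. ev x b \<noteq> 0)" for x
        unfolding S(2) U_def zeros_def using X_points by blast
      have \<phi>Y: "x \<in> X \<Longrightarrow> \<phi> x \<in> Y" for x using mor by (auto simp: morphism_def)
      have "y \<in> \<phi> ` V \<longleftrightarrow> y \<in> (points m UNIV - zeros \<delta> m (\<Union>b\<in>S. As b)) \<inter> Y" for y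
      proof -
        have "y \<in> \<phi> ` V \<longleftrightarrow> y \<in> Y \<and> (\<exists>b\<in>S. attained f b y)"
          unfolding image_iff Bex_def V using \<phi>Y by blast
        also have "\<dots> \<longleftrightarrow> y \<in> Y \<and> (\<exists>b\<in>S. \<exists>a\<in>As b. ev y a \<noteq> 0)" using As(2)[of _ y] by (intro conj_cong refl bex_cong) auto
        also have "\<dots> \<longleftrightarrow> y \<in> (points m UNIV - zeros \<delta> m (\<Union>b\<in>S. As b)) \<inter> Y"
          unfolding zeros_def using Y_points by blast
        finally show ?thesis .
      qed
      then have "\<phi> ` V = (points m UNIV - zeros \<delta> m (\<Union>b\<in>S. As b)) \<inter> Y" by (rule Set.set_eqI)
      moreover have "(\<Union>b\<in>S. As b) \<subseteq> dpolys \<Delta> m" using As(1) by blast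
      ultimately show "openin (kolchin_on \<Delta> \<delta> m Y) (\<phi> ` V)"
        unfolding openin_subtopology openin_kolchin by blast
    qed
  qed
qed

end

theorem mainTheorem4:
  fixes \<Delta> :: "'d set" and \<delta> :: "'d \<Rightarrow> 'a::field_char_0 \<Rightarrow> 'a"
    and n m :: nat and X Y :: "(nat \<Rightarrow> 'a) set" and \<phi> :: "(nat \<Rightarrow> 'a) \<Rightarrow> (nat \<Rightarrow> 'a)"
  assumes "differentially_closed \<Delta> \<delta>"
    and "differential_variety \<Delta> \<delta> n X" and "irreducible_space (subtopology (kolchin \<Delta> \<delta> n) X)"
    and "differential_variety \<Delta> \<delta> m Y" and "irreducible_space (subtopology (kolchin \<Delta> \<delta> m) Y)"
    and "morphism \<Delta> \<delta> n X m Y \<phi>" and "dominant \<Delta> \<delta> X m Y \<phi>"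
  shows "\<exists>U. openin (subtopology (kolchin \<Delta> \<delta> n) X) U \<and> U \<noteq> {} \<and>
    open_map (subtopology (kolchin \<Delta> \<delta> n) U) (subtopology (kolchin \<Delta> \<delta> m) Y) \<phi>"
proof -
  interpret dominant_morphism \<Delta> \<delta> n m X Y \<phi> by unfold_locales (fact assms)+
  show ?thesis by (rule generically_open)
qed

end
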